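(* Let $p\ge 3$ and $q\ge 1$ be integers and let $n$ be sufficiently large. If $G$ is an $n$-vertex non-$p$-partite $B_{p,q}$-free graph, then $\rho(G)\le \rho(Y_p(n))$, with equality if and only if $G\cong Y_p(n)$.
   Context: $\rho(G)$ denotes the spectral radius (largest eigenvalue of the adjacency matrix) of $G$. For integers $p\ge 2$, $q\ge 1$, $B_{p,q}=K_p\nabla qK_1$ is the join of a clique $K_p$ with an independent set of $q$ vertices; $B_{p,q}$-free means containing no subgraph isomorphic to $B_{p,q}$. A graph is non-$p$-partite if its chromatic number exceeds $p$. $T_{m,p}$ is the Turán graph (complete $p$-partite graph on $m$ vertices with parts as equal as possible). $Y_p(n)$: let $T_1,\dots,T_p$ be the color classes of $T_{n-1,p}$ with $\lfloor\frac{n-1}{p}\rfloor=|T_1|\le\cdots\le|T_p|=\lceil\frac{n-1}{p}\rceil$, pick $u_1\in T_1$, $u_2\in T_2$; $Y_p(n)$ is obtained from $T_{n-1,p}$ by deleting the edge $u_1u_2$ and adding a new vertex $u_0$ adjacent to all vertices of $(T_3\cup\cdots\cup T_p)\cup\{u_1,u_2\}$. *)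

theory Defs
  imports "Jordan_Normal_Form.Char_Poly"
begin

definition simple_graph :: "nat \<Rightarrow> (nat \<Rightarrow> nat \<Rightarrow> bool) \<Rightarrow> bool" where
  "simple_graph n E \<longleftrightarrow> (\<forall>u v. E u v \<longrightarrow> u < n \<and> v < n \<and> u \<noteq> v \<and> E v u)"

definition adj_mat :: "nat \<Rightarrow> (nat \<Rightarrow> nat \<Rightarrow> bool) \<Rightarrow> real mat" where
  "adj_mat n E = mat n n (\<lambda>(i, j). if E i j then 1 else 0)"

definition spec_rad :: "nat \<Rightarrow> (nat \<Rightarrow> nat \<Rightarrow> bool) \<Rightarrow> real" where
  "spec_rad n E = Max {k. eigenvalue (adj_mat n E) k}"

definition colorable :: "nat \<Rightarrow> (nat \<Rightarrow> nat \<Rightarrow> bool) \<Rightarrow> nat \<Rightarrow> bool" where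
  "colorable n E k \<longleftrightarrow> (\<exists>c. (\<forall>v<n. c v < k) \<and> (\<forall>u v. u < n \<longrightarrow> v < n \<longrightarrow> E u v \<longrightarrow> c u \<noteq> c v))"

(* G contains B_{p,q} = K_p join q K_1 as a (not necessarily induced) subgraph *)
definition contains_book :: "nat \<Rightarrow> (nat \<Rightarrow> nat \<Rightarrow> bool) \<Rightarrow> nat \<Rightarrow> nat \<Rightarrow> bool" where
  "contains_book n E p q \<longleftrightarrow> (\<exists>K Q. K \<subseteq> {0..<n} \<and> Q \<subseteq> {0..<n} \<and> K \<inter> Q = {} \<and>
      card K = p \<and> card Q = q \<and>
      (\<forall>u\<in>K. \<forall>v\<in>K. u \<noteq> v \<longrightarrow> E u v) \<and> (\<forall>u\<in>K. \<forall>v\<in>Q. E u v))"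

definition graph_iso :: "nat \<Rightarrow> (nat \<Rightarrow> nat \<Rightarrow> bool) \<Rightarrow> (nat \<Rightarrow> nat \<Rightarrow> bool) \<Rightarrow> bool" where
  "graph_iso n E F \<longleftrightarrow> (\<exists>f. bij_betw f {0..<n} {0..<n} \<and>
      (\<forall>u<n. \<forall>v<n. E u v \<longleftrightarrow> F (f u) (f v)))"

(* Y_p(n): vertex 0 is u_0; vertices 1..n-1 form T_{n-1,p}, vertex v lying in the
   part of index (v-1) mod p.  Parts of index p-1 and p-2 are the two smallest
   (play the roles of T_1, T_2); u_1 = p (index p-1), u_2 = p-1 (index p-2). *)
definition Y_graph :: "nat \<Rightarrow> nat \<Rightarrow> nat \<Rightarrow> nat \<Rightarrow> bool" where
  "Y_graph p n u v \<longleftrightarrow> u < n \<and> v < n \<and> u \<noteq> v \<and>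
     ((1 \<le> u \<and> 1 \<le> v \<and> (u - 1) mod p \<noteq> (v - 1) mod p \<and> {u, v} \<noteq> {p - 1, p}) \<or>
      (u = 0 \<and> 1 \<le> v \<and> ((v - 1) mod p < p - 2 \<or> v = p - 1 \<or> v = p)) \<or>
      (v = 0 \<and> 1 \<le> u \<and> ((u - 1) mod p < p - 2 \<or> u = p - 1 \<or> u = p)))"

end

theory Submission
  imports Defs "HOL-Analysis.Function_Topology" "HOL-Analysis.Convex" "HOL-Real_Asymp.Real_Asymp"
begin

text \<open>
  Write \<open>a = 1 - 1/p\<close> and \<open>\<theta> = (p-2)/(p-1)\<close>, and normalise the Perron vector \<open>x\<close> to \<open>\<Sum> x\<^sub>i\<^sup>2 = n\<close>.
  A weighted Turan inequality for book-free graphs shows that \<open>\<rho> \<ge> a n - O(1)\<close> forces \<open>\<Sum> (x\<^sub>i - 1)\<^sup>2 = O(1)\<close>;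
  hence \<open>x\<^sub>v\<close> is close to \<open>d(v)/(a n)\<close>, and all but boundedly many degrees are close to \<open>a n\<close>.
  Away from a bounded set \<open>L\<close> of low-degree vertices the graph is essentially complete \<open>p\<close>-partite, and
  \<open>\<rho> \<le> a (n - \<Sum>\<^bsub>v\<in>L\<^esub> (1 - x\<^sub>v\<^sup>2)) + o(1)\<close>. If the graph is not \<open>p\<close>-colourable, then some vertex, or some pair of
  vertices, has total degree deficit about \<open>n/p\<close>; by concavity this is affordable only if a single vertex \<open>u0\<close>
  carries the whole deficit, so that \<open>x\<^bsub>u0\<^esub>\<close> is close to \<open>\<theta>\<close>. Deleting \<open>u0\<close> leaves a \<open>p\<close>-partite graph; as \<open>\<theta> < 1\<close>, shifting edges
  away from \<open>u0\<close> increases the quadratic form until the graph is \<open>T\<close> minus an edge \<open>u1 u2\<close> plus \<open>u0\<close>, where \<open>T\<close> is complete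
  \<open>p\<close>-partite but not yet balanced. Moving one vertex between classes changes \<open>\<rho>\<close> by
  \<open>y\<^sup>T (A' - A) x / y\<^sup>T x\<close>, where \<open>x\<close> and \<open>y\<close> are the two Perron vectors. To first order this is a positive multiple of the
  change in the number of edges, those at \<open>u0\<close> counted with weight \<open>\<theta>\<close>, which is positive unless the classes are balanced.
\<close>

section \<open>Perron vectors\<close>

declare sum_of_bool_mult_eq[simp del] sum_mult_of_bool_eq[simp del]

text \<open>The number \<theta> is the limiting Perron entry at \<open>u0\<close>: this vertex has
  degree about \<open>(1 - 2/p) * n\<close>, and dividing by \<open>a * n\<close> gives \<theta>.
  The deficit \<open>n / p\<close> arises in two ways. A vertex that cannot be coloured by a class
  without neighbours has degree at most about \<open>(1 - 2/p) * n\<close>, and two adjacent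
  vertices that avoid the same class have degree sum at most about \<open>(2 - 3/p) * n\<close>
  instead of \<open>(2 - 2/p) * n\<close>. The obstacle is precision. The structural estimates
  locate \<rho> only up to o(1), while moving one vertex between nearly balanced classes changes it
  by order \<open>1 / n\<close>. Pairing two Perron vectors gives an exact identity, so no
  second-order expansion is needed; it remains to know differences of class sums of entries up to a
  small constant. The number \<open>q\<close> of pages influences only additive constants, since a
  forbidden configuration always leaves more common neighbours than any fixed
  \<open>q\<close>.\<close>

definition nsum :: "nat \<Rightarrow> (nat \<Rightarrow> nat \<Rightarrow> bool) \<Rightarrow> (nat \<Rightarrow> real) \<Rightarrow> nat \<Rightarrow> real" where
  "nsum n E f i = (\<Sum>j<n. of_bool (E i j) * f j)"

text \<open>The quadratic form of the adjacency matrix A, with \<open>nsum n E f\<close> as the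
  vector A f. Vectors are functions on all naturals of which only the values below \<open>n\<close>
  matter.\<close>

definition quad :: "nat \<Rightarrow> (nat \<Rightarrow> nat \<Rightarrow> bool) \<Rightarrow> (nat \<Rightarrow> real) \<Rightarrow> real" where
  "quad n E f = (\<Sum>i<n. f i * nsum n E f i)"

text \<open>The graph may be disconnected, so the entries are only nonnegative and several such
  vectors can exist; the estimates below hold for each of them.\<close>

definition perron :: "nat \<Rightarrow> (nat \<Rightarrow> nat \<Rightarrow> bool) \<Rightarrow> (nat \<Rightarrow> real) \<Rightarrow> bool" where
  "perron n E x \<longleftrightarrow> (\<forall>i<n. 0 \<le> x i) \<and> (\<Sum>i<n. (x i)\<^sup>2) = real n \<and>
     (\<forall>i<n. nsum n E x i = spec_rad n E * x i)"

section \<open>Linear algebra of \<open>nsum\<close> and \<open>quad\<close>\<close>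

lemma nsum_sym:
  assumes "simple_graph n E"
  shows "(\<Sum>i<n. y i * nsum n E x i) = (\<Sum>i<n. x i * nsum n E y i)"
proof -
  have "(\<Sum>i<n. y i * nsum n E x i) = (\<Sum>i<n. \<Sum>j<n. of_bool (E i j) * y i * x j)"
    by (simp add: nsum_def sum_distrib_left algebra_simps)
  also have "\<dots> = (\<Sum>j<n. \<Sum>i<n. of_bool (E i j) * y i * x j)" by (rule sum.swap)
  also have "\<dots> = (\<Sum>i<n. \<Sum>j<n. of_bool (E i j) * x i * y j)"
    using assms by (intro sum.cong refl) (auto simp: simple_graph_def)
  also have "\<dots> = (\<Sum>i<n. x i * nsum n E y i)"
    by (simp add: nsum_def sum_distrib_left algebra_simps)
  finally show ?thesis .
qed

lemma nsum_cong: "(\<And>i. i < n \<Longrightarrow> f i = g i) \<Longrightarrow> nsum n E f = nsum n E g"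
  by (rule ext) (simp add: nsum_def)

lemma quad_cong: "(\<And>i. i < n \<Longrightarrow> f i = g i) \<Longrightarrow> quad n E f = quad n E g"
  using nsum_cong[of n f g E] by (simp add: quad_def)

lemma quad_scale: "quad n E (\<lambda>i. c * f i) = c\<^sup>2 * quad n E f"
  by (simp add: quad_def nsum_def sum_distrib_left power2_eq_square algebra_simps)

lemma nsum_add: "nsum n E (\<lambda>i. f i + g i) i = nsum n E f i + nsum n E g i"
  by (simp add: nsum_def sum.distrib algebra_simps)

lemma nsum_scale: "nsum n E (\<lambda>i. c * f i) i = c * nsum n E f i"
  by (simp add: nsum_def sum_distrib_left algebra_simps)

lemma quad_add:
  assumes "simple_graph n E"
  shows "quad n E (\<lambda>i. f i + g i) = quad n E f + 2 * (\<Sum>i<n. g i * nsum n E f i) + quad n E g"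
proof -
  have "quad n E (\<lambda>i. f i + g i) = quad n E f + (\<Sum>i<n. f i * nsum n E g i) + (\<Sum>i<n. g i * nsum n E f i) + quad n E g"
    by (simp add: quad_def nsum_add sum.distrib algebra_simps)
  then show ?thesis using nsum_sym[OF assms, of f g] by simp
qed

section \<open>Variational characterisation of the spectral radius\<close>

lemma quad_attains_max:
  assumes "n > 0"
  obtains x where "(\<Sum>i<n. (x i)\<^sup>2) = 1" "\<And>f. (\<Sum>i<n. (f i)\<^sup>2) = 1 \<Longrightarrow> quad n E f \<le> quad n E x"
proof -
  \<comment> \<open>Coordinates from \<open>n\<close> on are pinned to 0, so the unit sphere sits in
    a product of compact sets and Tychonoff's theorem applies.\<close>
  define B where "B = (\<Pi>\<^sub>E i\<in>UNIV. if i < n then {-1..1::real} else {0})"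
  define S where "S = B \<inter> {f. (\<Sum>i<n. (f i)\<^sup>2) = 1}"
  have cB: "compact B"
  proof -
    have "compactin (product_topology (\<lambda>_. euclidean) UNIV) B"
      unfolding B_def by (subst compactin_PiE) auto
    then show ?thesis by (simp add: euclidean_product_topology)
  qed
  have co: "continuous_on T (\<lambda>f::nat\<Rightarrow>real. f i)" for T i
    by (rule continuous_on_product_coordinates[THEN continuous_on_subset]) simp
  have "closed {f::nat\<Rightarrow>real. (\<Sum>i<n. (f i)\<^sup>2) = 1}"
    by (intro closed_Collect_eq continuous_intros co)
  with cB have cS: "compact S" unfolding S_def by blast
  have "(\<lambda>i. if i = 0 then 1 else 0) \<in> S"
    using assms by (auto simp: S_def B_def PiE_def extensional_def if_distrib[of "\<lambda>x. x\<^sup>2"] cong: if_cong)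
  then have ne: "S \<noteq> {}" by blast
  have "continuous_on S (quad n E)"
    unfolding quad_def nsum_def by (intro continuous_intros co)
  from continuous_attains_sup[OF cS ne this] obtain x where x: "x \<in> S" "\<And>y. y \<in> S \<Longrightarrow> quad n E y \<le> quad n E x"
    by blast
  show thesis
  proof (rule that)
    show "(\<Sum>i<n. (x i)\<^sup>2) = 1" using x by (simp add: S_def)
    fix f :: "nat \<Rightarrow> real" assume f: "(\<Sum>i<n. (f i)\<^sup>2) = 1"
    define g where "g i = (if i < n then f i else 0)" for i
    have "(f i)\<^sup>2 \<le> 1" if "i < n" for i
      using member_le_sum[of i "{..<n}" "\<lambda>i. (f i)\<^sup>2"] that f by simp
    then have "-1 \<le> f i \<and> f i \<le> 1" if "i < n" for i
      using that by (simp add: abs_square_le_1 abs_le_iff[symmetric]) (metis abs_le_iff minus_le_iff)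
    then have "g \<in> S" using f by (auto simp: S_def B_def g_def)
    moreover have "quad n E g = quad n E f" by (rule quad_cong) (simp add: g_def)
    ultimately show "quad n E f \<le> quad n E x" using x(2) by metis
  qed
qed

lemma quad_abs_le: "quad n E f \<le> quad n E (\<lambda>i. \<bar>f i\<bar>)"
proof -
  have "f i * (of_bool (E i j) * f j) \<le> \<bar>f i\<bar> * (of_bool (E i j) * \<bar>f j\<bar>)" for i j
    by (cases "E i j") (auto simp: abs_mult[symmetric])
  then show ?thesis unfolding quad_def nsum_def sum_distrib_left by (intro sum_mono) blast
qed

text \<open>The first-order condition at a maximum in elementary form: a line through the origin
  that stays below a parabola through the origin with vertex there must be horizontal.\<close>

lemma linear_part_zero:
  fixes b c :: real
  assumes "\<And>t. b * t \<le> c * t\<^sup>2"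
  shows "b = 0"
proof (rule ccontr)
  assume b: "b \<noteq> 0"
  \<comment> \<open>Any \<open>k > 0\<close> above \<open>c\<close> works: at
    \<open>t = b / k\<close> the hypothesis would give \<open>k \<le> c\<close>.\<close>
  define k where "k = 2 * (\<bar>c\<bar> + 1)"
  have k: "k > 0" "c < k" by (auto simp: k_def)
  have "b * (b / k) \<le> c * (b / k)\<^sup>2" by (rule assms)
  then have "b\<^sup>2 * k \<le> c * b\<^sup>2" using k by (simp add: field_simps power2_eq_square)
  then show False using b k by (simp add: mult.commute)
qed

lemma eigenvalue_adj_mat:
  assumes "simple_graph n E"
  shows "eigenvalue (adj_mat n E) k \<longleftrightarrow> (\<exists>f. (\<exists>i<n. f i \<noteq> 0) \<and> (\<forall>i<n. nsum n E f i = k * f i))"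
proof
  assume "eigenvalue (adj_mat n E) k"
  then obtain v where v: "v \<in> carrier_vec n" "v \<noteq> 0\<^sub>v n" "adj_mat n E *\<^sub>v v = k \<cdot>\<^sub>v v"
    by (auto simp: eigenvalue_def eigenvector_def adj_mat_def)
  have "\<exists>i<n. v $ i \<noteq> 0" using v by (metis carrier_vecD eq_vecI index_zero_vec)
  moreover have "nsum n E (\<lambda>i. v $ i) i = k * v $ i" if "i < n" for i
  proof -
    have "nsum n E (\<lambda>i. v $ i) i = (adj_mat n E *\<^sub>v v) $ i"
      using that v(1) by (auto simp: nsum_def adj_mat_def scalar_prod_def atLeast0LessThan intro!: sum.cong)
    then show ?thesis using v that by simp
  qed
  ultimately show "\<exists>f. (\<exists>i<n. f i \<noteq> 0) \<and> (\<forall>i<n. nsum n E f i = k * f i)" by blast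
next
  assume "\<exists>f. (\<exists>i<n. f i \<noteq> 0) \<and> (\<forall>i<n. nsum n E f i = k * f i)"
  then obtain f where f: "\<exists>i<n. f i \<noteq> 0" "\<And>i. i < n \<Longrightarrow> nsum n E f i = k * f i" by blast
  define v where "v = vec n f"
  have "v \<in> carrier_vec n" "v \<noteq> 0\<^sub>v n" using f(1) by (auto simp: v_def) (metis index_vec index_zero_vec(1))
  moreover have "adj_mat n E *\<^sub>v v = k \<cdot>\<^sub>v v"
  proof (rule eq_vecI)
    fix i assume "i < dim_vec (k \<cdot>\<^sub>v v)"
    then have i: "i < n" by (simp add: v_def)
    have "(adj_mat n E *\<^sub>v v) $ i = nsum n E f i"
      using i by (auto simp: v_def nsum_def adj_mat_def scalar_prod_def atLeast0LessThan intro!: sum.cong)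
    then show "(adj_mat n E *\<^sub>v v) $ i = (k \<cdot>\<^sub>v v) $ i" using f(2) i by (simp add: v_def)
  qed (simp add: v_def adj_mat_def)
  ultimately show "eigenvalue (adj_mat n E) k"
    unfolding eigenvalue_def eigenvector_def by (auto simp: adj_mat_def)
qed

text \<open>A maximiser of the form on the unit sphere can be replaced by its entrywise absolute
  value, which is where the nonnegativity of a Perron vector comes from. Stationarity makes it an
  eigenvector, and testing the form on any other eigenvector shows that its eigenvalue is the
  largest.\<close>

lemma spec_rad_exists:
  assumes "simple_graph n E" "n > 0"
  shows "(\<forall>f. quad n E f \<le> spec_rad n E * (\<Sum>i<n. (f i)\<^sup>2)) \<and> (\<exists>x. perron n E x)"
proof -
  obtain x0 where x0: "(\<Sum>i<n. (x0 i)\<^sup>2) = 1" "\<And>f. (\<Sum>i<n. (f i)\<^sup>2) = 1 \<Longrightarrow> quad n E f \<le> quad n E x0"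
    using quad_attains_max[OF assms(2)] by metis
  define x where "x = (\<lambda>i. \<bar>x0 i\<bar>)"
  have x1: "(\<Sum>i<n. (x i)\<^sup>2) = 1" using x0 by (simp add: x_def)
  define \<mu> where "\<mu> = quad n E x"
  \<comment> \<open>Homogeneity removes the sphere constraint, so the perturbation below needs no
    renormalising.\<close>
  have ub: "quad n E f \<le> \<mu> * (\<Sum>i<n. (f i)\<^sup>2)" for f
  proof (cases "(\<Sum>i<n. (f i)\<^sup>2) = 0")
    case True
    then have "\<forall>i<n. f i = 0" by (simp add: sum_nonneg_eq_0_iff)
    then have "quad n E f = 0" by (simp add: quad_def)
    then show ?thesis using True by simp
  next
    case False
    define s where "s = (\<Sum>i<n. (f i)\<^sup>2)"
    have s: "s > 0" using False unfolding s_def by (metis less_eq_real_def sum_nonneg zero_le_power2)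
    define c where "c = 1 / sqrt s"
    have c2: "c\<^sup>2 = 1 / s" using s by (simp add: c_def power_divide)
    have "(\<Sum>i<n. (c * f i)\<^sup>2) = c\<^sup>2 * s" by (simp add: s_def power_mult_distrib sum_distrib_left)
    then have "(\<Sum>i<n. (c * f i)\<^sup>2) = 1" using c2 s by simp
    then have "quad n E (\<lambda>i. c * f i) \<le> quad n E x0" by (rule x0(2))
    also have "\<dots> \<le> \<mu>" unfolding \<mu>_def x_def by (rule quad_abs_le)
    finally have "quad n E f / s \<le> \<mu>" by (simp add: quad_scale c2)
    then show ?thesis using s by (simp add: s_def[symmetric] field_simps)
  qed
  have ev: "nsum n E x i = \<mu> * x i" if i: "i < n" for i
  proof -
    \<comment> \<open>Perturb \<open>x\<close> by \<open>t\<close> in coordinate \<open>i\<close>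
      alone and compare with \<open>ub\<close>; the coefficient of \<open>t\<close> must
      vanish.\<close>
    have "(2 * (nsum n E x i - \<mu> * x i)) * t \<le> (\<mu> - quad n E (\<lambda>j. of_bool (j = i))) * t\<^sup>2" for t
    proof -
      define e where "e = (\<lambda>j. t * of_bool (j = i))"
      have e1: "(\<Sum>j<n. e j * g j) = t * g i" for g
        using i by (simp add: e_def of_bool_def if_distrib[of "\<lambda>y. t * y"] if_distrib[of "\<lambda>y. y * _"] cong: if_cong)
      have "quad n E (\<lambda>i. x i + e i) \<le> \<mu> * (\<Sum>i<n. (x i + e i)\<^sup>2)" by (rule ub)
      moreover have "quad n E (\<lambda>i. x i + e i) = \<mu> + 2 * (t * nsum n E x i) + quad n E e"
        by (simp add: quad_add[OF assms(1)] e1 \<mu>_def)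
      moreover have "quad n E e = t\<^sup>2 * quad n E (\<lambda>j. of_bool (j = i))"
        unfolding e_def by (rule quad_scale)
      moreover have "(\<Sum>i<n. (x i + e i)\<^sup>2) = (\<Sum>i<n. (x i)\<^sup>2) + 2 * (\<Sum>j<n. e j * x j) + (\<Sum>j<n. e j * e j)"
        by (simp add: power2_eq_square algebra_simps sum.distrib sum_distrib_left)
      moreover have "e i = t" by (simp add: e_def)
      ultimately show ?thesis using x1 by (simp add: e1 algebra_simps power2_eq_square)
    qed
    from linear_part_zero[OF this] show ?thesis by simp
  qed
  have "\<exists>i<n. x i \<noteq> 0"
  proof (rule ccontr)
    assume "\<not> ?thesis"
    then have "(\<Sum>i<n. (x i)\<^sup>2) = 0" by simp
    with x1 show False by simp
  qed
  then have evm: "eigenvalue (adj_mat n E) \<mu>" using ev unfolding eigenvalue_adj_mat[OF assms(1)] by auto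
  have le: "k \<le> \<mu>" if k: "eigenvalue (adj_mat n E) k" for k
  proof -
    obtain f i where f: "i < n" "f i \<noteq> 0" "\<forall>i<n. nsum n E f i = k * f i"
      using k unfolding eigenvalue_adj_mat[OF assms(1)] by auto
    have "quad n E f = k * (\<Sum>i<n. (f i)\<^sup>2)"
      using f(3) by (simp add: quad_def sum_distrib_left power2_eq_square algebra_simps)
    moreover have "(\<Sum>i<n. (f i)\<^sup>2) > 0" using f by (intro sum_pos2[of _ i]) auto
    ultimately show ?thesis using ub[of f] by simp
  qed
  \<comment> \<open>\<open>spec_rad\<close> is a \<open>Max\<close>, which is informative only for a
    finite set of eigenvalues.\<close>
  have fin: "finite {k. eigenvalue (adj_mat n E) k}"
  proof -
    have c: "adj_mat n E \<in> carrier_mat n n" by (simp add: adj_mat_def)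
    have "char_poly (adj_mat n E) \<noteq> 0" using degree_monic_char_poly[OF c] by auto
    then have "finite {k. poly (char_poly (adj_mat n E)) k = 0}" by (rule poly_roots_finite)
    then show ?thesis using eigenvalue_root_char_poly[OF c] by simp
  qed
  have sr: "spec_rad n E = \<mu>" unfolding spec_rad_def using fin evm le by (intro Max_eqI) auto
  have "perron n E (\<lambda>i. sqrt n * x i)"
    unfolding perron_def sr
  proof (intro conjI allI impI)
    show "0 \<le> sqrt (real n) * x i" for i by (simp add: x_def)
    have "(\<Sum>i<n. (sqrt (real n) * x i)\<^sup>2) = real n * (\<Sum>i<n. (x i)\<^sup>2)"
      by (simp add: power_mult_distrib sum_distrib_left)
    then show "(\<Sum>i<n. (sqrt (real n) * x i)\<^sup>2) = real n" using x1 by simp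
    show "nsum n E (\<lambda>i. sqrt (real n) * x i) i = \<mu> * (sqrt (real n) * x i)" if "i < n" for i
      using ev[OF that] by (simp add: nsum_scale)
  qed
  then show ?thesis using ub sr by blast
qed

lemmas quad_le_spec_rad = spec_rad_exists[THEN conjunct1, rule_format]
lemmas perron_exists = spec_rad_exists[THEN conjunct2]

lemma quad_perron: "perron n E x \<Longrightarrow> quad n E x = spec_rad n E * n"
  by (simp add: perron_def quad_def power2_eq_square sum_distrib_left[symmetric] mult.left_commute[of _ "spec_rad n E"])

section \<open>The weighted Turan inequality and near-uniform Perron vectors\<close>

text \<open>Relative to a vertex set, because the Turan induction passes to neighbourhoods and a
  later application restricts to the vertices of high degree.\<close>

definition book_on :: "nat set \<Rightarrow> (nat \<Rightarrow> nat \<Rightarrow> bool) \<Rightarrow> nat \<Rightarrow> nat \<Rightarrow> bool" where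
  "book_on S E p q \<longleftrightarrow> (\<exists>K Q. K \<subseteq> S \<and> Q \<subseteq> S \<and> K \<inter> Q = {} \<and> card K = p \<and> card Q = q \<and>
      (\<forall>u\<in>K. \<forall>v\<in>K. u \<noteq> v \<longrightarrow> E u v) \<and> (\<forall>u\<in>K. \<forall>v\<in>Q. E u v))"

lemma contains_book_eq: "contains_book n E p q \<longleftrightarrow> book_on {..<n} E p q"
  by (simp add: contains_book_def book_on_def atLeast0LessThan)

lemma book_on_neighbourhood:
  assumes "finite S" "v \<in> S" "\<And>u w. E u w \<Longrightarrow> E w u" "\<And>u. \<not> E u u" "p \<ge> 1"
    and "book_on {w\<in>S. E v w} E p q"
  shows "book_on S E (Suc p) q"
proof -
  obtain K Q where KQ: "K \<subseteq> {w\<in>S. E v w}" "Q \<subseteq> {w\<in>S. E v w}" "K \<inter> Q = {}" "card K = p" "card Q = q"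
      "\<forall>u\<in>K. \<forall>v\<in>K. u \<noteq> v \<longrightarrow> E u v" "\<forall>u\<in>K. \<forall>v\<in>Q. E u v"
    using assms(6) unfolding book_on_def by auto
  have "finite K" using KQ(1) assms(1) by (auto intro: finite_subset)
  moreover have "v \<notin> K" "v \<notin> Q" using KQ assms(4) by auto
  ultimately have "card (insert v K) = Suc p" "insert v K \<inter> Q = {}" using KQ by auto
  moreover have "\<forall>u\<in>insert v K. \<forall>w\<in>insert v K. u \<noteq> w \<longrightarrow> E u w" "\<forall>u\<in>insert v K. \<forall>w\<in>Q. E u w"
    using KQ assms(3) by blast+
  ultimately show ?thesis using KQ assms(2) unfolding book_on_def
    by (intro exI[of _ "insert v K"] exI[of _ Q]) auto
qed

text \<open>Induction on \<open>p\<close> via neighbourhoods: \<open>N(v)\<close> contains no book with \<open>p - 1\<close> in place of \<open>p\<close>, and weighted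
  degrees inside \<open>N(v)\<close> are at least \<open>d(w) + d(v) - W\<close>, where \<open>W\<close> is the total weight.\<close>

lemma weighted_turan:
  fixes y :: "nat \<Rightarrow> real"
  assumes "finite S" "p \<ge> 1" "q \<ge> 1"
    and "\<And>u v. E u v \<Longrightarrow> E v u" "\<And>u. \<not> E u u" "\<not> book_on S E p q"
    and "\<And>v. v \<in> S \<Longrightarrow> 0 \<le> y v \<and> y v \<le> m" "m \<ge> 0"
  shows "(\<Sum>u\<in>S. y u * (\<Sum>v\<in>S. of_bool (E u v) * y v))
           \<le> (1 - 1 / p) * (\<Sum>u\<in>S. y u)\<^sup>2 + real (q - 1) * m * (\<Sum>u\<in>S. y u)"
  using assms(2,1,6,7)
proof (induction p arbitrary: S rule: nat_induct_at_least)
  case base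
  \<comment> \<open>For \<open>p = 1\<close> a book is a star with \<open>q\<close> leaves, so every
    vertex has at most \<open>q - 1\<close> neighbours, each of weight at most
    \<open>m\<close>.\<close>
  have "(\<Sum>v\<in>S. of_bool (E u v) * y v) \<le> real (q - 1) * m" if u: "u \<in> S" for u
  proof -
    have "card {v\<in>S. E u v} \<le> q - 1"
    proof (rule ccontr)
      assume "\<not> ?thesis"
      then obtain Q where Q: "Q \<subseteq> {v\<in>S. E u v}" "card Q = q"
        using assms(3) by (metis One_nat_def Suc_pred less_eq_Suc_le not_less obtain_subset_with_card_n)
      have "book_on S E 1 q" unfolding book_on_def
        using Q u assms(5) by (intro exI[of _ "{u}"] exI[of _ Q]) auto
      with base show False by simp
    qed
    then have "real (card {v\<in>S. E u v}) * m \<le> real (q - 1) * m"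
      using assms(8) by (intro mult_right_mono) auto
    moreover have "(\<Sum>v\<in>S. of_bool (E u v) * y v) = (\<Sum>v\<in>{v\<in>S. E u v}. y v)"
      using base(1) by (intro sum.mono_neutral_cong_right) auto
    moreover have "\<dots> \<le> (\<Sum>v\<in>{v\<in>S. E u v}. m)" using base by (intro sum_mono) auto
    ultimately show ?thesis by simp
  qed
  then have "(\<Sum>u\<in>S. y u * (\<Sum>v\<in>S. of_bool (E u v) * y v)) \<le> (\<Sum>u\<in>S. y u * (real (q - 1) * m))"
    using base by (intro sum_mono mult_left_mono) auto
  then show ?case by (simp add: sum_distrib_right[symmetric] mult.commute del: of_nat_diff)
next
  case (Suc p)
  define d where "d v = (\<Sum>w\<in>S. of_bool (E v w) * y w)" for v
  define N where "N v = {w\<in>S. E v w}" for v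
  define W where "W = (\<Sum>u\<in>S. y u)"
  define T where "T = (\<Sum>u\<in>S. y u * d u)"
  define D where "D = (\<Sum>u\<in>S. y u * (d u)\<^sup>2)"
  define c where "c = real (q - 1) * m"
  have c0: "c \<ge> 0" using assms(8) by (simp add: c_def)
  have y0: "0 \<le> y v" if "v \<in> S" for v using Suc.prems(3) that by blast
  have finN: "finite (N v)" for v using Suc.prems(1) by (simp add: N_def)
  have dN: "d v = (\<Sum>w\<in>N v. y w)" for v
    unfolding d_def N_def using Suc.prems(1) by (intro sum.mono_neutral_cong_right) auto
  have swapN: "(\<Sum>v\<in>S. y v * (\<Sum>w\<in>N v. y w * d w)) = D"
  proof -
    have "(\<Sum>v\<in>S. y v * (\<Sum>w\<in>N v. y w * d w)) = (\<Sum>v\<in>S. \<Sum>w\<in>S. of_bool (E v w) * (y v * y w * d w))"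
      unfolding sum_distrib_left N_def using Suc.prems(1)
      by (intro sum.cong refl sum.mono_neutral_cong_left) auto
    also have "\<dots> = (\<Sum>w\<in>S. \<Sum>v\<in>S. of_bool (E v w) * (y v * y w * d w))" by (rule sum.swap)
    also have "\<dots> = (\<Sum>w\<in>S. \<Sum>v\<in>S. y w * d w * (of_bool (E w v) * y v))"
      using assms(4) by (intro sum.cong refl) (auto simp: of_bool_def)
    also have "\<dots> = (\<Sum>w\<in>S. y w * d w * d w)" by (simp only: sum_distrib_left[symmetric] d_def)
    finally show ?thesis by (simp add: D_def power2_eq_square mult.assoc)
  qed
  have key: "(d v)\<^sup>2 - W * d v + (\<Sum>w\<in>N v. y w * d w) \<le> (1 - 1 / p) * (d v)\<^sup>2 + c * d v" if v: "v \<in> S" for v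
  proof -
    have "\<not> book_on (N v) E p q"
      using book_on_neighbourhood[of S v E p q] Suc.prems(1,2) v assms(4,5) Suc.hyps unfolding N_def by blast
    then have IH: "(\<Sum>u\<in>N v. y u * (\<Sum>w\<in>N v. of_bool (E u w) * y w)) \<le> (1 - 1 / p) * (d v)\<^sup>2 + c * d v"
      unfolding dN c_def using Suc.prems(3) finN[of v] by (intro Suc.IH) (auto simp: N_def)
    have "d v + d u - W \<le> (\<Sum>w\<in>N v. of_bool (E u w) * y w)" for u
    proof -
      have "(\<Sum>w\<in>N v. of_bool (E u w) * y w) = (\<Sum>w\<in>N v \<inter> N u. y w)"
        unfolding N_def using Suc.prems(1) by (intro sum.mono_neutral_cong_right) auto
      moreover have "(\<Sum>w\<in>N v \<union> N u. y w) + (\<Sum>w\<in>N v \<inter> N u. y w) = d v + d u"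
        unfolding dN using finN[of v] finN[of u] by (rule sum.union_inter)
      moreover have "(\<Sum>w\<in>N v \<union> N u. y w) \<le> W" unfolding W_def
        using Suc.prems(1) y0 by (intro sum_mono2) (auto simp: N_def)
      ultimately show ?thesis by linarith
    qed
    then have "(\<Sum>u\<in>N v. y u * (d v + d u - W)) \<le> (\<Sum>u\<in>N v. y u * (\<Sum>w\<in>N v. of_bool (E u w) * y w))"
      using y0 by (intro sum_mono mult_left_mono) (auto simp: N_def)
    moreover have "(\<Sum>u\<in>N v. y u * (d v + d u - W)) = (\<Sum>u\<in>N v. y u) * d v - (\<Sum>u\<in>N v. y u) * W + (\<Sum>u\<in>N v. y u * d u)"
      by (simp add: algebra_simps sum.distrib sum_subtractf sum_distrib_left)
    ultimately show ?thesis using IH by (simp add: dN[symmetric] power2_eq_square mult.commute)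
  qed
  \<comment> \<open>Weighting by \<open>y v\<close> and summing turns the local inequalities into
    one between the first moment \<open>T\<close> and the second moment \<open>D\<close> of the
    weighted degrees.\<close>
  have "(\<Sum>v\<in>S. y v * ((d v)\<^sup>2 - W * d v + (\<Sum>w\<in>N v. y w * d w))) \<le> (\<Sum>v\<in>S. y v * ((1 - 1 / p) * (d v)\<^sup>2 + c * d v))"
    using key y0 by (intro sum_mono mult_left_mono) auto
  moreover have "(\<Sum>v\<in>S. y v * ((d v)\<^sup>2 - W * d v + (\<Sum>w\<in>N v. y w * d w))) = D - W * T + D"
  proof -
    have "(\<Sum>v\<in>S. y v * ((d v)\<^sup>2 - W * d v + (\<Sum>w\<in>N v. y w * d w)))
        = (\<Sum>v\<in>S. y v * (d v)\<^sup>2 - W * (y v * d v) + y v * (\<Sum>w\<in>N v. y w * d w))"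
      by (intro sum.cong refl) (simp only: distrib_left right_diff_distrib mult.left_commute)
    also have "\<dots> = D - W * T + D"
      by (simp only: sum.distrib sum_subtractf sum_distrib_left[symmetric] D_def[symmetric] T_def[symmetric] swapN)
    finally show ?thesis .
  qed
  moreover have "(\<Sum>v\<in>S. y v * ((1 - 1 / p) * (d v)\<^sup>2 + c * d v)) = (1 - 1 / p) * D + c * T"
    unfolding D_def T_def sum_distrib_left sum.distrib[symmetric] by (intro sum.cong) (auto simp: algebra_simps)
  ultimately have I1: "(1 + 1 / p) * D \<le> W * T + c * T" by (simp add: algebra_simps)
  have W0: "W \<ge> 0" unfolding W_def using y0 by (rule sum_nonneg)
  have d0: "d v \<ge> 0" for v unfolding d_def using y0 by (intro sum_nonneg) auto
  have T0: "T \<ge> 0" unfolding T_def using y0 d0 by (intro sum_nonneg) auto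
  \<comment> \<open>Cauchy-Schwarz \<open>T\<^sup>2 \<le> W * D\<close> as the nonnegativity of a
    variance, kept multiplied by \<open>W\<close> so that nothing is divided by a possibly zero
    total weight.\<close>
  have "0 \<le> (\<Sum>v\<in>S. y v * (W * d v - T)\<^sup>2)" using y0 by (intro sum_nonneg) auto
  also have "\<dots> = (\<Sum>v\<in>S. W\<^sup>2 * (y v * (d v)\<^sup>2) - 2 * W * T * (y v * d v) + T\<^sup>2 * y v)"
    by (intro sum.cong) (auto simp: algebra_simps power2_eq_square)
  also have "\<dots> = W\<^sup>2 * D - 2 * W * T * T + T\<^sup>2 * W"
    unfolding D_def T_def W_def sum_distrib_left sum.distrib sum_subtractf by simp
  finally have CS: "0 \<le> W * (W * D - T\<^sup>2)" by (simp add: algebra_simps power2_eq_square)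
  have goal: "T \<le> (1 - 1 / Suc p) * (W\<^sup>2 + c * W)"
  proof (cases "T = 0")
    case True
    have "1 / real (Suc p) \<le> 1" by (simp add: field_simps)
    then show ?thesis using True W0 c0 by (intro order.trans[OF eq_refl mult_nonneg_nonneg]) auto
  next
    case False
    have "W \<noteq> 0"
    proof
      assume "W = 0"
      then have "\<forall>v\<in>S. y v = 0" using Suc.prems(1) y0 by (simp add: W_def sum_nonneg_eq_0_iff)
      then show False using False by (simp add: T_def)
    qed
    then have "T\<^sup>2 \<le> W * D" using CS W0 by (simp add: zero_le_mult_iff)
    then have "(1 + 1 / p) * T\<^sup>2 \<le> (1 + 1 / p) * (W * D)" by (intro mult_left_mono) auto
    then have "(1 + 1 / p) * T\<^sup>2 \<le> W * ((1 + 1 / p) * D)" by (simp add: mult.left_commute)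
    also have "\<dots> \<le> W * (W * T + c * T)" using I1 W0 by (rule mult_left_mono)
    finally have "T * ((1 + 1 / p) * T) \<le> T * (W\<^sup>2 + c * W)" by (simp add: algebra_simps power2_eq_square)
    then have "(1 + 1 / p) * T \<le> W\<^sup>2 + c * W" using False T0 by simp
    \<comment> \<open>The recursion of the Turan densities: dividing by \<open>1 + 1/p\<close> is
      multiplying by the density for \<open>p + 1\<close> classes.\<close>
    moreover have "1 - 1 / real (Suc p) = 1 / (1 + 1 / p)" using Suc.hyps by (simp add: field_simps)
    moreover have "(1 + 1 / real p) > 0" by (simp add: add_pos_nonneg)
    ultimately show ?thesis by (simp add: pos_le_divide_eq mult.commute[of T])
  qed
  also have "\<dots> \<le> (1 - 1 / Suc p) * W\<^sup>2 + c * W"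
    using c0 W0 mult_left_le_one_le[of "c * W" "1 - 1 / Suc p"] by (simp add: distrib_left)
  finally show ?case by (simp add: T_def d_def W_def c_def)
qed

text \<open>Let \<open>W\<close> be the sum of the entries. The Turan inequality gives
  \<open>\<rho> * n \<le> a * W\<^sup>2 + O(W)\<close>, and the hypothesis leaves an error of order
  \<open>n\<close> only, so \<open>W \<ge> n - O(1)\<close>. Under the normalisation,
  \<open>2 * n - 2 * W\<close> is the sum of squares to be bounded.\<close>

lemma perron_near_uniform:
  fixes p q :: nat and C0 :: real
  assumes p: "p \<ge> 2" and q: "q \<ge> 1"
  shows "\<exists>C. \<forall>\<^sub>F n in sequentially. \<forall>E x. simple_graph n E \<longrightarrow> \<not> contains_book n E p q \<longrightarrow> perron n E x \<longrightarrow>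
    (1 - 1 / p) * n - C0 \<le> spec_rad n E \<longrightarrow>
    (\<Sum>i<n. (x i - 1)\<^sup>2) \<le> C \<and> spec_rad n E \<le> (1 - 1 / p) * n + C \<and> (\<forall>i<n. x i \<le> 3)"
proof -
  define a where "a = 1 - 1 / real p"
  have a: "a \<ge> 1/2" "a \<le> 1" using p by (auto simp: a_def field_simps)
  \<comment> \<open>As \<open>a \<ge> 1/2\<close>, a drop of \<open>W\<close> below
    \<open>n - D\<close> would lose more than
    \<open>D * n / 2 = (\<bar>C0\<bar> + 3 * q) * n\<close>, the whole error available.\<close>
  define D where "D = 2 * (\<bar>C0\<bar> + 3 * q)"
  have D: "D \<ge> 6 * q" by (simp add: D_def)
  have "\<forall>\<^sub>F n in sequentially. real n \<ge> D + 6 * \<bar>C0\<bar> + 1" by real_asymp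
  then have "\<forall>\<^sub>F n in sequentially. \<forall>E x. simple_graph n E \<longrightarrow> \<not> contains_book n E p q \<longrightarrow> perron n E x \<longrightarrow>
    a * n - C0 \<le> spec_rad n E \<longrightarrow>
    (\<Sum>i<n. (x i - 1)\<^sup>2) \<le> 2 * D \<and> spec_rad n E \<le> a * n + 2 * D \<and> (\<forall>i<n. x i \<le> 3)"
  proof (eventually_elim, intro allI impI)
    fix n E x
    assume n: "real n \<ge> D + 6 * \<bar>C0\<bar> + 1" and E: "simple_graph n E" and nb: "\<not> contains_book n E p q"
      and x: "perron n E x" and \<rho>: "a * n - C0 \<le> spec_rad n E"
    define W where "W = (\<Sum>i<n. x i)"
    have n0: "n > 0" using n D by (intro gr0I) auto
    have x0: "0 \<le> x i" if "i < n" for i using x that by (auto simp: perron_def)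
    have sq: "(\<Sum>i<n. (x i - 1)\<^sup>2) = 2 * n - 2 * W"
    proof -
      have "(\<Sum>i<n. (x i - 1)\<^sup>2) = (\<Sum>i<n. (x i)\<^sup>2) - 2 * W + n"
        by (simp add: power2_diff sum.distrib sum_subtractf W_def sum_distrib_left)
      then show ?thesis using x by (simp add: perron_def)
    qed
    have Wn: "W \<le> n" using sum_nonneg[of "{..<n}" "\<lambda>i. (x i - 1)\<^sup>2"] sq by simp
    have W0: "W \<ge> 0" unfolding W_def using x0 by (intro sum_nonneg) auto
    have \<rho>3: "spec_rad n E \<ge> n / 3"
    proof -
      have "a * n \<ge> 1/2 * n" using a by (intro mult_right_mono) auto
      then show ?thesis using \<rho> n D by linarith
    qed
    \<comment> \<open>Crude, but it must precede the Turan bound, whose error term contains the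
      largest weight: \<open>\<rho> \<ge> n / 3\<close>, and every neighbour sum is at most
      \<open>n\<close>.\<close>
    have x3: "x i \<le> 3" if i: "i < n" for i
    proof -
      have "n / 3 * x i \<le> spec_rad n E * x i" using \<rho>3 x0[OF i] by (rule mult_right_mono)
      also have "\<dots> = nsum n E x i" using x i by (simp add: perron_def)
      also have "\<dots> \<le> W" unfolding nsum_def W_def using x0 by (intro sum_mono) (auto simp: of_bool_def)
      also have "\<dots> \<le> n" by (rule Wn)
      finally show ?thesis using n0 by (simp add: field_simps)
    qed
    have "spec_rad n E * n = (\<Sum>u\<in>{..<n}. x u * (\<Sum>v\<in>{..<n}. of_bool (E u v) * x v))"
      using quad_perron[OF x] by (simp add: quad_def nsum_def)
    also have "\<dots> \<le> (1 - 1 / p) * W\<^sup>2 + real (q - 1) * 3 * W" unfolding W_def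
      using E nb x0 x3 p q by (intro weighted_turan) (auto simp: simple_graph_def contains_book_eq)
    finally have up: "spec_rad n E * n \<le> a * W\<^sup>2 + real (q - 1) * 3 * W" by (simp add: a_def)
    have "real (q - 1) * 3 * W \<le> real q * 3 * n" using Wn W0 by (intro mult_mono) auto
    then have qW: "real (q - 1) * 3 * W \<le> 3 * q * n" by simp
    have "a * W\<^sup>2 \<le> a * n\<^sup>2" using a Wn W0 by (intro mult_left_mono power_mono) auto
    then have "spec_rad n E * n \<le> (a * n + 3 * q) * n" using up qW by (simp add: algebra_simps power2_eq_square)
    then have \<rho>up: "spec_rad n E \<le> a * n + 3 * q" using n0 by simp
    have "W \<ge> n - D"
    proof (rule ccontr)
      assume "\<not> ?thesis"
      then have "W\<^sup>2 \<le> (n - D)\<^sup>2" using W0 by (intro power_mono) auto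
      moreover have "(n - D)\<^sup>2 = n\<^sup>2 - D * n - D * (n - D)" by (simp add: power2_eq_square algebra_simps)
      moreover have "D * (n - D) > 0" using n D q by (intro mult_pos_pos) auto
      ultimately have 1: "W\<^sup>2 < n\<^sup>2 - D * n" by linarith
      have "(a * n - C0) * n \<le> a * W\<^sup>2 + 3 * q * n"
        using up qW mult_right_mono[OF \<rho>, of n] by linarith
      then have "a * (n\<^sup>2 - W\<^sup>2) \<le> (\<bar>C0\<bar> + 3 * q) * n"
        using abs_ge_self[of C0, THEN mult_right_mono, of n] by (simp add: algebra_simps power2_eq_square)
      moreover have "a * (n\<^sup>2 - W\<^sup>2) > 1/2 * (D * n)"
      proof -
        have "1/2 * (D * n) < 1/2 * (n\<^sup>2 - W\<^sup>2)" using 1 by simp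
        also have "\<dots> \<le> a * (n\<^sup>2 - W\<^sup>2)" using a Wn W0 by (intro mult_right_mono) (auto intro: power_mono)
        finally show ?thesis .
      qed
      ultimately show False by (simp add: D_def algebra_simps)
    qed
    then show "(\<Sum>i<n. (x i - 1)\<^sup>2) \<le> 2 * D \<and> spec_rad n E \<le> a * n + 2 * D \<and> (\<forall>i<n. x i \<le> 3)"
      using sq \<rho>up x3 D by auto
  qed
  then show ?thesis unfolding a_def by blast
qed

section \<open>Perron entries and degrees\<close>

definition deg :: "nat \<Rightarrow> (nat \<Rightarrow> nat \<Rightarrow> bool) \<Rightarrow> nat \<Rightarrow> nat" where
  "deg n E v = card {w. w < n \<and> E v w}"

lemma nsum_one: "nsum n E (\<lambda>_. 1) v = deg n E v"
proof -
  have "nsum n E (\<lambda>_. 1) v = (\<Sum>w\<in>{w. w < n \<and> E v w}. 1)"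
    unfolding nsum_def by (intro sum.mono_neutral_cong_right) auto
  then show ?thesis by (simp add: deg_def)
qed

text \<open>\<open>\<rho> * x i\<close> differs from the degree by the sum of \<open>x j - 1\<close>
  over the neighbours. By Cauchy-Schwarz and \<open>perron_near_uniform\<close> this is only of
  order \<open>sqrt n\<close>, whereas \<rho> is linear in \<open>n\<close>.\<close>

lemma perron_entry_degree:
  fixes p q :: nat and C0 \<epsilon> :: real
  assumes p: "p \<ge> 2" and q: "q \<ge> 1" and \<epsilon>: "\<epsilon> > 0"
  shows "\<forall>\<^sub>F n in sequentially. \<forall>E x. simple_graph n E \<longrightarrow> \<not> contains_book n E p q \<longrightarrow> perron n E x \<longrightarrow>
    (1 - 1 / p) * n - C0 \<le> spec_rad n E \<longrightarrow>
    (\<forall>i<n. \<bar>x i - deg n E i / ((1 - 1 / p) * n)\<bar> \<le> \<epsilon>)"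
proof -
  define a where "a = 1 - 1 / real p"
  have a: "a \<ge> 1/2" "a \<le> 1" using p by (auto simp: a_def field_simps)
  obtain C where C: "\<forall>\<^sub>F n in sequentially. \<forall>E x. simple_graph n E \<longrightarrow> \<not> contains_book n E p q \<longrightarrow> perron n E x \<longrightarrow>
    (1 - 1 / p) * n - C0 \<le> spec_rad n E \<longrightarrow>
    (\<Sum>i<n. (x i - 1)\<^sup>2) \<le> C \<and> spec_rad n E \<le> (1 - 1 / p) * n + C \<and> (\<forall>i<n. x i \<le> 3)"
    using perron_near_uniform[OF p q] by blast
  define M where "M = \<bar>C\<bar> + \<bar>C0\<bar> + 1"
  have M: "M > 0" by (simp add: M_def)
  have "\<forall>\<^sub>F n in sequentially. sqrt (real n * M) + 3 * M \<le> \<epsilon> / 2 * real n"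
    using \<epsilon> M by real_asymp
  then have ev: "\<forall>\<^sub>F n in sequentially. n > 0 \<and> sqrt (real n * M) + 3 * M \<le> \<epsilon> / 2 * real n"
    using eventually_gt_at_top by eventually_elim auto
  from C ev show ?thesis
  proof (eventually_elim, intro allI impI)
    fix n E x i
    assume *: "\<forall>E x. simple_graph n E \<longrightarrow> \<not> contains_book n E p q \<longrightarrow> perron n E x \<longrightarrow>
      (1 - 1 / p) * n - C0 \<le> spec_rad n E \<longrightarrow>
      (\<Sum>i<n. (x i - 1)\<^sup>2) \<le> C \<and> spec_rad n E \<le> (1 - 1 / p) * n + C \<and> (\<forall>i<n. x i \<le> 3)"
      and n: "n > 0 \<and> sqrt (real n * M) + 3 * M \<le> \<epsilon> / 2 * real n"
      and h: "simple_graph n E" "\<not> contains_book n E p q" "perron n E x" "(1 - 1 / p) * n - C0 \<le> spec_rad n E"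
      and i: "i < n"
    define \<rho> where "\<rho> = spec_rad n E"
    note ** = *[rule_format, OF h]
    have ei: "\<rho> * x i = nsum n E x i" using h i by (simp add: perron_def \<rho>_def)
    have "\<rho> * x i - deg n E i = (\<Sum>j<n. of_bool (E i j) * (x j - 1))"
      unfolding ei nsum_one[symmetric] by (simp add: nsum_def sum_subtractf algebra_simps)
    also have "\<bar>\<dots>\<bar> \<le> sqrt (real n * M)"
    proof (rule real_le_rsqrt)
      have "\<bar>\<Sum>j<n. of_bool (E i j) * (x j - 1)\<bar>\<^sup>2 \<le> (\<Sum>j<n. (of_bool (E i j))\<^sup>2) * (\<Sum>j<n. (x j - 1)\<^sup>2)"
        unfolding power2_abs by (rule Cauchy_Schwarz_ineq_sum)
      also have "\<dots> \<le> (\<Sum>j<n. 1) * M" using ** unfolding M_def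
        by (intro mult_mono sum_mono sum_nonneg) (auto simp: of_bool_def)
      finally show "\<bar>\<Sum>j<n. of_bool (E i j) * (x j - 1)\<bar>\<^sup>2 \<le> real n * M" by simp
    qed
    finally have 1: "\<bar>\<rho> * x i - deg n E i\<bar> \<le> sqrt (real n * M)" .
    have x: "0 \<le> x i" "x i \<le> 3" using h i ** by (auto simp: perron_def)
    have "\<bar>(a * n - \<rho>)\<bar> \<le> M" using ** h(4) by (auto simp: a_def \<rho>_def M_def)
    then have 2: "\<bar>(a * n - \<rho>) * x i\<bar> \<le> M * 3" unfolding abs_mult using x by (intro mult_mono) auto
    have "\<bar>a * n * x i - deg n E i\<bar> \<le> sqrt (real n * M) + 3 * M"
      using 1 2 by (simp add: algebra_simps abs_le_iff)
    also have "\<dots> \<le> 1/2 * (\<epsilon> * n)" using n by simp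
    also have "\<dots> \<le> a * (\<epsilon> * n)" using a \<epsilon> by (intro mult_right_mono) auto
    finally have 3: "\<bar>a * n * x i - deg n E i\<bar> \<le> \<epsilon> * (a * n)" by (simp add: mult_ac)
    have an: "a * n > 0" using a n by simp
    have "x i - deg n E i / (a * n) = (a * n * x i - deg n E i) / (a * n)" using a n by (simp add: field_simps)
    then have "\<bar>x i - deg n E i / (a * n)\<bar> = \<bar>a * n * x i - deg n E i\<bar> / (a * n)" using an by (simp add: abs_divide)
    also have "\<dots> \<le> \<epsilon>" using 3 an by (simp add: pos_divide_le_eq)
    finally show "\<bar>x i - deg n E i / ((1 - 1 / p) * n)\<bar> \<le> \<epsilon>" by (simp add: a_def)
  qed
qed

section \<open>Multipartite structure of book-free graphs\<close>

definition clique :: "(nat \<Rightarrow> nat \<Rightarrow> bool) \<Rightarrow> nat set \<Rightarrow> bool" where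
  "clique E K \<longleftrightarrow> (\<forall>u\<in>K. \<forall>v\<in>K. u \<noteq> v \<longrightarrow> E u v)"

definition common_nbrs :: "nat \<Rightarrow> (nat \<Rightarrow> nat \<Rightarrow> bool) \<Rightarrow> nat set \<Rightarrow> nat set" where
  "common_nbrs n E S = {u. u < n \<and> (\<forall>v\<in>S. E v u)}"

lemma common_nbrs_subset: "common_nbrs n E S \<subseteq> {..<n}"
  by (auto simp: common_nbrs_def)

lemma finite_common_nbrs [simp]: "finite (common_nbrs n E S)"
  by (rule finite_subset[OF common_nbrs_subset]) simp

lemma simple_graphD:
  assumes "simple_graph n E"
  shows "E u v \<Longrightarrow> E v u" "\<not> E u u" "E u v \<Longrightarrow> u < n" "E u v \<Longrightarrow> v < n"
  using assms by (auto simp: simple_graph_def)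

lemma clique_common_nbrs_less:
  assumes "simple_graph n E" "\<not> contains_book n E p q" "K \<subseteq> {..<n}" "clique E K" "card K = p"
  shows "card (common_nbrs n E K) < q"
proof (rule ccontr)
  assume "\<not> ?thesis"
  then obtain Q where Q: "Q \<subseteq> common_nbrs n E K" "card Q = q"
    by (meson not_less obtain_subset_with_card_n)
  have "K \<inter> Q = {}" using Q simple_graphD(2)[OF assms(1)] by (auto simp: common_nbrs_def)
  moreover have "Q \<subseteq> {..<n}" "\<forall>u\<in>K. \<forall>v\<in>Q. E u v" using Q by (auto simp: common_nbrs_def)
  ultimately have "book_on {..<n} E p q"
    unfolding book_on_def using assms(3-5) Q(2) unfolding clique_def by blast
  with assms(2) show False by (simp add: contains_book_eq)
qed

lemma deg_complement: "card {w. w < n \<and> \<not> E v w} = n - deg n E v"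
proof -
  have "{w. w < n \<and> \<not> E v w} = {..<n} - {w. w < n \<and> E v w}" by auto
  moreover have "card ({..<n} - {w. w < n \<and> E v w}) = card {..<n} - card {w. w < n \<and> E v w}"
    by (rule card_Diff_subset) auto
  ultimately show ?thesis by (simp add: deg_def)
qed

lemma deg_le: "deg n E v \<le> n"
proof -
  have "card {w. w < n \<and> E v w} \<le> card {..<n}" by (intro card_mono) auto
  then show ?thesis by (simp add: deg_def)
qed

lemma sum_card_swap:
  assumes "finite A" "finite B"
  shows "(\<Sum>a\<in>A. card {b\<in>B. R a b}) = (\<Sum>b\<in>B. card {a\<in>A. R a b})"
proof -
  have "(\<Sum>a\<in>A. card {b\<in>B. R a b}) = (\<Sum>a\<in>A. \<Sum>b\<in>B. of_bool (R a b))"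
    using assms by (intro sum.cong refl) (simp add: Int_def)
  also have "\<dots> = (\<Sum>b\<in>B. \<Sum>a\<in>A. of_bool (R a b))" by (rule sum.swap)
  also have "\<dots> = (\<Sum>b\<in>B. card {a\<in>A. R a b})"
    using assms by (intro sum.cong refl) (simp add: Int_def)
  finally show ?thesis .
qed

text \<open>Double counting of pairs of a clique vertex and a neighbour: a vertex that sees at least
  \<open>p\<close> of the \<open>p + 1\<close> clique vertices is a common neighbour of a
  \<open>p\<close>-clique, and each of the \<open>p + 1\<close> subcliques has fewer than
  \<open>q\<close> of these.\<close>

lemma large_clique_degree_sum:
  assumes E: "simple_graph n E" and nb: "\<not> contains_book n E p q" and p: "p \<ge> 1"
    and K: "K \<subseteq> {..<n}" "clique E K" "card K = Suc p"
  shows "(\<Sum>v\<in>K. deg n E v) \<le> (p - 1) * n + 2 * (Suc p * q)"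
proof -
  have finK: "finite K" using K(1) finite_subset by auto
  define m where "m u = card {v\<in>K. E v u}" for u
  define B where "B = {u\<in>{..<n}. m u \<ge> p}"
  have "B \<subseteq> (\<Union>w\<in>K. common_nbrs n E (K - {w}))"
  proof
    fix u assume u: "u \<in> B"
    show "u \<in> (\<Union>w\<in>K. common_nbrs n E (K - {w}))"
    proof (cases "{v\<in>K. E v u} = K")
      case True
      then have "\<forall>v\<in>K. E v u" by blast
      moreover have "K \<noteq> {}" using K(3) by auto
      ultimately show ?thesis using u by (auto simp: B_def common_nbrs_def)
    next
      case False
      then obtain w where w: "w \<in> K" "\<not> E w u" by blast
      have "card (K - {w}) \<le> card {v\<in>K. E v u}" using u w K finK by (simp add: B_def m_def)
      then have "{v\<in>K. E v u} = K - {w}" using w finK by (intro card_seteq) auto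
      then show ?thesis using u w by (auto simp: B_def common_nbrs_def)
    qed
  qed
  then have "card B \<le> card (\<Union>w\<in>K. common_nbrs n E (K - {w}))" using finK by (intro card_mono) auto
  also have "\<dots> \<le> (\<Sum>w\<in>K. card (common_nbrs n E (K - {w})))" using finK by (rule card_UN_le)
  also have "\<dots> \<le> (\<Sum>w\<in>K. q)"
  proof (rule sum_mono)
    fix w assume w: "w \<in> K"
    have "card (common_nbrs n E (K - {w})) < q"
      using K w finK by (intro clique_common_nbrs_less[OF E nb]) (auto simp: clique_def)
    then show "card (common_nbrs n E (K - {w})) \<le> q" by simp
  qed
  finally have B: "card B \<le> Suc p * q" using K by simp
  have "(\<Sum>v\<in>K. deg n E v) = (\<Sum>v\<in>K. card {u\<in>{..<n}. E v u})" by (simp add: deg_def)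
  also have "\<dots> = (\<Sum>u<n. m u)" unfolding m_def by (rule sum_card_swap[OF finK]) simp
  \<comment> \<open>The summand 2 lifts \<open>p - 1\<close> to the trivial bound
    \<open>p + 1\<close> on the exceptional set \<open>B\<close>.\<close>
  also have "\<dots> \<le> (\<Sum>u<n. (p - 1) + 2 * of_bool (u \<in> B))"
  proof (rule sum_mono)
    fix u assume u: "u \<in> {..<n}"
    have "m u \<le> card K" unfolding m_def using finK by (intro card_mono) auto
    then show "m u \<le> (p - 1) + 2 * of_bool (u \<in> B)" using u K p by (cases "p \<le> m u") (auto simp: B_def)
  qed
  also have "\<dots> = (p - 1) * n + 2 * card B"
  proof -
    have "{..<n} \<inter> B = B" by (auto simp: B_def)
    then show ?thesis by (simp add: sum.distrib sum_distrib_left[symmetric])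
  qed
  also have "\<dots> \<le> (p - 1) * n + 2 * (Suc p * q)" using B by simp
  finally show ?thesis .
qed

text \<open>Greedy choice: at most \<open>p - 1\<close> earlier vertices rule out at most
  \<open>t\<close> vertices each, and together with \<open>L\<close> these are fewer than
  \<open>n\<close>.\<close>

lemma clique_exists:
  fixes n :: nat and E :: "nat \<Rightarrow> nat \<Rightarrow> bool"
  assumes E: "simple_graph n E" and L: "finite L"
    and d: "\<And>v. v < n \<Longrightarrow> v \<notin> L \<Longrightarrow> real n - deg n E v \<le> t"
    and t: "real (p - 1) * t + card L < n" "t \<ge> 0" and k: "k \<le> p"
  shows "\<exists>K. K \<subseteq> {..<n} - L \<and> clique E K \<and> card K = k"
  using k
proof (induction k)
  case 0
  show ?case by (intro exI[of _ "{}"]) (auto simp: clique_def)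
next
  case (Suc k)
  then obtain K where K: "K \<subseteq> {..<n} - L" "clique E K" "card K = k" by auto
  have finK: "finite K" using K(1) finite_subset by auto
  have "\<exists>u<n. u \<notin> L \<and> (\<forall>v\<in>K. E v u)"
  proof (rule ccontr)
    assume "\<not> ?thesis"
    then have "{..<n} \<subseteq> L \<union> (\<Union>v\<in>K. {u. u < n \<and> \<not> E v u})" by blast
    then have "card {..<n} \<le> card (L \<union> (\<Union>v\<in>K. {u. u < n \<and> \<not> E v u}))"
      using L finK by (intro card_mono) auto
    then have "n \<le> card (L \<union> (\<Union>v\<in>K. {u. u < n \<and> \<not> E v u}))" by simp
    also have "\<dots> \<le> card L + card (\<Union>v\<in>K. {u. u < n \<and> \<not> E v u})" by (rule card_Un_le)
    also have "card (\<Union>v\<in>K. {u. u < n \<and> \<not> E v u}) \<le> (\<Sum>v\<in>K. card {u. u < n \<and> \<not> E v u})"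
      using finK by (rule card_UN_le)
    finally have "n \<le> card L + (\<Sum>v\<in>K. card {u. u < n \<and> \<not> E v u})" by simp
    then have "real n \<le> card L + (\<Sum>v\<in>K. real (card {u. u < n \<and> \<not> E v u}))"
      unfolding of_nat_sum[symmetric] of_nat_add[symmetric] of_nat_le_iff .
    also have "(\<Sum>v\<in>K. real (card {u. u < n \<and> \<not> E v u})) \<le> (\<Sum>v\<in>K. t)"
    proof (rule sum_mono)
      fix v assume "v \<in> K"
      then show "real (card {u. u < n \<and> \<not> E v u}) \<le> t"
        using K(1) d[of v] deg_le[of n E v] by (auto simp: deg_complement of_nat_diff)
    qed
    also have "\<dots> = real k * t" using K by simp
    also have "\<dots> \<le> real (p - 1) * t" using Suc.prems t(2) by (intro mult_right_mono) auto
    finally show False using t by simp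
  qed
  then obtain u where u: "u < n" "u \<notin> L" "\<forall>v\<in>K. E v u" by blast
  have uK: "u \<notin> K" using u simple_graphD(2)[OF E] by blast
  have "clique E (insert u K)" using K(2) u(3) simple_graphD(1)[OF E] unfolding clique_def by blast
  moreover have "insert u K \<subseteq> {..<n} - L" using K(1) u by auto
  moreover have "card (insert u K) = Suc k" using uK finK K(3) by simp
  ultimately show ?case by blast
qed

text \<open>Completes a clique \<open>S\<close> greedily by one vertex from each class of \<open>I\<close> but the last, which supplies the \<open>q\<close> pages.\<close>

lemma greedy_book:
  assumes E: "simple_graph n E" and nb: "\<not> contains_book n E p q" and q: "q \<ge> 1" and e: "e \<ge> 0"
    and near: "\<And>i j u. i \<in> I \<Longrightarrow> j \<in> I \<Longrightarrow> i \<noteq> j \<Longrightarrow> u \<in> V i \<Longrightarrow> real (card (V j - {w. E u w})) \<le> e"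
    and V: "\<And>i. i \<in> I \<Longrightarrow> V i \<subseteq> {..<n}"
    and I: "finite I" "I \<noteq> {}" and S: "S \<subseteq> {..<n}" "clique E S" "card S + card I = Suc p"
    and big: "\<And>i. i \<in> I \<Longrightarrow> real (card (V i \<inter> common_nbrs n E S)) \<ge> real (card I - 1) * e + q"
  shows False
  using I near V S big
proof (induction I arbitrary: S rule: finite_ne_induct)
  case (singleton i)
  have "real q \<le> card (V i \<inter> common_nbrs n E S)" using singleton.prems(6)[of i] by simp
  also have "\<dots> \<le> card (common_nbrs n E S)" by (simp add: card_mono)
  finally show False using clique_common_nbrs_less[OF E nb, of S] singleton.prems by simp
next
  case (insert i I)
  have finS: "finite S" using insert.prems(3) finite_subset by blast
  have cI: "card I \<ge> 1" using insert.hyps by (simp add: Suc_leI card_gt_0_iff)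
  have "0 < real (card (V i \<inter> common_nbrs n E S))"
  proof -
    have "0 < real (card (insert i I) - 1) * e + q" using q e by (intro add_nonneg_pos) auto
    then show ?thesis using insert.prems(6)[of i] by simp
  qed
  then obtain w where w: "w \<in> V i" "w \<in> common_nbrs n E S" by (metis Int_iff card.empty ex_in_conv less_irrefl of_nat_0)
  have wS: "w \<notin> S" using w simple_graphD(2)[OF E] by (auto simp: common_nbrs_def)
  show False
  proof (rule insert.IH[of "insert w S"])
    show "real (card (V j - {w. E u w})) \<le> e" if "i' \<in> I" "j \<in> I" "i' \<noteq> j" "u \<in> V i'" for i' j u
      using insert.prems(1)[of i' j u] that by simp
    show "V j \<subseteq> {..<n}" if "j \<in> I" for j using insert.prems(2) that by simp
    show "insert w S \<subseteq> {..<n}" using insert.prems(3) w common_nbrs_subset by blast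
    show "clique E (insert w S)"
      using insert.prems(4) w(2) simple_graphD(1)[OF E] unfolding clique_def common_nbrs_def by blast
    show "card (insert w S) + card I = Suc p" using insert.prems(5) insert.hyps wS finS by simp
    fix j assume j: "j \<in> I"
    then have ij: "i \<noteq> j" using insert.hyps by auto
    \<comment> \<open>Adding \<open>w\<close> to the clique costs each remaining class at most
      \<open>e\<close> common neighbours, which is paid for by one fewer class in the factor of
      \<open>e\<close>.\<close>
    have "V j \<inter> common_nbrs n E S \<subseteq> (V j \<inter> common_nbrs n E (insert w S)) \<union> (V j - {u. E w u})"
      by (auto simp: common_nbrs_def)
    moreover have "finite (V j)" using insert.prems(2)[of j] j finite_subset by blast
    ultimately have "card (V j \<inter> common_nbrs n E S) \<le> card (V j \<inter> common_nbrs n E (insert w S)) + card (V j - {u. E w u})"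
      by (meson card_Un_le card_mono finite_Diff finite_Int finite_UnI order_trans)
    then have "real (card (V j \<inter> common_nbrs n E S)) \<le> card (V j \<inter> common_nbrs n E (insert w S)) + real (card (V j - {u. E w u}))"
      by linarith
    moreover have "real (card (V j - {u. E w u})) \<le> e" using insert.prems(1)[of i j w] ij j w by simp
    moreover have "real (card (V j \<inter> common_nbrs n E S)) \<ge> real (card I) * e + q"
      using insert.prems(6)[of j] j insert.hyps by simp
    moreover have "real (card I) * e = real (card I - 1) * e + e" using cI by (simp add: algebra_simps of_nat_diff)
    ultimately show "real (card (V j \<inter> common_nbrs n E (insert w S))) \<ge> real (card I - 1) * e + q" by linarith
  qed
qed

text \<open>\<open>(p + 1) * (1 - 1/p) = p - 1/p\<close> exceeds the factor \<open>p - 1\<close> of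
  \<open>large_clique_degree_sum\<close> by at least 1/2, more than all error terms. Vertices of
  high degree thus span no clique on \<open>p + 1\<close> vertices, whatever \<open>q\<close>
  is.\<close>

lemma no_high_degree_clique:
  fixes \<epsilon> :: real and p q n :: nat
  assumes E: "simple_graph n E" and nb: "\<not> contains_book n E p q" and p: "p \<ge> 2" and n0: "n > 0"
    and \<epsilon>: "\<epsilon> > 0" "\<epsilon> \<le> 1 / (4 * p^2)" and n: "2 * real (p + 1) * q \<le> \<epsilon> * n"
    and K: "K \<subseteq> {..<n}" "clique E K" "card K = Suc p"
    and d: "\<And>v. v \<in> K \<Longrightarrow> deg n E v \<ge> (1 - 1 / p - \<epsilon>) * n"
  shows False
proof -
  have pe: "p * \<epsilon> \<le> 1 / (4 * p)" using \<epsilon>(2) p by (simp add: field_simps power2_eq_square)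
  have pe2: "1 / real p \<le> 1 / 2" using p by (simp add: field_simps)
  have "(\<Sum>v\<in>K. deg n E v) \<le> (p - 1) * n + 2 * (Suc p * q)"
    using p by (intro large_clique_degree_sum[OF E nb _ K]) auto
  then have "real (\<Sum>v\<in>K. deg n E v) \<le> real ((p - 1) * n + 2 * (Suc p * q))" by (rule of_nat_mono)
  also have "\<dots> = (real p - 1) * n + 2 * (real (Suc p) * q)" unfolding of_nat_add of_nat_mult using p by (simp add: of_nat_diff)
  finally have "real (\<Sum>v\<in>K. deg n E v) \<le> (real p - 1) * n + 2 * (real (Suc p) * q)" .
  moreover have "(\<Sum>v\<in>K. (1 - 1 / p - \<epsilon>) * n) \<le> real (\<Sum>v\<in>K. deg n E v)"
    unfolding of_nat_sum using d by (intro sum_mono) auto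
  ultimately have "real (Suc p) * ((1 - 1 / p - \<epsilon>) * n) \<le> (real p - 1) * n + \<epsilon> * n"
    using K n by (simp add: algebra_simps)
  then have "(real (Suc p) * (1 - 1 / p - \<epsilon>)) * n \<le> (real p - 1 + \<epsilon>) * n" by (simp add: algebra_simps)
  then have "real (Suc p) * (1 - 1 / p - \<epsilon>) \<le> real p - 1 + \<epsilon>" using n0 by simp
  moreover have "real (Suc p) * (1 - 1 / p - \<epsilon>) = real p - 1 / p - p * \<epsilon> - \<epsilon>" using p by (simp add: field_simps)
  ultimately have "1 \<le> 1 / p + p * \<epsilon> + 2 * \<epsilon>" by linarith
  moreover have "2 * \<epsilon> \<le> p * \<epsilon>" using p \<epsilon> by (intro mult_right_mono) auto
  moreover have "1 / (4 * real p) \<le> 1/8" using p by (simp add: field_simps)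
  ultimately show False using pe pe2 by linarith
qed

text \<open>A clique on \<open>p\<close> vertices of high degree serves as a coordinate system: each
  of its vertices has at most about \<open>n / p\<close> non-neighbours and hardly any vertex is
  adjacent to all of them, so almost every vertex misses exactly one, which names its class.\<close>

lemma multipartite_core:
  fixes \<epsilon> :: real and p q n :: nat
  assumes E: "simple_graph n E" and nb: "\<not> contains_book n E p q" and p: "p \<ge> 2" and q: "q \<ge> 1"
    and \<epsilon>: "\<epsilon> > 0" "\<epsilon> \<le> 1 / (4 * p^2)" and n: "2 * real (p + 1) * q \<le> \<epsilon> * n"
    and L: "L \<subseteq> {..<n}" "card L \<le> \<epsilon> * n"
    and d: "\<And>v. v < n \<Longrightarrow> v \<notin> L \<Longrightarrow> deg n E v \<ge> (1 - 1 / p - \<epsilon>) * n"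
  shows "\<exists>V. (\<forall>i<p. V i \<subseteq> {..<n} \<and> card (V i) \<ge> (1 / p - (2 * real p + 1) * \<epsilon>) * n) \<and>
     (\<forall>i<p. \<forall>j<p. i \<noteq> j \<longrightarrow> V i \<inter> V j = {} \<and> (\<forall>u\<in>V i. real (card (V j - {w. E u w})) \<le> (2 * real p + 2) * \<epsilon> * n))"
proof -
  have n0: "real n > 0"
  proof (cases "n = 0")
    case True
    then have "2 * real (p + 1) * q \<le> 0" using n by simp
    then show ?thesis using q by (simp add: mult_le_0_iff)
  qed simp
  have finL: "finite L" using L(1) finite_subset by auto
  have pe: "p * \<epsilon> \<le> 1 / (4 * p)" using \<epsilon>(2) p by (simp add: field_simps power2_eq_square)
  have pe2: "1 / real p \<le> 1 / 2" using p by (simp add: field_simps)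
  have d': "real n - deg n E v \<le> (1 / p + \<epsilon>) * n" if "v < n" "v \<notin> L" for v
    using d[OF that] by (simp add: algebra_simps)
  obtain K where K: "K \<subseteq> {..<n} - L" "clique E K" "card K = p"
  proof -
    have "real (p - 1) * ((1 / p + \<epsilon>) * n) + card L \<le> ((real p - 1) * (1 / p + \<epsilon>) + \<epsilon>) * n"
      using L(2) p by (simp add: algebra_simps of_nat_diff)
    also have "(real p - 1) * (1 / p + \<epsilon>) + \<epsilon> = 1 - (1 / p - p * \<epsilon>)" using p by (simp add: field_simps)
    also have "\<dots> < 1"
    proof -
      have "1 / (4 * real p) < 1 / p" using p by (simp add: field_simps)
      then show ?thesis using pe by linarith
    qed
    finally have "real (p - 1) * ((1 / p + \<epsilon>) * n) + card L < n" using n0 by simp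
    from clique_exists[OF E finL d' this _ order_refl] show thesis using that \<epsilon> by auto
  qed
  have finK: "finite K" using K(1) finite_subset by auto
  obtain f where f: "bij_betw f {..<p} K"
    using ex_bij_betw_nat_finite[OF finK] K(3) by (auto simp: atLeast0LessThan)
  have fK: "f i \<in> K" if "i < p" for i using f that by (auto simp: bij_betw_def)
  have fn: "f i < n" "f i \<notin> L" if "i < p" for i using fK[OF that] K(1) by auto
  have sym: "E u v \<longleftrightarrow> E v u" for u v using simple_graphD(1)[OF E] by blast
  define V where "V i = {u. u < n \<and> u \<notin> L \<and> \<not> E (f i) u \<and> (\<forall>j<p. j \<noteq> i \<longrightarrow> E (f j) u)}" for i
  have Vn: "V i \<subseteq> {..<n} - L" for i by (auto simp: V_def)
  have finV: "finite (V i)" for i by (simp add: V_def)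
  have disj: "V i \<inter> V j = {}" if "i < p" "j < p" "i \<noteq> j" for i j using that by (auto simp: V_def)
  have free: "\<not> (K' \<subseteq> {..<n} - L \<and> clique E K' \<and> card K' = Suc p)" for K'
  proof
    assume K': "K' \<subseteq> {..<n} - L \<and> clique E K' \<and> card K' = Suc p"
    have "K' \<subseteq> {..<n}" "clique E K'" "card K' = Suc p" using K' by auto
    moreover have "(1 - 1 / p - \<epsilon>) * n \<le> deg n E v" if "v \<in> K'" for v using d[of v] that K' by auto
    ultimately show False by (intro no_high_degree_clique[OF E nb p _ \<epsilon> n, of K']) (use n0 in auto)
  qed
  \<comment> \<open>Two adjacent vertices of one class would extend the clique without
    \<open>f i\<close> to \<open>p + 1\<close> vertices of high degree.\<close>
  have indep: "\<not> E u v" if u: "u \<in> V i" and v: "v \<in> V i" and i: "i < p" for u v i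
  proof
    assume uv: "E u v"
    then have ne: "u \<noteq> v" using simple_graphD(2)[OF E] by blast
    let ?K = "insert u (insert v (K - {f i}))"
    have adj: "E w x" if "w \<in> K - {f i}" "x \<in> V i" for w x
    proof -
      from that obtain j where j: "j < p" "w = f j" using f by (auto simp: bij_betw_def)
      then show ?thesis using that by (auto simp: V_def)
    qed
    have un: "u \<notin> K - {f i}" using adj[OF _ u] simple_graphD(2)[OF E] by blast
    have vn: "v \<notin> K - {f i}" using adj[OF _ v] simple_graphD(2)[OF E] by blast
    have "card ?K = Suc p" using un vn ne finK K(3) fK[OF i] p by simp
    moreover have "clique E ?K" unfolding clique_def
    proof (intro ballI impI)
      fix x y assume "x \<in> ?K" "y \<in> ?K" "x \<noteq> y"
      then show "E x y" using uv adj u v K(2) sym unfolding clique_def by blast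
    qed
    moreover have "?K \<subseteq> {..<n} - L" using Vn u v K(1) by blast
    ultimately show False using free by blast
  qed
  have up: "card (V i) \<le> (1 / p + \<epsilon>) * n" if i: "i < p" for i
  proof (cases "V i = {}")
    case False
    then obtain u where u: "u \<in> V i" by blast
    have "V i \<subseteq> {w. w < n \<and> \<not> E u w}" using indep[OF u _ i] Vn by auto
    then have "card (V i) \<le> n - deg n E u" unfolding deg_complement[symmetric] by (intro card_mono) auto
    then have "real (card (V i)) \<le> real n - deg n E u" using deg_le[of n E u] by (simp add: of_nat_diff)
    also have "\<dots> \<le> (1 / p + \<epsilon>) * n" using u Vn by (intro d') auto
    finally show ?thesis .
  qed (use \<epsilon> in auto)
  have tot: "(\<Sum>i<p. real (card (V i))) \<ge> n - (p + 1) * \<epsilon> * n - 2 * q"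
  proof -
    \<comment> \<open>\<open>m u\<close> counts the clique vertices missed by \<open>u\<close>. The
      total is at most about \<open>n\<close>, and fewer than \<open>q\<close> vertices have
      \<open>m u = 0\<close>, so few can have \<open>m u \<ge> 2\<close>.\<close>
    define m where "m u = card {i\<in>{..<p}. \<not> E (f i) u}" for u
    define Z where "Z = common_nbrs n E K"
    define M where "M = {u\<in>{..<n}. m u \<ge> 2}"
    have Z: "card Z < q" unfolding Z_def using K by (intro clique_common_nbrs_less[OF E nb]) auto
    have mZ: "m u = 0 \<longleftrightarrow> u \<in> Z" if "u < n" for u
    proof -
      have "m u = 0 \<longleftrightarrow> (\<forall>i<p. E (f i) u)" by (auto simp: m_def)
      also have "\<dots> \<longleftrightarrow> (\<forall>v\<in>K. E v u)" using f by (auto simp: bij_betw_def)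
      finally show ?thesis using that by (simp add: Z_def common_nbrs_def)
    qed
    have "(\<Sum>u<n. m u) = (\<Sum>i<p. card {u\<in>{..<n}. \<not> E (f i) u})"
      unfolding m_def by (rule sum_card_swap) auto
    also have "\<dots> = (\<Sum>i<p. n - deg n E (f i))" using deg_complement by simp
    finally have "real (\<Sum>u<n. m u) = (\<Sum>i<p. real n - deg n E (f i))"
      using deg_le by (simp add: of_nat_diff)
    also have "\<dots> \<le> (\<Sum>i<p. (1 / p + \<epsilon>) * n)" using fn d' by (intro sum_mono) auto
    also have "\<dots> = (1 + p * \<epsilon>) * n" using p by (simp add: field_simps)
    finally have s1: "real (\<Sum>u<n. m u) \<le> (1 + p * \<epsilon>) * n" .
    have "(\<Sum>u<n. 1 + of_bool (u \<in> M)) \<le> (\<Sum>u<n. m u + of_bool (u \<in> Z))"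
    proof (rule sum_mono)
      fix u assume "u \<in> {..<n}"
      then show "1 + of_bool (u \<in> M) \<le> m u + of_bool (u \<in> Z)"
        using mZ[of u] by (cases "m u = 0") (auto simp: M_def)
    qed
    moreover have "{..<n} \<inter> M = M" "{..<n} \<inter> Z = Z" by (auto simp: M_def Z_def common_nbrs_def)
    moreover have "(\<Sum>u<n. 1 + of_bool (u \<in> M)) = n + card ({..<n} \<inter> M)"
      by (simp only: sum.distrib) simp
    ultimately have "n + card M \<le> (\<Sum>u<n. m u) + card Z" by (simp add: sum.distrib)
    then have "real n + card M \<le> real (\<Sum>u<n. m u) + card Z"
      unfolding of_nat_add[symmetric] of_nat_le_iff .
    then have M: "card M \<le> p * \<epsilon> * n + card Z" using s1 by (simp add: algebra_simps)
    have "{..<n} \<subseteq> (\<Union>i<p. V i) \<union> (L \<union> (Z \<union> M))"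
    proof
      fix u assume u: "u \<in> {..<n}"
      show "u \<in> (\<Union>i<p. V i) \<union> (L \<union> (Z \<union> M))"
      proof (rule ccontr)
        assume c: "\<not> ?thesis"
        then have "m u = 1" using mZ[of u] u by (auto simp: M_def)
        then obtain i where i: "{i\<in>{..<p}. \<not> E (f i) u} = {i}" unfolding m_def by (auto simp: card_1_singleton_iff)
        then have "i < p" "\<not> E (f i) u" "\<forall>j<p. j \<noteq> i \<longrightarrow> E (f j) u" by blast+
        then have "u \<in> V i" using u c by (auto simp: V_def)
        then show False using c \<open>i < p\<close> by blast
      qed
    qed
    then have "card {..<n} \<le> card ((\<Union>i<p. V i) \<union> (L \<union> (Z \<union> M)))"
      using finL finV by (intro card_mono) (auto simp: M_def Z_def)
    also have "\<dots> \<le> card (\<Union>i<p. V i) + (card L + (card Z + card M))"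
      by (meson add_left_mono card_Un_le order_trans)
    also have "card (\<Union>i<p. V i) \<le> (\<Sum>i<p. card (V i))" by (rule card_UN_le) simp
    finally have "n \<le> (\<Sum>i<p. card (V i)) + (card L + (card Z + card M))" by simp
    then have "real n \<le> real ((\<Sum>i<p. card (V i)) + (card L + (card Z + card M)))" by (rule of_nat_mono)
    then show ?thesis using M Z L(2) by (simp add: algebra_simps)
  qed
  \<comment> \<open>The total size minus the upper bounds for the other \<open>p - 1\<close>
    classes.\<close>
  have lo: "card (V i) \<ge> (1 / p - (2 * real p + 1) * \<epsilon>) * n" if i: "i < p" for i
  proof -
    have "(\<Sum>j<p. real (card (V j))) = real (card (V i)) + (\<Sum>j\<in>{..<p}-{i}. real (card (V j)))"
      using i by (simp add: sum.remove)
    also have "(\<Sum>j\<in>{..<p}-{i}. real (card (V j))) \<le> (\<Sum>j\<in>{..<p}-{i}. (1 / p + \<epsilon>) * n)"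
      using up by (intro sum_mono) auto
    also have "\<dots> = (real p - 1) * ((1 / p + \<epsilon>) * n)" using i by (simp add: of_nat_diff)
    also have "\<dots> = (1 - 1 / p + (p - 1) * \<epsilon>) * n" using p by (simp add: field_simps)
    finally have "real (card (V i)) \<ge> n - (p + 1) * \<epsilon> * n - 2 * q - (1 - 1 / p + (p - 1) * \<epsilon>) * n"
      using tot by linarith
    moreover have "2 * real q \<le> \<epsilon> * n"
    proof -
      have "2 * real q * 1 \<le> 2 * real q * (p + 1)" using p by (intro mult_left_mono) auto
      also have "\<dots> = 2 * real (p + 1) * q" by simp
      finally show ?thesis using n by simp
    qed
    ultimately show ?thesis using p by (simp add: algebra_simps of_nat_diff)
  qed
  \<comment> \<open>The non-neighbours of \<open>u\<close> include its own class of size about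
    \<open>n / p\<close>, which already uses up nearly all of its degree deficit.\<close>
  have near: "real (card (V j - {w. E u w})) \<le> (2 * real p + 2) * \<epsilon> * n"
    if i: "i < p" and j: "j < p" and ij: "i \<noteq> j" and u: "u \<in> V i" for i j u
  proof -
    have "(V j - {w. E u w}) \<union> V i \<subseteq> {w. w < n \<and> \<not> E u w}" using indep[OF u _ i] Vn by auto
    then have "card ((V j - {w. E u w}) \<union> V i) \<le> n - deg n E u" unfolding deg_complement[symmetric] by (intro card_mono) auto
    moreover have "card ((V j - {w. E u w}) \<union> V i) = card (V j - {w. E u w}) + card (V i)"
      using finV disj[OF i j ij] by (intro card_Un_disjoint) auto
    ultimately have "real (card (V j - {w. E u w})) + card (V i) \<le> real n - deg n E u"
      using deg_le[of n E u] by (simp add: of_nat_diff flip: of_nat_add)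
    also have "\<dots> \<le> (1 / p + \<epsilon>) * n" using u Vn by (intro d') auto
    finally show ?thesis using lo[OF i] by (simp add: algebra_simps)
  qed
  show ?thesis using Vn lo disj near by (intro exI[of _ V]) blast
qed

text \<open>A vertex takes the colour of a class in which it has no neighbour. If no class
  qualifies, or if adjacent vertices share one, the degree hypotheses leave room for a greedy book.
  \<open>U\<close> is the whole vertex set while a bad vertex is sought, and all vertices but
  \<open>u0\<close> once it is found.\<close>

lemma partial_colouring:
  fixes \<epsilon> \<eta> :: real and p q n :: nat
  assumes E: "simple_graph n E" and nb: "\<not> contains_book n E p q" and p: "p \<ge> 2" and q: "q \<ge> 1"
    and \<epsilon>: "\<epsilon> > 0" "\<epsilon> \<le> 1 / (4 * p^2)" and n: "2 * real (p + 1) * q \<le> \<epsilon> * n"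
    and L: "L \<subseteq> {..<n}" "card L \<le> \<epsilon> * n"
    and d: "\<And>v. v < n \<Longrightarrow> v \<notin> L \<Longrightarrow> deg n E v \<ge> (1 - 1 / p - \<epsilon>) * n"
    and \<eta>: "8 * (real p + 1)^2 * \<epsilon> \<le> \<eta>" and U: "U \<subseteq> {..<n}"
    and U1: "\<And>v. v \<in> U \<Longrightarrow> deg n E v \<ge> (1 - 2 / p + \<eta>) * n"
    and U2: "\<And>u v. u \<in> U \<Longrightarrow> v \<in> U \<Longrightarrow> u \<noteq> v \<Longrightarrow> E u v \<Longrightarrow> real (deg n E u) + deg n E v \<ge> (2 - 3 / p + \<eta>) * n"
  shows "\<exists>c. (\<forall>v\<in>U. c v < p) \<and> (\<forall>u\<in>U. \<forall>v\<in>U. E u v \<longrightarrow> c u \<noteq> c v)"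
proof -
  obtain V where V: "\<And>i. i < p \<Longrightarrow> V i \<subseteq> {..<n}" "\<And>i. i < p \<Longrightarrow> card (V i) \<ge> (1 / p - (2 * real p + 1) * \<epsilon>) * n"
     and disj: "\<And>i j. i < p \<Longrightarrow> j < p \<Longrightarrow> i \<noteq> j \<Longrightarrow> V i \<inter> V j = {}"
     and near: "\<And>i j u. i < p \<Longrightarrow> j < p \<Longrightarrow> i \<noteq> j \<Longrightarrow> u \<in> V i \<Longrightarrow> real (card (V j - {w. E u w})) \<le> (2 * real p + 2) * \<epsilon> * n"
  proof -
    have "\<exists>V. (\<forall>i<p. V i \<subseteq> {..<n} \<and> card (V i) \<ge> (1 / p - (2 * real p + 1) * \<epsilon>) * n) \<and>
       (\<forall>i<p. \<forall>j<p. i \<noteq> j \<longrightarrow> V i \<inter> V j = {} \<and> (\<forall>u\<in>V i. real (card (V j - {w. E u w})) \<le> (2 * real p + 2) * \<epsilon> * n))"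
      by (rule multipartite_core[OF E nb p q \<epsilon> n L]) (rule d)
    then obtain V where
      "(\<forall>i<p. V i \<subseteq> {..<n} \<and> card (V i) \<ge> (1 / p - (2 * real p + 1) * \<epsilon>) * n) \<and>
       (\<forall>i<p. \<forall>j<p. i \<noteq> j \<longrightarrow> V i \<inter> V j = {} \<and> (\<forall>u\<in>V i. real (card (V j - {w. E u w})) \<le> (2 * real p + 2) * \<epsilon> * n))"
      by blast
    then show thesis by (intro that[of V]) simp_all
  qed
  define e where "e = (2 * real p + 2) * \<epsilon> * n"
  have near': "\<And>i j u. i < p \<Longrightarrow> j < p \<Longrightarrow> i \<noteq> j \<Longrightarrow> u \<in> V i \<Longrightarrow> real (card (V j - {w. E u w})) \<le> e"
    using near by (simp add: e_def)
  have e0: "e \<ge> 0" using \<epsilon> by (simp add: e_def)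
  have finV: "finite (V i)" if "i < p" for i using V(1)[OF that] finite_subset by blast
  have qn: "q \<le> \<epsilon> * n"
  proof -
    have "real q * 1 \<le> real q * (2 * (p + 1))" using p by (intro mult_left_mono) auto
    also have "\<dots> = 2 * real (p + 1) * q" by simp
    finally show ?thesis using n by simp
  qed
  have \<eta>n: "8 * (real p + 1)^2 * (\<epsilon> * n) \<le> \<eta> * n" using \<eta> by (simp add: mult_right_mono mult.assoc[symmetric])
  have expand: "8 * (real p + 1)^2 * (\<epsilon> * n) = 8 * (p * p * (\<epsilon> * n)) + 16 * (p * (\<epsilon> * n)) + 8 * (\<epsilon> * n)"
    by (simp add: power2_eq_square algebra_simps)
  have pe: "p * (\<epsilon> * n) \<ge> 0" "p * p * (\<epsilon> * n) \<ge> 0" "\<epsilon> * n \<ge> 0" using \<epsilon> by auto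
  have sym: "E u v \<longleftrightarrow> E v u" for u v using simple_graphD(1)[OF E] by blast
  have ex: "\<exists>i<p. V i \<inter> {w. E v w} = {}" if v: "v \<in> U" for v
  proof (rule ccontr)
    assume no: "\<not> ?thesis"
    define a where "a i = card (V i \<inter> {w. E v w})" for i
    \<comment> \<open>Class \<open>i\<close> has the fewest neighbours of \<open>v\<close>. One of
      them joins the clique, and the greedy choice runs through the other classes, which have at
      least as many.\<close>
    have "Min (a ` {..<p}) \<in> a ` {..<p}" using p by (intro Min_in) (auto simp: lessThan_empty_iff)
    then obtain i where "i < p" "a i = Min (a ` {..<p})" by auto
    then have i: "i < p" "\<And>j. j < p \<Longrightarrow> a i \<le> a j" by auto
    obtain w where w: "w \<in> V i" "E v w" using no i(1) by blast
    show False
    proof (rule greedy_book[OF E nb q e0, where I = "{..<p} - {i}" and V = V and S = "{v, w}"])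
      show "real (card (V j' - {w. E u w})) \<le> e" if "i' \<in> {..<p} - {i}" "j' \<in> {..<p} - {i}" "i' \<noteq> j'" "u \<in> V i'" for i' j' u
        using near' that by auto
      show "V j \<subseteq> {..<n}" if "j \<in> {..<p} - {i}" for j using V that by auto
      show "{..<p} - {i} \<noteq> {}" using p i(1) by (intro card_gt_0_iff[THEN iffD1, THEN conjunct1]) simp
      show "{v, w} \<subseteq> {..<n}" using v U simple_graphD(4)[OF E w(2)] by auto
      show "clique E {v, w}" using w sym by (auto simp: clique_def)
      show "card {v, w} + card ({..<p} - {i}) = Suc p" using w simple_graphD(2)[OF E, of v] i(1) p by (cases "v = w") auto
      fix j assume j: "j \<in> {..<p} - {i}"
      have split: "card (V k) = a k + card (V k - {w. E v w})" if "k < p" for k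
        unfolding a_def using finV[OF that] card_Diff_subset_Int[of "V k" "{w. E v w}"] card_mono[of "V k" "V k \<inter> {w. E v w}"] by auto
      have "(V i - {w. E v w}) \<union> (V j - {w. E v w}) \<subseteq> {w. w < n \<and> \<not> E v w}" using V i j by auto
      then have "card ((V i - {w. E v w}) \<union> (V j - {w. E v w})) \<le> n - deg n E v" unfolding deg_complement[symmetric] by (intro card_mono) auto
      moreover have "card ((V i - {w. E v w}) \<union> (V j - {w. E v w})) = card (V i - {w. E v w}) + card (V j - {w. E v w})"
        using finV disj[of i j] i j by (intro card_Un_disjoint) auto
      ultimately have "real (card (V i - {w. E v w})) + card (V j - {w. E v w}) \<le> real n - deg n E v"
        using deg_le[of n E v] by (simp add: of_nat_diff flip: of_nat_add)
      also have "\<dots> \<le> (2 / p - \<eta>) * n" using U1[OF v] by (simp add: algebra_simps)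
      \<comment> \<open>As \<open>a i \<le> a j\<close>, the neighbours in both classes together
        number at most \<open>2 * a j\<close>, while the non-neighbours there are at most
        \<open>(2 / p - \<eta>) * n\<close>.\<close>
      finally have "2 * real (a j) \<ge> card (V i) + real (card (V j)) - (2 / p - \<eta>) * n"
        using split[of i] split[of j] i(1) i(2)[of j] j by simp
      then have "2 * real (a j) \<ge> card (V i) + real (card (V j)) - 2 * (n / p) + \<eta> * n"
        by (simp add: algebra_simps)
      moreover have "card (V i) \<ge> n / p - 2 * (p * (\<epsilon> * n)) - \<epsilon> * n"
        and "card (V j) \<ge> n / p - 2 * (p * (\<epsilon> * n)) - \<epsilon> * n"
        using V(2)[of i] V(2)[of j] i j by (auto simp: algebra_simps)
      ultimately have aj: "real (a j) \<ge> 4 * (p * p * (\<epsilon> * n)) + 6 * (p * (\<epsilon> * n)) + 3 * (\<epsilon> * n)"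
        using \<eta>n expand by linarith
      have "V j \<inter> {w. E v w} \<subseteq> (V j \<inter> common_nbrs n E {v, w}) \<union> (V j - {u. E w u})"
        using V j by (auto simp: common_nbrs_def)
      then have "a j \<le> card ((V j \<inter> common_nbrs n E {v, w}) \<union> (V j - {u. E w u}))"
        unfolding a_def using finV j by (intro card_mono) auto
      then have "a j \<le> card (V j \<inter> common_nbrs n E {v, w}) + card (V j - {u. E w u})"
        by (rule order_trans[OF _ card_Un_le])
      then have "real (a j) \<le> real (card (V j \<inter> common_nbrs n E {v, w})) + real (card (V j - {u. E w u}))"
        by linarith
      moreover have "real (card (V j - {u. E w u})) \<le> e" using near'[of i j w] i j w by auto
      moreover have "real (p - 2) * e = 2 * (p * p * (\<epsilon> * n)) - 2 * (p * (\<epsilon> * n)) - 4 * (\<epsilon> * n)"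
        using p by (simp add: e_def of_nat_diff algebra_simps)
      moreover have "e = 2 * (p * (\<epsilon> * n)) + 2 * (\<epsilon> * n)" by (simp add: e_def algebra_simps)
      ultimately have "real (p - 2) * e + q \<le> real (card (V j \<inter> common_nbrs n E {v, w}))"
        using aj qn pe by linarith
      then show "real (card ({..<p} - {i} ) - 1) * e + q \<le> real (card (V j \<inter> common_nbrs n E {v, w}))"
        using i by (simp add: numeral_2_eq_2)
    qed simp
  qed
  define c where "c v = (SOME i. i < p \<and> V i \<inter> {w. E v w} = {})" for v
  have c: "c v < p" "V (c v) \<inter> {w. E v w} = {}" if "v \<in> U" for v
    using someI_ex[of "\<lambda>i. i < p \<and> V i \<inter> {w. E v w} = {}"] ex[OF that] unfolding c_def by blast+
  have "c u \<noteq> c v" if u: "u \<in> U" and v: "v \<in> U" and uv: "E u v" for u v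
  proof
    assume eq: "c u = c v"
    define i where "i = c u"
    have i: "i < p" "V i \<inter> {w. E u w} = {}" "V i \<inter> {w. E v w} = {}" using c[OF u] c[OF v] eq by (auto simp: i_def)
    have ne: "u \<noteq> v" using uv simple_graphD(2)[OF E] by blast
    show False
    proof (rule greedy_book[OF E nb q e0, where I = "{..<p} - {i}" and V = V and S = "{u, v}"])
      show "real (card (V j' - {w. E u w})) \<le> e" if "i' \<in> {..<p} - {i}" "j' \<in> {..<p} - {i}" "i' \<noteq> j'" "u \<in> V i'" for i' j' u
        using near' that by auto
      show "V j \<subseteq> {..<n}" if "j \<in> {..<p} - {i}" for j using V that by auto
      show "{..<p} - {i} \<noteq> {}" using p i(1) by (intro card_gt_0_iff[THEN iffD1, THEN conjunct1]) simp
      show "{u, v} \<subseteq> {..<n}" using u v U by auto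
      show "clique E {u, v}" using uv sym by (auto simp: clique_def)
      show "card {u, v} + card ({..<p} - {i}) = Suc p" using ne i(1) p by auto
      fix j assume j: "j \<in> {..<p} - {i}"
      \<comment> \<open>Avoiding \<open>V i\<close> altogether uses up about \<open>n / p\<close> of
        the deficit. For \<open>u\<close> and \<open>v\<close> together \<open>V i\<close> counts
        twice and \<open>V j\<close> must not be exhausted, which is where the threshold with
        \<open>3 / p\<close> comes from.\<close>
      have miss: "real (card (V j - {w. E x w})) \<le> real n - deg n E x - real (card (V i))" if "V i \<inter> {w. E x w} = {}" for x
      proof -
        have "(V j - {w. E x w}) \<union> V i \<subseteq> {w. w < n \<and> \<not> E x w}" using V i j that by auto
        then have "card ((V j - {w. E x w}) \<union> V i) \<le> n - deg n E x" unfolding deg_complement[symmetric] by (intro card_mono) auto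
        moreover have "card ((V j - {w. E x w}) \<union> V i) = card (V j - {w. E x w}) + card (V i)"
          using finV disj[of i j] i j by (intro card_Un_disjoint) auto
        ultimately show ?thesis using deg_le[of n E x] by (simp add: of_nat_diff)
      qed
      have "V j \<subseteq> (V j \<inter> common_nbrs n E {u, v}) \<union> ((V j - {w. E u w}) \<union> (V j - {w. E v w}))"
        using V j by (auto simp: common_nbrs_def)
      then have "card (V j) \<le> card ((V j \<inter> common_nbrs n E {u, v}) \<union> ((V j - {w. E u w}) \<union> (V j - {w. E v w})))"
        using finV j by (intro card_mono) auto
      also have "\<dots> \<le> card (V j \<inter> common_nbrs n E {u, v}) + (card (V j - {w. E u w}) + card (V j - {w. E v w}))"
        by (meson add_left_mono card_Un_le order_trans)
      finally have "real (card (V j)) \<le> card (V j \<inter> common_nbrs n E {u, v}) + (real (card (V j - {w. E u w})) + card (V j - {w. E v w}))"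
        by linarith
      moreover have "real (p - 2) * e = 2 * (p * p * (\<epsilon> * n)) - 2 * (p * (\<epsilon> * n)) - 4 * (\<epsilon> * n)"
        using p by (simp add: e_def of_nat_diff algebra_simps)
      moreover have "(1 / p - (2 * real p + 1) * \<epsilon>) * n = n / p - 2 * (p * (\<epsilon> * n)) - \<epsilon> * n" by (simp add: algebra_simps)
      moreover have "(2 - 3 / p + \<eta>) * n = 2 * n - 3 * (n / p) + \<eta> * n" by (simp add: algebra_simps)
      moreover have ci: "card (V i) \<ge> (1 / p - (2 * real p + 1) * \<epsilon>) * n"
        and cj: "card (V j) \<ge> (1 / p - (2 * real p + 1) * \<epsilon>) * n" using V(2) i j by auto
      ultimately have "real (p - 2) * e + q \<le> real (card (V j \<inter> common_nbrs n E {u, v}))"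
        using ci cj miss[OF i(2)] miss[OF i(3)] U2[OF u v ne uv] qn \<eta>n expand pe by linarith
      then show "real (card ({..<p} - {i} ) - 1) * e + q \<le> real (card (V j \<inter> common_nbrs n E {u, v}))"
        using i by (simp add: numeral_2_eq_2)
    qed simp
  qed
  then show ?thesis using c by blast
qed

section \<open>The graphs \<open>Y\<close> with arbitrary class sizes\<close>

definition attached :: "(nat \<Rightarrow> nat) \<Rightarrow> nat \<Rightarrow> nat \<Rightarrow> nat \<Rightarrow> bool" where
  "attached c u1 u2 v \<longleftrightarrow> (c v \<noteq> c u1 \<and> c v \<noteq> c u2) \<or> v = u1 \<or> v = u2"

text \<open>\<open>Y_graph p n\<close> with an arbitrary colouring \<open>c\<close> of the vertices other than \<open>u0\<close>; the value \<open>c u0\<close> is irrelevant.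
  The colours of \<open>u1\<close> and \<open>u2\<close> play the roles of \<open>T\<^sub>1\<close> and \<open>T\<^sub>2\<close>.\<close>

definition Y_col :: "nat \<Rightarrow> (nat \<Rightarrow> nat) \<Rightarrow> nat \<Rightarrow> nat \<Rightarrow> nat \<Rightarrow> nat \<Rightarrow> nat \<Rightarrow> bool" where
  "Y_col n c u0 u1 u2 u v \<longleftrightarrow> u < n \<and> v < n \<and> u \<noteq> v \<and>
     (if u = u0 then attached c u1 u2 v
      else if v = u0 then attached c u1 u2 u
      else c u \<noteq> c v \<and> \<not> (u = u1 \<and> v = u2) \<and> \<not> (u = u2 \<and> v = u1))"

definition part :: "nat \<Rightarrow> (nat \<Rightarrow> nat) \<Rightarrow> nat \<Rightarrow> nat \<Rightarrow> nat set" where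
  "part n c u0 i = {w. w < n \<and> w \<noteq> u0 \<and> c w = i}"

lemma finite_part [simp]: "finite (part n c u0 i)"
  by (simp add: part_def)

text \<open>Class sizes are unrestricted, and a class containing neither \<open>u1\<close> nor
  \<open>u2\<close> may be empty, so that vertices can be moved freely; \<open>balanced\<close>
  later singles out the extremal sizes.\<close>

locale Y_structure =
  fixes p n :: nat and c :: "nat \<Rightarrow> nat" and u0 u1 u2 :: nat
  assumes p2: "p \<ge> 2" and u0n: "u0 < n" and u1n: "u1 < n" and u2n: "u2 < n"
    and u01: "u0 \<noteq> u1" and u02: "u0 \<noteq> u2" and c12: "c u1 \<noteq> c u2"
    and cp: "\<And>v. v < n \<Longrightarrow> v \<noteq> u0 \<Longrightarrow> c v < p"
begin

lemma u12: "u1 \<noteq> u2"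
  using c12 by auto

abbreviation "G \<equiv> Y_col n c u0 u1 u2"
abbreviation "P \<equiv> part n c u0"

lemma simple_G: "simple_graph n G"
proof -
  have "G v u" if "G u v" for u v
    using that unfolding Y_col_def by (cases "u = u0"; cases "v = u0") auto
  moreover have "u < n \<and> v < n \<and> u \<noteq> v" if "G u v" for u v using that unfolding Y_col_def by simp
  ultimately show ?thesis unfolding simple_graph_def by simp
qed

text \<open>There is not even a clique on \<open>p + 1\<close> vertices: it would consist of
  \<open>u0\<close> and one vertex of each colour, but in the two special colours \<open>u0\<close>
  sees only \<open>u1\<close> and \<open>u2\<close>, which are not adjacent.\<close>

lemma book_free:
  assumes "q \<ge> 1"
  shows "\<not> contains_book n G p q"
proof
  assume "contains_book n G p q"
  then obtain K Q where KQ: "K \<subseteq> {..<n}" "Q \<subseteq> {..<n}" "card K = p" "card Q = q"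
    "\<forall>u\<in>K. \<forall>v\<in>K. u \<noteq> v \<longrightarrow> G u v" "\<forall>u\<in>K. \<forall>v\<in>Q. G u v"
    unfolding contains_book_eq book_on_def by blast
  have "Q \<noteq> {}" using KQ(4) assms by auto
  then obtain w where w: "w \<in> Q" by blast
  define M where "M = insert w K"
  have finK: "finite K" using KQ(1) finite_subset by blast
  have wK: "w \<notin> K" using KQ(6) w simple_graphD(2)[OF simple_G] by blast
  have cM: "card M = Suc p" "finite M" "M \<subseteq> {..<n}" using wK finK KQ w by (auto simp: M_def)
  have M: "G u v" if "u \<in> M" "v \<in> M" "u \<noteq> v" for u v
    using that KQ(5,6) w simple_graphD(1)[OF simple_G] unfolding M_def by blast
  have adj0: "c u \<noteq> c v \<and> \<not> (u = u1 \<and> v = u2)" if "u \<in> M - {u0}" "v \<in> M - {u0}" "u \<noteq> v" for u v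
    using M[of u v] that by (auto simp: Y_col_def)
  have inj: "inj_on c (M - {u0})" using adj0 by (auto simp: inj_on_def)
  have sub: "c ` (M - {u0}) \<subseteq> {..<p}" using cp cM(3) by auto
  have "card (M - {u0}) \<le> p" using card_inj_on_le[OF inj sub] by simp
  then have u0M: "u0 \<in> M" using cM by (metis Diff_empty Diff_insert0 Suc_n_not_le_n)
  then have "card (M - {u0}) = p" using cM by simp
  then have "card (c ` (M - {u0})) = p" using card_image[OF inj] by simp
  then have surj: "c ` (M - {u0}) = {..<p}" using sub by (intro card_subset_eq) auto
  have "c u1 \<in> c ` (M - {u0})" "c u2 \<in> c ` (M - {u0})" unfolding surj using cp u1n u2n u01 u02 by auto
  then obtain x y where xy: "x \<in> M - {u0}" "c x = c u1" "y \<in> M - {u0}" "c y = c u2" by (metis imageE)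
  have "x = u1" using M[of u0 x] u0M xy c12 u02 by (auto simp: Y_col_def attached_def)
  moreover have "y = u2" using M[of u0 y] u0M xy c12 u01 by (auto simp: Y_col_def attached_def)
  ultimately show False using adj0[of x y] xy u12 by simp
qed

section \<open>Rows and quadratic form of \<open>Y_col\<close> as class sums\<close>

lemma sum_delta:
  fixes f :: "nat \<Rightarrow> real"
  assumes "a < n"
  shows "(\<Sum>w<n. of_bool (w = a) * f w) = f a"
proof -
  have "(\<Sum>w<n. of_bool (w = a) * f w) = (\<Sum>w<n. if w = a then f w else 0)"
    by (intro sum.cong) auto
  then show ?thesis using assms by simp
qed

lemma sum_part:
  fixes f :: "nat \<Rightarrow> real"
  shows "(\<Sum>w<n. of_bool (w \<noteq> u0 \<and> c w = i) * f w) = sum f (P i)"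
  unfolding part_def by (intro sum.mono_neutral_cong_right) auto

lemma sum_tot:
  fixes f :: "nat \<Rightarrow> real"
  shows "(\<Sum>w<n. of_bool (w \<noteq> u0) * f w) = sum f ({..<n} - {u0})"
  by (intro sum.mono_neutral_cong_right) auto

lemma nsum_u0: "nsum n G f u0 = sum f ({..<n} - {u0}) - sum f (P (c u1)) - sum f (P (c u2)) + f u1 + f u2"
proof -
  have "nsum n G f u0 = (\<Sum>w<n. of_bool (w \<noteq> u0) * f w - of_bool (w \<noteq> u0 \<and> c w = c u1) * f w
     - of_bool (w \<noteq> u0 \<and> c w = c u2) * f w + of_bool (w = u1) * f w + of_bool (w = u2) * f w)"
    unfolding nsum_def
  proof (intro sum.cong refl)
    fix w assume "w \<in> {..<n}"
    then show "of_bool (G u0 w) * f w = of_bool (w \<noteq> u0) * f w - of_bool (w \<noteq> u0 \<and> c w = c u1) * f w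
     - of_bool (w \<noteq> u0 \<and> c w = c u2) * f w + of_bool (w = u1) * f w + of_bool (w = u2) * f w"
      using u0n u01 u02 u12 c12
      by (cases "w = u0"; cases "w = u1"; cases "w = u2"; cases "c w = c u1"; cases "c w = c u2")
         (simp_all add: Y_col_def attached_def)
  qed
  then show ?thesis
    by (simp only: sum.distrib sum_subtractf sum_part sum_tot sum_delta[OF u1n] sum_delta[OF u2n])
qed

text \<open>The total minus the own class, with indicator corrections at \<open>u0\<close>,
  \<open>u1\<close> and \<open>u2\<close>. In this form rows can be summed over a class, and rows of
  two colourings subtracted termwise.\<close>

lemma nsum_other:
  assumes v: "v < n" "v \<noteq> u0"
  shows "nsum n G f v = sum f ({..<n} - {u0}) - sum f (P (c v))
    + of_bool (attached c u1 u2 v) * f u0 - of_bool (v = u1) * f u2 - of_bool (v = u2) * f u1"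
proof -
  have "nsum n G f v = (\<Sum>w<n. of_bool (w \<noteq> u0) * f w - of_bool (w \<noteq> u0 \<and> c w = c v) * f w
     + of_bool (attached c u1 u2 v) * (of_bool (w = u0) * f w)
     - of_bool (v = u1) * (of_bool (w = u2) * f w) - of_bool (v = u2) * (of_bool (w = u1) * f w))"
    unfolding nsum_def
  proof (intro sum.cong refl)
    fix w assume w: "w \<in> {..<n}"
    show "of_bool (G v w) * f w = of_bool (w \<noteq> u0) * f w - of_bool (w \<noteq> u0 \<and> c w = c v) * f w
     + of_bool (attached c u1 u2 v) * (of_bool (w = u0) * f w)
     - of_bool (v = u1) * (of_bool (w = u2) * f w) - of_bool (v = u2) * (of_bool (w = u1) * f w)"
    proof (cases "w = u0")
      case True
      then show ?thesis using v u0n u01 u02 by (simp add: Y_col_def)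
    next
      case False
      then have G: "G v w \<longleftrightarrow> c w \<noteq> c v \<and> \<not> (v = u1 \<and> w = u2) \<and> \<not> (v = u2 \<and> w = u1)"
        using v w by (auto simp: Y_col_def)
      consider "v = u1" | "v = u2" | "v \<noteq> u1" "v \<noteq> u2" by blast
      then show ?thesis
      proof cases
        case 1
        then show ?thesis using False u12 c12 unfolding G by (cases "w = u2") auto
      next
        case 2
        then show ?thesis using False u12 c12 unfolding G by (cases "w = u1") auto
      next
        case 3
        then show ?thesis using False unfolding G by simp
      qed
    qed
  qed
  then show ?thesis
    by (simp only: sum.distrib sum_subtractf sum_distrib_left[symmetric] sum_part sum_tot sum_delta[OF u0n] sum_delta[OF u1n] sum_delta[OF u2n])
qed

lemma sum_others: "(\<Sum>i<p. sum f (P i)) = sum f ({..<n} - {u0})" for f :: "nat \<Rightarrow> 'a::comm_monoid_add"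
proof -
  have "P i = {x \<in> {..<n} - {u0}. c x = i}" for i by (auto simp: part_def)
  then show ?thesis using sum.group[of "{..<n} - {u0}" "{..<p}" c f] cp by auto
qed

lemma sum_sizes: "(\<Sum>i<p. card (P i)) = n - 1"
  using sum_others[of "\<lambda>_. 1::nat"] u0n by simp

lemma special: "c u1 < p" "c u2 < p"
  using cp u1n u2n u01 u02 by auto

text \<open>Twice the number of edges, those at \<open>u0\<close> weighted by \<theta>. The summand
  -2 is the deleted edge between \<open>u1\<close> and \<open>u2\<close>, and the last bracket is
  the degree of \<open>u0\<close>.\<close>

lemma quad_test_vector:
  "quad n G (\<lambda>v. if v = u0 then \<theta> else 1) =
     (real n - 1)^2 - (\<Sum>i<p. (real (card (P i)))^2) - 2 + 2 * \<theta> * (real n + 1 - card (P (c u1)) - card (P (c u2)))"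
proof -
  define f where "f = (\<lambda>v. if v = u0 then \<theta> else (1::real))"
  define m where "m = real n - 1"
  have sumf: "sum f A = card A" if "u0 \<notin> A" for A
  proof -
    have "sum f A = (\<Sum>a\<in>A. 1)" using that by (intro sum.cong) (auto simp: f_def)
    then show ?thesis by simp
  qed
  have tot: "sum f ({..<n} - {u0}) = m" using sumf[of "{..<n} - {u0}"] u0n by (simp add: m_def of_nat_diff Suc_leI)
  have prt: "sum f (P i) = card (P i)" for i by (rule sumf) (simp add: part_def)
  have f12: "f u1 = 1" "f u2 = 1" "f u0 = \<theta>" using u01 u02 by (auto simp: f_def)
  have ones: "(\<Sum>v\<in>{..<n} - {u0}. of_bool (v = a)) = (1::real)" if "a < n" "a \<noteq> u0" for a
    using that by (simp add: of_bool_def)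
  have "(\<Sum>v\<in>{..<n} - {u0}. of_bool (attached c u1 u2 v))
      = (\<Sum>v\<in>{..<n} - {u0}. 1 - of_bool (c v = c u1) - of_bool (c v = c u2) + of_bool (v = u1) + of_bool (v = u2) :: real)"
    using c12 u12 by (intro sum.cong) (auto simp: attached_def)
  also have "\<dots> = m - card (P (c u1)) - card (P (c u2)) + 1 + 1"
  proof -
    have "(\<Sum>v\<in>{..<n} - {u0}. of_bool (c v = i)) = real (card (P i))" for i
    proof -
      have "(\<Sum>v\<in>{..<n} - {u0}. of_bool (c v = i)) = (\<Sum>v\<in>P i. 1::real)"
        by (intro sum.mono_neutral_cong_right) (auto simp: part_def)
      then show ?thesis by simp
    qed
    moreover have "(\<Sum>v\<in>{..<n} - {u0}. 1::real) = m" using u0n by (simp add: m_def of_nat_diff Suc_leI)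
    ultimately show ?thesis by (simp only: sum.distrib sum_subtractf ones[OF u1n u01[symmetric]] ones[OF u2n u02[symmetric]])
  qed
  finally have nb: "(\<Sum>v\<in>{..<n} - {u0}. of_bool (attached c u1 u2 v)) = m + 2 - card (P (c u1)) - card (P (c u2))"
    by simp
  have sq: "(\<Sum>v\<in>{..<n} - {u0}. real (card (P (c v)))) = (\<Sum>i<p. (real (card (P i)))^2)"
  proof -
    have "(\<Sum>v\<in>P i. real (card (P (c v)))) = (real (card (P i)))^2" for i
    proof -
      have "(\<Sum>v\<in>P i. real (card (P (c v)))) = (\<Sum>v\<in>P i. real (card (P i)))"
        by (intro sum.cong) (auto simp: part_def)
      then show ?thesis by (simp add: power2_eq_square)
    qed
    then show ?thesis using sum_others[of "\<lambda>v. real (card (P (c v)))"] by simp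
  qed
  have "quad n G f = f u0 * nsum n G f u0 + (\<Sum>v\<in>{..<n} - {u0}. f v * nsum n G f v)"
    unfolding quad_def using u0n by (simp add: sum.remove)
  also have "(\<Sum>v\<in>{..<n} - {u0}. f v * nsum n G f v) = (\<Sum>v\<in>{..<n} - {u0}. m - card (P (c v))
      + \<theta> * of_bool (attached c u1 u2 v) - of_bool (v = u1) - of_bool (v = u2))"
  proof (intro sum.cong refl)
    fix v assume v: "v \<in> {..<n} - {u0}"
    then have "f v = 1" by (simp add: f_def)
    with v show "f v * nsum n G f v = m - card (P (c v)) + \<theta> * of_bool (attached c u1 u2 v) - of_bool (v = u1) - of_bool (v = u2)"
      by (simp add: nsum_other tot prt f12)
  qed
  also have "\<dots> = m * m - (\<Sum>i<p. (real (card (P i)))^2) + \<theta> * (m + 2 - card (P (c u1)) - card (P (c u2))) - 1 - 1"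
  proof -
    have "(\<Sum>v\<in>{..<n} - {u0}. m) = m * m" using u0n by (simp add: m_def of_nat_diff Suc_leI)
    then show ?thesis
      by (simp only: sum.distrib sum_subtractf sum_distrib_left[symmetric] ones[OF u1n u01[symmetric]] ones[OF u2n u02[symmetric]] nb sq)
  qed
  also have "nsum n G f u0 = m - card (P (c u1)) - card (P (c u2)) + 2"
    by (simp add: nsum_u0 tot prt f12)
  finally show ?thesis unfolding f_def[symmetric] by (simp add: f12 m_def power2_eq_square algebra_simps)
qed

end

text \<open>The test vector carries the limiting Perron entry \<theta> at \<open>u0\<close>. With
  \<open>m = n - 1\<close> the Rayleigh quotient is about \<open>a * (m\<^sup>2 + 2 *
  \<theta>\<^sup>2 * m) / (m + \<theta>\<^sup>2)\<close>, which is
  \<open>a * (m + \<theta>\<^sup>2)\<close> up to O(1/n).\<close>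

lemma spec_rad_Y_lower:
  fixes p :: nat and \<eta> :: real
  assumes p: "p \<ge> 2" and \<eta>: "\<eta> > 0"
  defines "\<theta> \<equiv> (real p - 2) / (real p - 1)"
  shows "\<forall>\<^sub>F n in sequentially. \<forall>c u0 u1 u2. Y_structure p n c u0 u1 u2 \<longrightarrow>
    (\<forall>i<p. \<bar>card (part n c u0 i) - (real n - 1) / p\<bar> \<le> 1) \<longrightarrow>
    (1 - 1 / p) * (real n - (1 - \<theta>\<^sup>2) - \<eta>) \<le> spec_rad n (Y_col n c u0 u1 u2)"
proof -
  define a where "a = 1 - 1 / real p"
  have a: "a \<ge> 1/2" using p by (simp add: a_def field_simps)
  have \<theta>a: "1 - 2 / real p = \<theta> * a" using p by (simp add: a_def \<theta>_def field_simps)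
  have \<theta>: "0 \<le> \<theta>" "\<theta> \<le> 1" using p by (auto simp: \<theta>_def)
  have "\<forall>\<^sub>F n in sequentially. real p + 3 \<le> 1/2 * (\<eta> * (real n - 1) - 1)"
    using \<eta> by real_asymp
  then show ?thesis
  proof (eventually_elim, intro allI impI)
    fix n c u0 u1 u2
    assume n: "real p + 3 \<le> 1/2 * (\<eta> * (real n - 1) - 1)" and Y: "Y_structure p n c u0 u1 u2"
      and s: "\<forall>i<p. \<bar>card (part n c u0 i) - (real n - 1) / p\<bar> \<le> 1"
    interpret Y_structure p n c u0 u1 u2 by (rule Y)
    define m where "m = real n - 1"
    \<comment> \<open>The deviations \<open>t i\<close> sum to 0, so the squared sizes exceed
      \<open>m\<^sup>2 / p\<close> only by the sum of the \<open>(t i)\<^sup>2\<close>, at most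
      \<open>p\<close>.\<close>
    define t where "t i = card (P i) - m / p" for i
    have n1: "n \<ge> 1" using u0n by linarith
    have "(\<Sum>i<p. real (card (P i))) = m"
      unfolding of_nat_sum[symmetric] sum_sizes using n1 by (simp add: m_def of_nat_diff)
    then have t0: "(\<Sum>i<p. t i) = 0" using p by (simp add: t_def sum_subtractf)
    have "(\<Sum>i<p. (real (card (P i)))^2) = (\<Sum>i<p. (m / p)^2 + 2 * (m / p) * t i + (t i)^2)"
      by (intro sum.cong) (auto simp: t_def power2_eq_square algebra_simps)
    also have "\<dots> = p * (m / p)^2 + 2 * (m / p) * (\<Sum>i<p. t i) + (\<Sum>i<p. (t i)^2)"
      by (simp only: sum.distrib sum_distrib_left[symmetric]) simp
    also have "\<dots> = m^2 / p + (\<Sum>i<p. (t i)^2)" using t0 p by (simp add: power2_eq_square)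
    also have "(\<Sum>i<p. (t i)^2) \<le> (\<Sum>i<p. 1)"
      using s by (intro sum_mono) (simp add: t_def m_def abs_square_le_1)
    finally have sq: "(\<Sum>i<p. (real (card (P i)))^2) \<le> m^2 / p + p" by simp
    have s12: "real (card (P (c u1))) \<le> m / p + 1" "real (card (P (c u2))) \<le> m / p + 1"
      using s[rule_format, OF special(1)] s[rule_format, OF special(2)] by (auto simp: m_def abs_le_iff)
    define f where "f = (\<lambda>v. if v = u0 then \<theta> else (1::real))"
    have Q: "quad n G f \<le> spec_rad n G * (m + \<theta>\<^sup>2)"
    proof -
      have "(\<Sum>i<n. (f i)\<^sup>2) = (f u0)^2 + (\<Sum>i\<in>{..<n} - {u0}. (f i)^2)" using u0n by (simp add: sum.remove)
      also have "(\<Sum>i\<in>{..<n} - {u0}. (f i)^2) = (\<Sum>i\<in>{..<n} - {u0}. 1)" by (intro sum.cong) (auto simp: f_def)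
      finally have "(\<Sum>i<n. (f i)\<^sup>2) = m + \<theta>\<^sup>2" using n1 u0n by (simp add: f_def m_def of_nat_diff)
      then show ?thesis using quad_le_spec_rad[OF simple_G, of f] n1 by simp
    qed
    have "2 * \<theta> * (m - 2 * (m / p)) \<le> 2 * \<theta> * (m + 2 - card (P (c u1)) - card (P (c u2)))"
      using s12 \<theta> by (intro mult_left_mono) auto
    moreover have "quad n G f = m^2 - (\<Sum>i<p. (real (card (P i)))^2) - 2 + 2 * \<theta> * (m + 2 - card (P (c u1)) - card (P (c u2)))"
      unfolding f_def quad_test_vector by (simp add: m_def)
    ultimately have "m^2 - (m^2 / p + p) - 2 + 2 * \<theta> * (m - 2 * (m / p)) \<le> quad n G f"
      using sq by linarith
    moreover have "m^2 - m^2 / p = a * m^2" by (simp add: a_def algebra_simps)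
    moreover have m\<theta>: "m - 2 * (m / p) = \<theta> * a * m" unfolding \<theta>a[symmetric] by (simp add: algebra_simps)
    ultimately have "a * m^2 - p - 2 + 2 * \<theta> * (\<theta> * a * m) \<le> quad n G f" unfolding m\<theta> by linarith
    then have Q2: "a * (m^2 + 2 * \<theta>\<^sup>2 * m) - p - 2 \<le> quad n G f" by (simp add: algebra_simps power2_eq_square)
    have \<theta>4: "\<theta>\<^sup>2 \<le> 1" using \<theta> by (simp add: power_le_one)
    have "a * (m + \<theta>\<^sup>2 - \<eta>) * (m + \<theta>\<^sup>2) = a * (m^2 + 2 * \<theta>\<^sup>2 * m) - a * (\<eta> * m + \<eta> * \<theta>\<^sup>2 - \<theta>\<^sup>2 * \<theta>\<^sup>2)"
      by (simp add: algebra_simps power2_eq_square)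
    moreover have "a * (\<eta> * m + \<eta> * \<theta>\<^sup>2 - \<theta>\<^sup>2 * \<theta>\<^sup>2) \<ge> real p + 2"
    proof -
      have "1/2 * (\<eta> * m - 1) \<le> a * (\<eta> * m - 1)"
        using a n by (intro mult_right_mono) (auto simp: m_def)
      also have "\<dots> \<le> a * (\<eta> * m + \<eta> * \<theta>\<^sup>2 - \<theta>\<^sup>2 * \<theta>\<^sup>2)"
      proof (intro mult_left_mono)
        have "\<theta>\<^sup>2 * \<theta>\<^sup>2 \<le> 1 * 1" using \<theta>4 by (intro mult_mono) auto
        moreover have "\<eta> * \<theta>\<^sup>2 \<ge> 0" using \<eta> by simp
        ultimately show "\<eta> * m - 1 \<le> \<eta> * m + \<eta> * \<theta>\<^sup>2 - \<theta>\<^sup>2 * \<theta>\<^sup>2" by linarith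
      qed (use a in simp)
      finally show ?thesis using n by (simp add: m_def)
    qed
    ultimately have "a * (m + \<theta>\<^sup>2 - \<eta>) * (m + \<theta>\<^sup>2) \<le> spec_rad n G * (m + \<theta>\<^sup>2)" using Q Q2 by linarith
    moreover have "m + \<theta>\<^sup>2 > 0"
    proof -
      have "\<eta> * m > 0" using n by (simp add: m_def)
      then have "m > 0" using \<eta> by (simp add: zero_less_mult_iff)
      then show ?thesis by (simp add: add_pos_nonneg)
    qed
    ultimately have "a * (m + \<theta>\<^sup>2 - \<eta>) \<le> spec_rad n G" by simp
    then show "(1 - 1 / p) * (real n - (1 - \<theta>\<^sup>2) - \<eta>) \<le> spec_rad n G" by (simp add: a_def m_def algebra_simps)
  qed
qed

text \<open>Near-balance is not assumed but forced: an oversized class has at least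
  \<open>\<delta> * n\<close> vertices whose degree falls short by \<open>\<delta> * n\<close>, and
  each adds at least \<open>\<delta>\<^sup>2 / 4\<close> to a bounded sum of squares. The class
  sizes then fix the degrees, and these the entries.\<close>

lemma Y_perron_entries:
  fixes p :: nat and C0 \<epsilon> :: real
  assumes p: "p \<ge> 2" and \<epsilon>: "\<epsilon> > 0"
  shows "\<forall>\<^sub>F n in sequentially. \<forall>c u0 u1 u2 x. Y_structure p n c u0 u1 u2 \<longrightarrow>
    perron n (Y_col n c u0 u1 u2) x \<longrightarrow> (1 - 1 / p) * n - C0 \<le> spec_rad n (Y_col n c u0 u1 u2) \<longrightarrow>
    (\<forall>i<p. \<bar>real (card (part n c u0 i)) - n / p\<bar> \<le> \<epsilon> * n) \<and>
    (\<forall>v<n. v \<noteq> u0 \<longrightarrow> \<bar>x v - 1\<bar> \<le> \<epsilon>) \<and> \<bar>x u0 - (real p - 2) / (real p - 1)\<bar> \<le> \<epsilon>"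
proof -
  define a where "a = 1 - 1 / real p"
  have a: "a \<ge> 1/2" "a \<le> 1" using p by (auto simp: a_def field_simps)
  \<comment> \<open>\<open>4 * p + 5\<close> dominates the factor of the largest final error,
    \<open>\<delta> / 2 + 2 * (2 * p + 1) * \<delta>\<close> at \<open>u0\<close>.\<close>
  define \<delta> where "\<delta> = \<epsilon> / (4 * p + 5)"
  have \<delta>: "\<delta> > 0" "(4 * real p + 5) * \<delta> = \<epsilon>" using \<epsilon> by (auto simp: \<delta>_def)
  define b where "b n E x \<longleftrightarrow> simple_graph n E \<and> \<not> contains_book n E p 1 \<and> perron n E x \<and> a * n - C0 \<le> spec_rad n E"
    for n :: nat and E and x :: "nat \<Rightarrow> real"
  obtain C where C: "\<forall>\<^sub>F n in sequentially. \<forall>E x. b n E x \<longrightarrow> (\<Sum>i<n. (x i - 1)\<^sup>2) \<le> C"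
  proof -
    obtain C where "\<forall>\<^sub>F n in sequentially. \<forall>E x. simple_graph n E \<longrightarrow> \<not> contains_book n E p 1 \<longrightarrow> perron n E x \<longrightarrow>
      (1 - 1 / p) * n - C0 \<le> spec_rad n E \<longrightarrow>
      (\<Sum>i<n. (x i - 1)\<^sup>2) \<le> C \<and> spec_rad n E \<le> (1 - 1 / p) * n + C \<and> (\<forall>i<n. x i \<le> 3)"
      using perron_near_uniform[OF p order_refl] by blast
    then have "\<forall>\<^sub>F n in sequentially. \<forall>E x. b n E x \<longrightarrow> (\<Sum>i<n. (x i - 1)\<^sup>2) \<le> C"
      by (rule eventually_mono) (unfold b_def a_def, blast)
    then show thesis by (rule that)
  qed
  have D: "\<forall>\<^sub>F n in sequentially. \<forall>E x. b n E x \<longrightarrow> (\<forall>i<n. \<bar>x i - deg n E i / (a * n)\<bar> \<le> \<delta> / 2)"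
    by (rule eventually_mono[OF perron_entry_degree[of p 1 "\<delta> / 2" C0]]) (use p \<delta>(1) in \<open>simp_all add: b_def a_def\<close>)
  have "\<forall>\<^sub>F n in sequentially. \<bar>C\<bar> < real n * (\<delta> * (\<delta>\<^sup>2 / 4))" using \<delta>(1) by real_asymp
  moreover have "\<forall>\<^sub>F n in sequentially. 3 \<le> \<delta> * real n" using \<delta>(1) by real_asymp
  ultimately show ?thesis using C D
  proof (eventually_elim, intro allI impI)
    fix n c u0 u1 u2 x
    assume n1: "\<bar>C\<bar> < real n * (\<delta> * (\<delta>\<^sup>2 / 4))" and n2: "3 \<le> \<delta> * real n"
      and C: "\<forall>E x. b n E x \<longrightarrow> (\<Sum>i<n. (x i - 1)\<^sup>2) \<le> C"
      and D: "\<forall>E x. b n E x \<longrightarrow> (\<forall>i<n. \<bar>x i - deg n E i / (a * n)\<bar> \<le> \<delta> / 2)"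
      and Y: "Y_structure p n c u0 u1 u2"
      and x: "perron n (Y_col n c u0 u1 u2) x" and \<rho>: "(1 - 1 / p) * n - C0 \<le> spec_rad n (Y_col n c u0 u1 u2)"
    interpret Y_structure p n c u0 u1 u2 by (rule Y)
    have b: "b n G x" unfolding b_def using simple_G book_free[of 1] x \<rho> by (simp add: a_def)
    have n0: "real n > 0" using u0n by simp
    have an: "a * n > 0" using a n0 by simp
    have e: "\<bar>x i - deg n G i / (a * n)\<bar> \<le> \<delta> / 2" if "i < n" for i using D b that by blast
    define s where "s i = real (card (P i))" for i
    have tot: "sum (\<lambda>_. 1::real) ({..<n} - {u0}) = real n - 1" using u0n by (simp add: of_nat_diff Suc_leI)
    have dg: "real n - 2 - s (c v) \<le> deg n G v \<and> deg n G v \<le> real n - s (c v)" if "v < n" "v \<noteq> u0" for v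
    proof -
      have "real (deg n G v) = real n - 1 - s (c v) + of_bool (attached c u1 u2 v) - of_bool (v = u1) - of_bool (v = u2)"
        using nsum_other[OF that, of "\<lambda>_. 1"] tot by (simp add: nsum_one s_def)
      moreover have "of_bool (v = u1) + of_bool (v = u2) \<le> (1::real)" using u12 by auto
      ultimately show ?thesis by (cases "attached c u1 u2 v"; cases "v = u1"; cases "v = u2") simp_all
    qed
    have dg0: "real (deg n G u0) = real n + 1 - s (c u1) - s (c u2)"
      using nsum_u0[of "\<lambda>_. 1"] tot by (simp add: nsum_one s_def)
    have up: "s i \<le> (1 / p + \<delta>) * n" if i: "i < p" for i
    proof (rule ccontr)
      assume c: "\<not> ?thesis"
      have "\<delta>\<^sup>2 / 4 \<le> (x v - 1)\<^sup>2" if v: "v \<in> P i" for v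
      proof -
        have vn: "v < n" "v \<noteq> u0" "c v = i" using v by (auto simp: part_def)
        have "real (deg n G v) \<le> (a - \<delta>) * n" using dg[OF vn(1,2)] vn(3) c by (simp add: a_def algebra_simps)
        also have "\<dots> \<le> (1 - \<delta>) * (a * n)"
          using a n0 \<delta>(1) mult_right_mono[of a 1 "\<delta> * n"] by (simp add: algebra_simps)
        finally have "deg n G v / (a * n) \<le> 1 - \<delta>" using an by (simp add: pos_divide_le_eq)
        then have "\<delta> / 2 \<le> 1 - x v" using e[OF vn(1)] by linarith
        then have "(\<delta> / 2)\<^sup>2 \<le> (1 - x v)\<^sup>2" using \<delta> by (intro power_mono) auto
        then show ?thesis by (simp add: power_divide power2_commute)
      qed
      then have "(\<Sum>v\<in>P i. \<delta>\<^sup>2 / 4) \<le> (\<Sum>v\<in>P i. (x v - 1)\<^sup>2)" by (rule sum_mono)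
      also have "\<dots> \<le> (\<Sum>v<n. (x v - 1)\<^sup>2)" by (rule sum_mono2) (auto simp: part_def)
      also have "\<dots> \<le> C" using C b by blast
      finally have "s i * (\<delta>\<^sup>2 / 4) \<le> C" by (simp add: s_def)
      moreover have "\<delta> * n * (\<delta>\<^sup>2 / 4) \<le> s i * (\<delta>\<^sup>2 / 4)"
      proof (rule mult_right_mono)
        have "(1 / p + \<delta>) * n \<le> s i" using c by simp
        moreover have "(1 / p + \<delta>) * n = n / p + \<delta> * n" "n / p \<ge> 0" by (simp_all add: algebra_simps)
        ultimately show "\<delta> * n \<le> s i" by linarith
      qed simp
      ultimately show False using n1 by (simp add: algebra_simps)
    qed
    have lo: "s i \<ge> n / p - p * \<delta> * n" if i: "i < p" for i
    proof -
      have "real n - 1 = (\<Sum>j<p. s j)" unfolding s_def of_nat_sum[symmetric] sum_sizes using u0n by (simp add: of_nat_diff Suc_leI)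
      also have "\<dots> = s i + (\<Sum>j\<in>{..<p}-{i}. s j)" using i by (simp add: sum.remove)
      also have "(\<Sum>j\<in>{..<p}-{i}. s j) \<le> (\<Sum>j\<in>{..<p}-{i}. (1 / p + \<delta>) * n)" using up by (intro sum_mono) auto
      also have "\<dots> = (real p - 1) * ((1 / p + \<delta>) * n)" using i by (simp add: of_nat_diff)
      also have "\<dots> = n - n / p + p * \<delta> * n - \<delta> * n" using p by (simp add: field_simps)
      finally show ?thesis using n2 by linarith
    qed
    have size: "\<bar>s i - n / p\<bar> \<le> p * \<delta> * n" if i: "i < p" for i
    proof -
      have "1 * (\<delta> * n) \<le> p * (\<delta> * n)" using p \<delta> n0 by (intro mult_right_mono) auto
      then show ?thesis using up[OF i] lo[OF i] by (simp add: abs_le_iff algebra_simps)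
    qed
    have pd: "p * \<delta> * n \<le> \<epsilon> * n" using \<delta> n0 unfolding \<delta>(2)[symmetric] by (intro mult_right_mono) auto
    have half: "y * n \<le> (2 * y) * (a * n)" if "y \<ge> 0" for y :: real
    proof -
      have "y * n * 1 \<le> y * n * (2 * a)" using a that n0 by (intro mult_left_mono) auto
      then show ?thesis by (simp add: mult_ac)
    qed
    have others: "\<bar>x v - 1\<bar> \<le> \<epsilon>" if v: "v < n" "v \<noteq> u0" for v
    proof -
      have "\<bar>deg n G v - a * n\<bar> \<le> p * \<delta> * n + \<delta> * n"
        using dg[OF v] size[OF cp[OF v]] n2 unfolding a_def by (simp add: abs_le_iff algebra_simps)
      also have "\<dots> = (real p + 1) * \<delta> * n" by (simp add: algebra_simps)
      also have "\<dots> \<le> (2 * (real p + 1) * \<delta>) * (a * n)"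
        using half[of "(real p + 1) * \<delta>"] \<delta>(1) unfolding mult.assoc by auto
      finally have "\<bar>deg n G v - a * n\<bar> / (a * n) \<le> 2 * (real p + 1) * \<delta>" using an by (simp add: pos_divide_le_eq)
      moreover have "\<bar>deg n G v / (a * n) - 1\<bar> = \<bar>deg n G v - a * n\<bar> / (a * n)"
        using an by (subst abs_of_pos[OF an, symmetric], subst abs_divide[symmetric]) (use a n0 in \<open>simp add: diff_divide_distrib\<close>)
      ultimately have "\<bar>x v - 1\<bar> \<le> \<delta> / 2 + 2 * (real p + 1) * \<delta>" using e[OF v(1)] by linarith
      also have "\<dots> \<le> \<epsilon>" unfolding \<delta>(2)[symmetric] using \<delta>(1) by (simp add: algebra_simps)
      finally show ?thesis .
    qed
    have "\<bar>x u0 - (real p - 2) / (real p - 1)\<bar> \<le> \<epsilon>"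
    proof -
      have th: "(1 - 2 / p) * n / (a * n) = (real p - 2) / (real p - 1)" using p n0 by (simp add: a_def field_simps)
      have "\<bar>deg n G u0 - (1 - 2 / p) * n\<bar> \<le> 2 * (p * \<delta> * n) + \<delta> * n"
      proof -
        have "(1 - 2 / p) * n = n - 2 * (n / p)" by (simp add: algebra_simps)
        then show ?thesis using size[OF special(1)] size[OF special(2)] n2 unfolding dg0 by linarith
      qed
      also have "\<dots> = (2 * real p + 1) * \<delta> * n" by (simp add: algebra_simps)
      also have "\<dots> \<le> (2 * (2 * real p + 1) * \<delta>) * (a * n)"
        using half[of "(2 * real p + 1) * \<delta>"] \<delta>(1) unfolding mult.assoc by auto
      finally have "\<bar>deg n G u0 - (1 - 2 / p) * n\<bar> / (a * n) \<le> 2 * (2 * real p + 1) * \<delta>" using an by (simp add: pos_divide_le_eq)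
      moreover have "\<bar>deg n G u0 / (a * n) - (1 - 2 / p) * n / (a * n)\<bar> = \<bar>deg n G u0 - (1 - 2 / p) * n\<bar> / (a * n)"
        using an by (subst abs_of_pos[OF an, symmetric], subst abs_divide[symmetric]) (use a n0 in \<open>simp add: diff_divide_distrib\<close>)
      ultimately have "\<bar>x u0 - (real p - 2) / (real p - 1)\<bar> \<le> \<delta> / 2 + 2 * (2 * real p + 1) * \<delta>"
        using e[OF u0n] unfolding th by linarith
      also have "\<dots> \<le> \<epsilon>" unfolding \<delta>(2)[symmetric] using \<delta>(1) by (simp add: algebra_simps)
      finally show ?thesis .
    qed
    moreover have "\<forall>i<p. \<bar>real (card (P i)) - n / p\<bar> \<le> \<epsilon> * n" using size pd unfolding s_def by force
    ultimately show "(\<forall>i<p. \<bar>real (card (P i)) - n / p\<bar> \<le> \<epsilon> * n) \<and>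
      (\<forall>v<n. v \<noteq> u0 \<longrightarrow> \<bar>x v - 1\<bar> \<le> \<epsilon>) \<and> \<bar>x u0 - (real p - 2) / (real p - 1)\<bar> \<le> \<epsilon>"
      using others by blast
  qed
qed

text \<open>Entrywise closeness to 1 is too weak here, as a class has about \<open>n / p\<close>
  vertices. Summing the eigenvalue equation over a class gives an exact linear equation for its
  class sum, and subtracting two such equations leaves an error relative to the size
  difference.\<close>

lemma Y_perron_class_difference:
  fixes p :: nat and C0 \<epsilon> :: real
  assumes p: "p \<ge> 2" and \<epsilon>: "\<epsilon> > 0"
  shows "\<forall>\<^sub>F n in sequentially. \<forall>c u0 u1 u2 x i j. Y_structure p n c u0 u1 u2 \<longrightarrow>
    perron n (Y_col n c u0 u1 u2) x \<longrightarrow> (1 - 1 / p) * n - C0 \<le> spec_rad n (Y_col n c u0 u1 u2) \<longrightarrow>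
    i < p \<longrightarrow> j < p \<longrightarrow>
    \<bar>sum x (part n c u0 i) - sum x (part n c u0 j) - ((1 - 1 / p) * (real (card (part n c u0 i)) - real (card (part n c u0 j)))
       - (real p - 2) / (real p - 1) / p * (of_bool (i \<in> {c u1, c u2}) - of_bool (j \<in> {c u1, c u2})))\<bar>
     \<le> \<epsilon> * (1 + \<bar>real (card (part n c u0 i)) - real (card (part n c u0 j))\<bar>)"
proof -
  define a where "a = 1 - 1 / real p"
  have a: "a \<ge> 1/2" "a \<le> 1" using p by (auto simp: a_def field_simps)
  define \<theta> where "\<theta> = (real p - 2) / (real p - 1)"
  have \<theta>: "0 \<le> \<theta>" "\<theta> \<le> 1" using p by (auto simp: \<theta>_def)
  \<comment> \<open>\<open>e \<le> 1/4\<close> keeps \<open>\<rho> + s i\<close> above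
    \<open>3/4 * n\<close>, and 7 absorbs the factor \<open>4/3 * 4\<close> that dividing by it
    produces.\<close>
  define e where "e = min (\<epsilon> / 7) (1/4)"
  have e: "e > 0" "7 * e \<le> \<epsilon>" "e \<le> 1/4" using \<epsilon> by (auto simp: e_def)
  define \<delta> where "\<delta> = e / 10"
  have \<delta>: "\<delta> > 0" "10 * \<delta> = e" "\<delta> \<le> 1" using e by (auto simp: \<delta>_def)
  obtain C where C: "\<forall>\<^sub>F n in sequentially. \<forall>E x. simple_graph n E \<longrightarrow> \<not> contains_book n E p 1 \<longrightarrow> perron n E x \<longrightarrow>
    (1 - 1 / p) * n - C0 \<le> spec_rad n E \<longrightarrow>
    (\<Sum>i<n. (x i - 1)\<^sup>2) \<le> C \<and> spec_rad n E \<le> (1 - 1 / p) * n + C \<and> (\<forall>i<n. x i \<le> 3)"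
    using perron_near_uniform[of p 1 C0] p by auto
  have "\<forall>\<^sub>F n in sequentially. \<bar>C\<bar> + \<bar>C0\<bar> + 12 \<le> \<delta> * real n" using \<delta>(1) by real_asymp
  then show ?thesis using C Y_perron_entries[OF p \<delta>(1), of C0]
  proof (eventually_elim, intro allI impI)
    fix n c u0 u1 u2 x i j
    assume n1: "\<bar>C\<bar> + \<bar>C0\<bar> + 12 \<le> \<delta> * real n"
      and C: "\<forall>E x. simple_graph n E \<longrightarrow> \<not> contains_book n E p 1 \<longrightarrow> perron n E x \<longrightarrow>
        (1 - 1 / p) * n - C0 \<le> spec_rad n E \<longrightarrow>
        (\<Sum>i<n. (x i - 1)\<^sup>2) \<le> C \<and> spec_rad n E \<le> (1 - 1 / p) * n + C \<and> (\<forall>i<n. x i \<le> 3)"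
      and A: "\<forall>c u0 u1 u2 x. Y_structure p n c u0 u1 u2 \<longrightarrow>
        perron n (Y_col n c u0 u1 u2) x \<longrightarrow> (1 - 1 / p) * n - C0 \<le> spec_rad n (Y_col n c u0 u1 u2) \<longrightarrow>
        (\<forall>i<p. \<bar>real (card (part n c u0 i)) - n / p\<bar> \<le> \<delta> * n) \<and>
        (\<forall>v<n. v \<noteq> u0 \<longrightarrow> \<bar>x v - 1\<bar> \<le> \<delta>) \<and> \<bar>x u0 - (real p - 2) / (real p - 1)\<bar> \<le> \<delta>"
      and Y: "Y_structure p n c u0 u1 u2"
      and x: "perron n (Y_col n c u0 u1 u2) x" and \<rho>': "(1 - 1 / p) * n - C0 \<le> spec_rad n (Y_col n c u0 u1 u2)"
      and ij: "i < p" "j < p"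
    interpret Y_structure p n c u0 u1 u2 by (rule Y)
    define \<rho> where "\<rho> = spec_rad n G"
    define s where "s i = real (card (P i))" for i
    define X where "X i = sum x (P i)" for i
    define T where "T = sum x ({..<n} - {u0}) + x u0"
    define I where "I i = (of_bool (i \<in> {c u1, c u2}) :: real)" for i
    have n0: "real n > 0" using u0n by simp
    note A' = A[rule_format, OF Y x \<rho>']
    note C' = C[rule_format, OF simple_G book_free[OF order_refl] x \<rho>']
    have size: "\<bar>s i - n / p\<bar> \<le> \<delta> * n" if "i < p" for i using A' that by (simp add: s_def)
    have xv: "\<bar>x v - 1\<bar> \<le> \<delta>" if "v < n" "v \<noteq> u0" for v using A' that by simp
    have x0: "\<bar>x u0 - \<theta>\<bar> \<le> \<delta>" using A' by (simp add: \<theta>_def)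
    \<comment> \<open>Within its class only \<open>u1\<close> gains the neighbour \<open>u0\<close>
      and loses \<open>u2\<close>, and symmetrically for \<open>u2\<close>; this is the bounded
      deviation from the generic row of the class.\<close>
    define err where "err i = (if i = c u1 then x u0 - x u2 else if i = c u2 then x u0 - x u1 else 0)" for i
    have err: "\<bar>err i\<bar> \<le> 3" for i
    proof -
      have b: "0 \<le> x v \<and> x v \<le> 3" if "v < n" for v using x C' that by (auto simp: perron_def)
      show ?thesis using b[OF u0n] b[OF u1n] b[OF u2n] by (simp add: err_def abs_le_iff)
    qed
    have eq: "(\<rho> + s i) * X i = s i * (T - I i * x u0) + err i" if i: "i < p" for i
    proof -
      have "\<rho> * X i = (\<Sum>v\<in>P i. nsum n G x v)"
        unfolding X_def sum_distrib_left using x by (intro sum.cong) (auto simp: perron_def \<rho>_def part_def)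
      also have "\<dots> = (\<Sum>v\<in>P i. (T - X i - I i * x u0) + of_bool (v = u1) * (x u0 - x u2) + of_bool (v = u2) * (x u0 - x u1))"
      proof (rule sum.cong[OF refl])
        fix v assume "v \<in> P i"
        then have v: "v < n" "v \<noteq> u0" "c v = i" by (auto simp: part_def)
        consider "v = u1" | "v = u2" | "v \<noteq> u1" "v \<noteq> u2" by blast
        then show "nsum n G x v = (T - X i - I i * x u0) + of_bool (v = u1) * (x u0 - x u2) + of_bool (v = u2) * (x u0 - x u1)"
        proof cases
          case 1
          then show ?thesis using v u12 by (simp add: nsum_other attached_def T_def X_def I_def)
        next
          case 2
          then show ?thesis using v u12 by (simp add: nsum_other attached_def T_def X_def I_def)
        next
          case 3
          then show ?thesis using v by (simp add: nsum_other attached_def T_def X_def I_def)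
        qed
      qed
      also have "\<dots> = s i * (T - X i - I i * x u0) + (\<Sum>v\<in>P i. of_bool (v = u1) * (x u0 - x u2)) + (\<Sum>v\<in>P i. of_bool (v = u2) * (x u0 - x u1))"
        by (simp add: sum.distrib s_def)
      also have "(\<Sum>v\<in>P i. of_bool (v = u1) * (x u0 - x u2)) = of_bool (c u1 = i) * (x u0 - x u2)"
      proof -
        have "(\<Sum>v\<in>P i. of_bool (v = u1) * (x u0 - x u2)) = (\<Sum>v\<in>P i. if v = u1 then x u0 - x u2 else 0)" by (intro sum.cong) auto
        then show ?thesis using u1n u01 by (simp add: part_def)
      qed
      also have "(\<Sum>v\<in>P i. of_bool (v = u2) * (x u0 - x u1)) = of_bool (c u2 = i) * (x u0 - x u1)"
      proof -
        have "(\<Sum>v\<in>P i. of_bool (v = u2) * (x u0 - x u1)) = (\<Sum>v\<in>P i. if v = u2 then x u0 - x u1 else 0)" by (intro sum.cong) auto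
        then show ?thesis using u2n u02 by (simp add: part_def)
      qed
      finally have "\<rho> * X i = s i * (T - X i - I i * x u0) + err i" using c12 by (auto simp: err_def)
      then show ?thesis by (simp add: algebra_simps)
    qed
    have Xb: "\<bar>X i - s i\<bar> \<le> \<delta> * s i" for i
    proof -
      have "\<bar>\<Sum>v\<in>P i. x v - 1\<bar> \<le> (\<Sum>v\<in>P i. \<delta>)"
        by (rule order_trans[OF sum_abs]) (intro sum_mono, auto simp: part_def intro: xv)
      then show ?thesis by (simp add: X_def s_def sum_subtractf mult.commute)
    qed
    have sn: "s i \<le> n" "0 \<le> s i" for i
    proof -
      have "card (P i) \<le> card {..<n}" by (intro card_mono) (auto simp: part_def)
      then show "s i \<le> n" "0 \<le> s i" by (simp_all add: s_def)
    qed
    have Xn: "\<bar>X i - n / p\<bar> \<le> 2 * \<delta> * n" if "i < p" for i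
    proof -
      have "\<delta> * s i \<le> \<delta> * n" using sn[of i] \<delta> by (intro mult_left_mono) auto
      then show ?thesis using Xb[of i] size[OF that] by linarith
    qed
    have Tn: "\<bar>T - n\<bar> \<le> 2 * \<delta> * n"
    proof -
      have "\<bar>\<Sum>v\<in>{..<n} - {u0}. x v - 1\<bar> \<le> (\<Sum>v\<in>{..<n} - {u0}. \<delta>)"
        by (rule order_trans[OF sum_abs]) (intro sum_mono, auto intro: xv)
      also have "\<dots> \<le> \<delta> * n" using \<delta> u0n by (simp add: of_nat_diff Suc_leI algebra_simps)
      finally have "\<bar>sum x ({..<n} - {u0}) - (real n - 1)\<bar> \<le> \<delta> * n"
        using u0n by (simp add: sum_subtractf of_nat_diff Suc_leI)
      then show ?thesis using x0 \<theta> \<delta> n1 unfolding T_def by linarith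
    qed
    have dn: "\<delta> * n > 0" "10 * (\<delta> * n) = e * n" using \<delta> n0 by simp_all
    have Rn: "\<bar>\<rho> + s i - n\<bar> \<le> e * n"
    proof -
      have \<rho>n: "\<bar>\<rho> - a * n\<bar> \<le> \<delta> * n" using C' \<rho>' n1 abs_ge_self[of C] abs_ge_self[of C0] unfolding a_def \<rho>_def abs_le_iff by linarith
      have "a * n + n / p = n" by (simp add: a_def algebra_simps)
      then show ?thesis using \<rho>n size[OF ij(1)] dn by linarith
    qed
    have Bn: "\<bar>(T - X j) - a * n\<bar> \<le> e * n"
    proof -
      have "a * n + n / p = n" by (simp add: a_def algebra_simps)
      then show ?thesis using Xn[OF ij(2)] Tn dn by linarith
    qed
    have Sn: "\<bar>x u0 * s i - \<theta> * n / p\<bar> \<le> e * n" if "i < p" for i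
    proof -
      have "x u0 * s i - \<theta> * n / p = (x u0 - \<theta>) * s i + \<theta> * (s i - n / p)" by (simp add: algebra_simps)
      also have "\<bar>\<dots>\<bar> \<le> \<bar>x u0 - \<theta>\<bar> * \<bar>s i\<bar> + \<bar>\<theta>\<bar> * \<bar>s i - n / p\<bar>"
        by (metis abs_mult abs_triangle_ineq)
      also have "\<dots> \<le> \<delta> * n + 1 * (\<delta> * n)" using x0 sn[of i] \<theta> size[OF that] \<delta> n0 by (intro add_mono mult_mono) auto
      also have "\<dots> \<le> e * n" using \<delta> n0 unfolding \<delta>(2)[symmetric] by simp
      finally show ?thesis .
    qed
    define d where "d = s i - s j"
    define J where "J = I i - I j"
    \<comment> \<open>To first order \<open>\<rho> + s i\<close> is \<open>n\<close>,
      \<open>T - X j\<close> is \<open>a * n\<close> and \<open>x u0 * s i\<close> is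
      \<open>\<theta> * n / p\<close>, so \<open>M\<close> is the main term of
      \<open>X i - X j\<close>.\<close>
    define M where "M = a * d - \<theta> / p * J"
    have J: "\<bar>J\<bar> \<le> 1" by (auto simp: J_def I_def)
    have "(X i - X j) * (\<rho> + s i) = d * (T - X j) - x u0 * (s i * I i - s j * I j) + err i - err j"
      using eq[OF ij(1)] eq[OF ij(2)] by (simp add: d_def algebra_simps)
    then have N: "(X i - X j) * (\<rho> + s i) - n * M
        = d * ((T - X j) - a * n) - (I i * (x u0 * s i - \<theta> * n / p) - I j * (x u0 * s j - \<theta> * n / p)) + (err i - err j)"
      by (simp add: M_def J_def algebra_simps)
    have tri: "\<bar>A - (B - B') + (D - D')\<bar> \<le> \<bar>A\<bar> + \<bar>B\<bar> + \<bar>B'\<bar> + \<bar>D\<bar> + \<bar>D'\<bar>" for A B B' D D' :: real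
      by linarith
    have "\<bar>d * ((T - X j) - a * n)\<bar> \<le> \<bar>d\<bar> * (e * n)" unfolding abs_mult using Bn by (intro mult_left_mono) auto
    moreover have "\<bar>I i * (x u0 * s i - \<theta> * n / p)\<bar> \<le> 1 * (e * n)" "\<bar>I j * (x u0 * s j - \<theta> * n / p)\<bar> \<le> 1 * (e * n)"
      unfolding abs_mult using Sn[OF ij(1)] Sn[OF ij(2)] by (intro mult_mono; simp add: I_def)+
    ultimately have "\<bar>(X i - X j) * (\<rho> + s i) - n * M\<bar> \<le> \<bar>d\<bar> * (e * n) + 1 * (e * n) + 1 * (e * n) + 3 + 3"
      unfolding N by (intro order_trans[OF tri] add_mono err)
    moreover have "6 \<le> e * n" using n1 dn abs_ge_zero[of C] abs_ge_zero[of C0] by linarith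
    ultimately have N1: "\<bar>(X i - X j) * (\<rho> + s i) - n * M\<bar> \<le> (\<bar>d\<bar> + 3) * (e * n)"
      unfolding distrib_right by linarith
    have Mb: "\<bar>M\<bar> \<le> \<bar>d\<bar> + 1"
    proof -
      have "\<bar>a * d\<bar> \<le> 1 * \<bar>d\<bar>" unfolding abs_mult using a by (intro mult_right_mono) auto
      moreover have "\<bar>\<theta> / p * J\<bar> \<le> 1 * 1" unfolding abs_mult using \<theta> J p by (intro mult_mono) (auto simp: field_simps)
      ultimately show ?thesis unfolding M_def by linarith
    qed
    have N2: "\<bar>M * (n - (\<rho> + s i))\<bar> \<le> (\<bar>d\<bar> + 1) * (e * n)"
      unfolding abs_mult using Mb Rn by (intro mult_mono) auto
    have "(X i - X j - M) * (\<rho> + s i) = ((X i - X j) * (\<rho> + s i) - n * M) + M * (n - (\<rho> + s i))" by (simp add: algebra_simps)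
    then have "\<bar>X i - X j - M\<bar> * \<bar>\<rho> + s i\<bar> \<le> (2 * \<bar>d\<bar> + 4) * (e * n)"
      unfolding abs_mult[symmetric] using N1 N2 by (simp only: distrib_right)
    moreover have "\<bar>\<rho> + s i\<bar> \<ge> 3/4 * n"
    proof -
      have "e * n \<le> 1/4 * n" using e n0 by (intro mult_right_mono) auto
      then show ?thesis using Rn by linarith
    qed
    ultimately have "\<bar>X i - X j - M\<bar> * (3/4 * n) \<le> (2 * \<bar>d\<bar> + 4) * (e * n)"
      by (meson abs_ge_zero mult_left_mono order_trans)
    then have "(\<bar>X i - X j - M\<bar> * (3/4)) * n \<le> ((2 * \<bar>d\<bar> + 4) * e) * n" by (simp add: mult_ac)
    then have "\<bar>X i - X j - M\<bar> * (3/4) \<le> (2 * \<bar>d\<bar> + 4) * e" using n0 by simp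
    also have "\<dots> = 2 * (e * \<bar>d\<bar>) + 4 * e" by (simp add: algebra_simps)
    also have "\<dots> \<le> 21/4 * (e * \<bar>d\<bar>) + 21/4 * e" using e(1) by (intro add_mono mult_right_mono) auto
    also have "\<dots> = 3/4 * (7 * e * (1 + \<bar>d\<bar>))" by (simp add: algebra_simps)
    also have "\<dots> \<le> 3/4 * (\<epsilon> * (1 + \<bar>d\<bar>))" using e by (intro mult_left_mono mult_right_mono) auto
    finally show "\<bar>sum x (P i) - sum x (P j) - ((1 - 1 / p) * (real (card (P i)) - real (card (P j)))
       - (real p - 2) / (real p - 1) / p * (of_bool (i \<in> {c u1, c u2}) - of_bool (j \<in> {c u1, c u2})))\<bar>
     \<le> \<epsilon> * (1 + \<bar>real (card (P i)) - real (card (P j))\<bar>)"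
      by (simp add: X_def M_def d_def J_def I_def s_def a_def \<theta>_def)
  qed
qed

section \<open>Balancing the classes\<close>

text \<open>The difference of the two adjacency matrices lives on row and column \<open>v\<close>,
  and its diagonal entry is 0, so nothing is counted twice.\<close>

lemma mixed_difference:
  assumes E: "simple_graph n E" and E': "simple_graph n E'" and v: "v < n"
    and off: "\<And>u w. u < n \<Longrightarrow> w < n \<Longrightarrow> u \<noteq> v \<Longrightarrow> w \<noteq> v \<Longrightarrow> E u w \<longleftrightarrow> E' u w"
  shows "(\<Sum>u<n. y u * (nsum n E' x u - nsum n E x u)) =
    y v * (nsum n E' x v - nsum n E x v) + x v * (nsum n E' y v - nsum n E y v)"
proof -
  have diff: "nsum n E' x u - nsum n E x u = (of_bool (E' v u) - of_bool (E v u)) * x v" if u: "u < n" "u \<noteq> v" for u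
  proof -
    have "nsum n E' x u - nsum n E x u = (\<Sum>w<n. (of_bool (E' u w) - of_bool (E u w)) * x w)"
      by (simp add: nsum_def sum_subtractf algebra_simps)
    also have "\<dots> = (\<Sum>w<n. if w = v then (of_bool (E' u v) - of_bool (E u v)) * x v else 0)"
      using off[OF u(1) _ u(2)] by (intro sum.cong) auto
    also have "\<dots> = (of_bool (E' u v) - of_bool (E u v)) * x v" using v by simp
    finally show ?thesis using simple_graphD(1)[OF E] simple_graphD(1)[OF E'] by (auto simp: of_bool_def)
  qed
  have "(\<Sum>u<n. y u * (nsum n E' x u - nsum n E x u)) =
     y v * (nsum n E' x v - nsum n E x v) + (\<Sum>u\<in>{..<n} - {v}. y u * (nsum n E' x u - nsum n E x u))"
    using v by (simp add: sum.remove)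
  also have "(\<Sum>u\<in>{..<n} - {v}. y u * (nsum n E' x u - nsum n E x u)) =
     (\<Sum>u\<in>{..<n} - {v}. x v * ((of_bool (E' v u) - of_bool (E v u)) * y u))"
    using diff by (intro sum.cong) auto
  also have "\<dots> = (\<Sum>u<n. x v * ((of_bool (E' v u) - of_bool (E v u)) * y u))"
    using v simple_graphD(2)[OF E, of v] simple_graphD(2)[OF E', of v] by (simp add: sum.remove[of _ v])
  also have "\<dots> = x v * (nsum n E' y v - nsum n E y v)"
    by (simp add: nsum_def sum_subtractf sum_distrib_left algebra_simps)
  finally show ?thesis .
qed

text \<open>Each eigenvalue equation is paired with the Perron vector of the other graph. The
  identity is exact, so changes of order \<open>1 / n\<close> are not blurred by second-order
  terms.\<close>

lemma spec_rad_difference: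
  assumes E: "simple_graph n E" and E': "simple_graph n E'" and v: "v < n"
    and off: "\<And>u w. u < n \<Longrightarrow> w < n \<Longrightarrow> u \<noteq> v \<Longrightarrow> w \<noteq> v \<Longrightarrow> E u w \<longleftrightarrow> E' u w"
    and x: "perron n E x" and y: "perron n E' y"
  shows "(spec_rad n E' - spec_rad n E) * (\<Sum>u<n. x u * y u) =
    y v * (nsum n E' x v - nsum n E x v) + x v * (nsum n E' y v - nsum n E y v)"
proof -
  have "spec_rad n E' * (\<Sum>u<n. x u * y u) = (\<Sum>u<n. x u * nsum n E' y u)"
    using y by (simp add: perron_def sum_distrib_left mult.left_commute)
  also have "\<dots> = (\<Sum>u<n. y u * nsum n E' x u)" by (rule nsum_sym[OF E'])
  finally have 1: "spec_rad n E' * (\<Sum>u<n. x u * y u) = (\<Sum>u<n. y u * nsum n E' x u)" .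
  have 2: "spec_rad n E * (\<Sum>u<n. x u * y u) = (\<Sum>u<n. y u * nsum n E x u)"
    using x by (simp add: perron_def sum_distrib_left mult_ac)
  have "(spec_rad n E' - spec_rad n E) * (\<Sum>u<n. x u * y u) = (\<Sum>u<n. y u * (nsum n E' x u - nsum n E x u))"
    using 1 2 by (simp add: left_diff_distrib right_diff_distrib sum_subtractf)
  then show ?thesis using mixed_difference[OF E E' v off] by simp
qed

text \<open>The old Perron vector serves as test vector: losing row and column \<open>v\<close>
  costs at most \<open>2 * 3 * 3 * n\<close> in the form. This keeps the modified graph in the range
  where the entry estimates apply to it as well.\<close>

lemma spec_rad_change_vertex:
  assumes E: "simple_graph n E" and E': "simple_graph n E'" and v: "v < n"
    and off: "\<And>u w. u < n \<Longrightarrow> w < n \<Longrightarrow> u \<noteq> v \<Longrightarrow> w \<noteq> v \<Longrightarrow> E u w \<longleftrightarrow> E' u w"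
    and x: "perron n E x" and x3: "\<And>i. i < n \<Longrightarrow> x i \<le> 3"
  shows "spec_rad n E - 18 \<le> spec_rad n E'"
proof -
  have n0: "n > 0" using v by simp
  have x0: "0 \<le> x i" if "i < n" for i using x that by (simp add: perron_def)
  have b: "0 \<le> nsum n F x v \<and> nsum n F x v \<le> 3 * real n" for F
  proof -
    have "nsum n F x v \<le> (\<Sum>w<n. 3)" unfolding nsum_def using x0 x3 by (intro sum_mono) (auto simp: of_bool_def)
    moreover have "0 \<le> nsum n F x v" unfolding nsum_def using x0 by (intro sum_nonneg) auto
    ultimately show ?thesis by simp
  qed
  have "quad n E' x - quad n E x = 2 * (x v * (nsum n E' x v - nsum n E x v))"
    using mixed_difference[OF E E' v off, of x x] by (simp add: quad_def right_diff_distrib sum_subtractf)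
  moreover have "x v * (nsum n E' x v - nsum n E x v) \<ge> - (3 * (3 * real n))"
  proof -
    have "x v * nsum n E x v \<le> 3 * (3 * real n)" using b[of E] x0[OF v] x3[OF v] by (intro mult_mono) auto
    moreover have "0 \<le> x v * nsum n E' x v" using b[of E'] x0[OF v] by simp
    ultimately show ?thesis by (simp add: right_diff_distrib)
  qed
  ultimately have "quad n E x - 18 * n \<le> quad n E' x" by simp
  moreover have "quad n E x = spec_rad n E * n" by (rule quad_perron[OF x])
  moreover have "quad n E' x \<le> spec_rad n E' * n"
    using quad_le_spec_rad[OF E' n0, of x] x by (simp add: perron_def)
  ultimately have "(spec_rad n E - 18) * n \<le> spec_rad n E' * n" by (simp add: algebra_simps)
  then show ?thesis using n0 by simp
qed

text \<open>Moving \<open>v\<close> changes its number of neighbours other than \<open>u0\<close> by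
  \<open>d - 1\<close> and its adjacency to \<open>u0\<close> by \<open>J\<close>, so the main term
  is \<open>2 * a * (d - 1 + J * \<theta>)\<close>. It is positive for \<open>d \<ge> 2\<close>
  because \<open>\<theta> < 1\<close>, and for \<open>d = 1\<close> with \<open>J = 1\<close>
  because \<open>\<theta> > 0\<close>.\<close>

lemma spec_rad_move:
  fixes p :: nat and C0 :: real
  assumes p: "p \<ge> 3"
  shows "\<forall>\<^sub>F n in sequentially. \<forall>c u0 u1 u2 v j. Y_structure p n c u0 u1 u2 \<longrightarrow>
    (1 - 1 / p) * n - C0 \<le> spec_rad n (Y_col n c u0 u1 u2) \<longrightarrow>
    v < n \<longrightarrow> v \<notin> {u0, u1, u2} \<longrightarrow> j < p \<longrightarrow>
    card (part n c u0 j) + 2 \<le> card (part n c u0 (c v)) \<or>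
      card (part n c u0 j) + 1 \<le> card (part n c u0 (c v)) \<and> c v \<in> {c u1, c u2} \<and> j \<notin> {c u1, c u2} \<longrightarrow>
    spec_rad n (Y_col n c u0 u1 u2) < spec_rad n (Y_col n (c(v := j)) u0 u1 u2)"
proof -
  define a where "a = 1 - 1 / real p"
  have a: "a \<ge> 1/2" "a \<le> 1" using p by (auto simp: a_def field_simps)
  define \<theta> where "\<theta> = (real p - 2) / (real p - 1)"
  have \<theta>: "1/2 \<le> \<theta>" "\<theta> \<le> 1" using p by (auto simp: \<theta>_def field_simps)
  have \<theta>': "1 - \<theta> \<ge> 1 / p" using p by (simp add: \<theta>_def field_simps)
  have p2: "p \<ge> 2" using p by simp
  \<comment> \<open>The collected errors amount to \<open>22 * e * d\<close> and must stay below the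
    guaranteed main term \<open>d / (2 * p)\<close>.\<close>
  define e where "e = 1 / (100 * real p)"
  have e: "e > 0" "e \<le> 1/100" "100 * e \<le> 1 / p" using p by (auto simp: e_def field_simps)
  obtain C where C: "\<forall>\<^sub>F n in sequentially. \<forall>E x. simple_graph n E \<longrightarrow> \<not> contains_book n E p 1 \<longrightarrow> perron n E x \<longrightarrow>
    (1 - 1 / p) * n - C0 \<le> spec_rad n E \<longrightarrow>
    (\<Sum>i<n. (x i - 1)\<^sup>2) \<le> C \<and> spec_rad n E \<le> (1 - 1 / p) * n + C \<and> (\<forall>i<n. x i \<le> 3)"
    using perron_near_uniform[OF p2 order_refl] by blast
  \<comment> \<open>The estimates are needed for both graphs, and moving \<open>v\<close> lowers the
    spectral radius by at most 18.\<close>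
  show ?thesis using C Y_perron_entries[OF p2 e(1), of "C0 + 18"] Y_perron_class_difference[OF p2 e(1), of "C0 + 18"]
  proof (eventually_elim, intro allI impI)
    fix n c u0 u1 u2 v j
    assume C: "\<forall>E x. simple_graph n E \<longrightarrow> \<not> contains_book n E p 1 \<longrightarrow> perron n E x \<longrightarrow>
        (1 - 1 / p) * n - C0 \<le> spec_rad n E \<longrightarrow>
        (\<Sum>i<n. (x i - 1)\<^sup>2) \<le> C \<and> spec_rad n E \<le> (1 - 1 / p) * n + C \<and> (\<forall>i<n. x i \<le> 3)"
      and A: "\<forall>c u0 u1 u2 x. Y_structure p n c u0 u1 u2 \<longrightarrow>
        perron n (Y_col n c u0 u1 u2) x \<longrightarrow> (1 - 1 / p) * n - (C0 + 18) \<le> spec_rad n (Y_col n c u0 u1 u2) \<longrightarrow>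
        (\<forall>i<p. \<bar>real (card (part n c u0 i)) - n / p\<bar> \<le> e * n) \<and>
        (\<forall>v<n. v \<noteq> u0 \<longrightarrow> \<bar>x v - 1\<bar> \<le> e) \<and> \<bar>x u0 - (real p - 2) / (real p - 1)\<bar> \<le> e"
      and B: "\<forall>c u0 u1 u2 x i j. Y_structure p n c u0 u1 u2 \<longrightarrow>
        perron n (Y_col n c u0 u1 u2) x \<longrightarrow> (1 - 1 / p) * n - (C0 + 18) \<le> spec_rad n (Y_col n c u0 u1 u2) \<longrightarrow>
        i < p \<longrightarrow> j < p \<longrightarrow>
        \<bar>sum x (part n c u0 i) - sum x (part n c u0 j) - ((1 - 1 / p) * (real (card (part n c u0 i)) - real (card (part n c u0 j)))
           - (real p - 2) / (real p - 1) / p * (of_bool (i \<in> {c u1, c u2}) - of_bool (j \<in> {c u1, c u2})))\<bar>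
         \<le> e * (1 + \<bar>real (card (part n c u0 i)) - real (card (part n c u0 j))\<bar>)"
      and Y: "Y_structure p n c u0 u1 u2" and \<rho>: "(1 - 1 / p) * n - C0 \<le> spec_rad n (Y_col n c u0 u1 u2)"
      and vn: "v < n" and v: "v \<notin> {u0, u1, u2}" and jp: "j < p"
      and unb: "card (part n c u0 j) + 2 \<le> card (part n c u0 (c v)) \<or>
        card (part n c u0 j) + 1 \<le> card (part n c u0 (c v)) \<and> c v \<in> {c u1, c u2} \<and> j \<notin> {c u1, c u2}"
    interpret Y_structure p n c u0 u1 u2 by (rule Y)
    define i where "i = c v"
    define c' where "c' = c(v := j)"
    have ij: "i \<noteq> j" using unb by (auto simp: i_def)
    have ip: "i < p" using cp vn v by (auto simp: i_def)
    have c'u: "c' u1 = c u1" "c' u2 = c u2" "c' v = j" using v by (auto simp: c'_def)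
    have Y': "Y_structure p n c' u0 u1 u2"
      using p2 u0n u1n u2n u01 u02 c12 cp jp v by unfold_locales (auto simp: c'_def)
    interpret Y': Y_structure p n c' u0 u1 u2 by (rule Y')
    let ?G = "Y_col n c u0 u1 u2" and ?G' = "Y_col n c' u0 u1 u2"
    have off: "?G u w \<longleftrightarrow> ?G' u w" if "u < n" "w < n" "u \<noteq> v" "w \<noteq> v" for u w
      using that c'u by (simp add: Y_col_def attached_def c'_def)
    have n0: "n > 0" using vn by simp
    obtain x where x: "perron n ?G x" using perron_exists[OF simple_G n0] by blast
    obtain y where y: "perron n ?G' y" using perron_exists[OF Y'.simple_G n0] by blast
    have x3: "x i \<le> 3" if "i < n" for i
      using C[rule_format, OF simple_G book_free[OF order_refl] x \<rho>] that by blast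
    have "spec_rad n ?G - 18 \<le> spec_rad n ?G'"
      by (rule spec_rad_change_vertex[OF simple_G Y'.simple_G vn off x x3])
    then have \<rho>2: "(1 - 1 / p) * n - (C0 + 18) \<le> spec_rad n ?G'" using \<rho> by linarith
    have \<rho>1: "(1 - 1 / p) * n - (C0 + 18) \<le> spec_rad n ?G" using \<rho> by linarith
    have P'i: "part n c u0 i = insert v (part n c' u0 i)" "v \<notin> part n c' u0 i"
      using vn v ij by (auto simp: part_def c'_def i_def)
    have P'j: "part n c' u0 j = insert v (part n c u0 j)" "v \<notin> part n c u0 j"
      using vn v ij by (auto simp: part_def c'_def i_def)
    define d where "d = real (card (part n c u0 i)) - real (card (part n c u0 j))"
    have d': "real (card (part n c' u0 i)) - real (card (part n c' u0 j)) = d - 2"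
      using P'i P'j by (simp add: d_def)
    define J where "J = of_bool (i \<in> {c u1, c u2}) - (of_bool (j \<in> {c u1, c u2}) :: real)"
    have J: "-1 \<le> J" "J \<le> 1" by (auto simp: J_def)
    have att: "attached c u1 u2 v \<longleftrightarrow> i \<notin> {c u1, c u2}" "attached c' u1 u2 v \<longleftrightarrow> j \<notin> {c u1, c u2}"
      using v c'u by (auto simp: attached_def i_def)
    define \<Delta> where "\<Delta> f = nsum n ?G' f v - nsum n ?G f v" for f
    have \<Delta>: "\<Delta> f = sum f (part n c u0 i) - sum f (part n c' u0 j) + J * f u0" for f
    proof -
      have v3: "v \<noteq> u0" "v \<noteq> u1" "v \<noteq> u2" using v by auto
      have "of_bool (j \<notin> {c u1, c u2}) - of_bool (i \<notin> {c u1, c u2}) = J" by (auto simp: J_def)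
      moreover have "nsum n ?G f v = sum f ({..<n} - {u0}) - sum f (part n c u0 i) + of_bool (i \<notin> {c u1, c u2}) * f u0"
        using nsum_other[OF vn v3(1), of f] v3 att(1) by (simp add: i_def)
      moreover have "nsum n ?G' f v = sum f ({..<n} - {u0}) - sum f (part n c' u0 j) + of_bool (j \<notin> {c u1, c u2}) * f u0"
        using Y'.nsum_other[OF vn v3(1), of f] v3 att(2) c'u by simp
      ultimately show ?thesis unfolding \<Delta>_def by (simp add: algebra_simps flip: left_diff_distrib)
    qed
    \<comment> \<open>\<open>x\<close> is known on the classes of \<open>c\<close> and
      \<open>y\<close> on those of \<open>c'\<close>. Rewriting each accordingly costs
      \<open>- x v\<close> and \<open>+ y v\<close>, which cancel to first order.\<close>
    have \<Delta>x: "\<Delta> x = (sum x (part n c u0 i) - sum x (part n c u0 j)) - x v + J * x u0"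
      unfolding \<Delta> P'j(1) using P'j(2) by simp
    have \<Delta>y: "\<Delta> y = (sum y (part n c' u0 i) - sum y (part n c' u0 j)) + y v + J * y u0"
      unfolding \<Delta> P'i(1) using P'i(2) by simp
    note Ax = A[rule_format, OF Y x \<rho>1] and Ay = A[rule_format, OF Y' y \<rho>2]
    have xv: "\<bar>x v - 1\<bar> \<le> e" "\<bar>y v - 1\<bar> \<le> e" using Ax Ay vn v by auto
    have xu: "\<bar>x u0 - \<theta>\<bar> \<le> e" "\<bar>y u0 - \<theta>\<bar> \<le> e" using Ax Ay by (auto simp: \<theta>_def)
    have Bx: "\<bar>sum x (part n c u0 i) - sum x (part n c u0 j) - (a * d - \<theta> / p * J)\<bar> \<le> e * (1 + \<bar>d\<bar>)"
      using B[rule_format, OF Y x \<rho>1 ip jp] unfolding d_def[symmetric] J_def[symmetric] a_def[symmetric] \<theta>_def[symmetric] .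
    have By: "\<bar>sum y (part n c' u0 i) - sum y (part n c' u0 j) - (a * (d - 2) - \<theta> / p * J)\<bar> \<le> e * (1 + \<bar>d - 2\<bar>)"
      using B[rule_format, OF Y' y \<rho>2 ip jp] unfolding d' c'u J_def[symmetric] a_def[symmetric] \<theta>_def[symmetric] .
    have d1: "d \<ge> 1" using unb by (auto simp: d_def i_def)
    have Jx: "\<bar>J * x u0 - J * \<theta>\<bar> \<le> e" "\<bar>J * y u0 - J * \<theta>\<bar> \<le> e"
    proof -
      have "\<bar>J * (z - \<theta>)\<bar> \<le> 1 * e" if "\<bar>z - \<theta>\<bar> \<le> e" for z
        unfolding abs_mult using J that by (intro mult_mono) auto
      then show "\<bar>J * x u0 - J * \<theta>\<bar> \<le> e" "\<bar>J * y u0 - J * \<theta>\<bar> \<le> e" using xu by (simp_all add: right_diff_distrib)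
    qed
    define Lx where "Lx = a * d - \<theta> / p * J - 1 + J * \<theta>"
    define Ly where "Ly = a * (d - 2) - \<theta> / p * J + 1 + J * \<theta>"
    have ed: "e * 1 \<le> e * d" using e d1 by (intro mult_left_mono) auto
    have "e * (1 + \<bar>d\<bar>) \<le> e * (2 * d)" "e * (1 + \<bar>d - 2\<bar>) \<le> e * (2 * d)"
      using e d1 by (intro mult_left_mono; simp)+
    note Bx' = order_trans[OF Bx this(1)] and By' = order_trans[OF By this(2)]
    have tri: "\<bar>S - M\<bar> \<le> A \<Longrightarrow> \<bar>r - t\<bar> \<le> e \<Longrightarrow> \<bar>z\<bar> \<le> e \<Longrightarrow> \<bar>(S + z + r) - (M + t)\<bar> \<le> A + 2 * e"
      for S M A r t z :: real by linarith
    have edd: "e * (2 * d) + 2 * e \<le> 4 * (e * d)" using ed by (simp add: mult.commute)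
    have Lx: "\<bar>\<Delta> x - Lx\<bar> \<le> 4 * (e * d)"
      using order_trans[OF tri[OF Bx' Jx(1), of "1 - x v"] edd] xv(1)
      unfolding \<Delta>x Lx_def by (simp add: algebra_simps abs_minus_commute)
    have Ly: "\<bar>\<Delta> y - Ly\<bar> \<le> 4 * (e * d)"
      using order_trans[OF tri[OF By' Jx(2), of "y v - 1"] edd] xv(2)
      unfolding \<Delta>y Ly_def by (simp add: algebra_simps)
    have ad: "0 \<le> a * d" "a * d \<le> d" using a d1 by (auto simp: mult_le_cancel_right1)
    have JT: "\<bar>J * \<theta>\<bar> \<le> 1" "\<bar>\<theta> / p * J\<bar> \<le> 1"
    proof -
      show "\<bar>J * \<theta>\<bar> \<le> 1" unfolding abs_mult using J \<theta> by (intro mult_le_one) auto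
      have "\<theta> / p \<le> 1" using \<theta> p by (simp add: field_simps)
      then show "\<bar>\<theta> / p * J\<bar> \<le> 1" unfolding abs_mult using J \<theta> by (intro mult_le_one) auto
    qed
    have ed2: "4 * (e * d) \<le> d" using e d1 mult_right_mono[of e "1/100" d] by simp
    have Db: "\<bar>\<Delta> x\<bar> \<le> 7 * d" "\<bar>\<Delta> y\<bar> \<le> 7 * d"
    proof -
      have g1: "0 \<le> A \<Longrightarrow> A \<le> d \<Longrightarrow> \<bar>H\<bar> \<le> 1 \<Longrightarrow> \<bar>K\<bar> \<le> 1 \<Longrightarrow> \<bar>A - K - 1 + H\<bar> \<le> 4 * d"
        and g2: "0 \<le> A \<Longrightarrow> A \<le> d \<Longrightarrow> \<bar>H\<bar> \<le> 1 \<Longrightarrow> \<bar>K\<bar> \<le> 1 \<Longrightarrow> \<bar>A - a * 2 - K + 1 + H\<bar> \<le> 6 * d" for A H K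
        using d1 a by linarith+
      have "\<bar>Lx\<bar> \<le> 4 * d" unfolding Lx_def by (rule g1[OF ad JT])
      then show "\<bar>\<Delta> x\<bar> \<le> 7 * d" using Lx ed2 d1 by linarith
      have "\<bar>Ly\<bar> \<le> 6 * d" unfolding Ly_def right_diff_distrib by (rule g2[OF ad JT])
      then show "\<bar>\<Delta> y\<bar> \<le> 7 * d" using Ly ed2 by linarith
    qed
    have P: "\<bar>(z - 1) * D\<bar> \<le> 7 * (e * d)" if "\<bar>z - 1\<bar> \<le> e" "\<bar>D\<bar> \<le> 7 * d" for z D
    proof -
      have "\<bar>(z - 1) * D\<bar> \<le> e * (7 * d)" unfolding abs_mult using that e by (intro mult_mono) auto
      then show ?thesis by simp
    qed
    have S: "y v * \<Delta> x + x v * \<Delta> y \<ge> Lx + Ly - 22 * (e * d)"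
    proof -
      have "y v * \<Delta> x = \<Delta> x + (y v - 1) * \<Delta> x" "x v * \<Delta> y = \<Delta> y + (x v - 1) * \<Delta> y" by (simp_all add: algebra_simps)
      then show ?thesis using P[OF xv(2) Db(1)] P[OF xv(1) Db(2)] Lx Ly by linarith
    qed
    have "Lx + Ly = 2 * a * (d - 1 + J * \<theta>)" by (simp add: Lx_def Ly_def a_def algebra_simps add_divide_distrib)
    also have "\<dots> \<ge> 1 * (d / (2 * p))"
    proof (rule mult_mono)
      show "d / (2 * p) \<le> d - 1 + J * \<theta>"
      proof (cases "J = 1")
        case True
        have "d / (2 * p) \<le> d / 2" using d1 p by (intro divide_left_mono) auto
        then show ?thesis using True \<theta> d1 by simp
      next
        case False
        then have "d \<ge> 2" using unb by (auto simp: d_def i_def J_def)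
        have "d / (2 * p) \<le> (d - 1) / p" using \<open>d \<ge> 2\<close> p by (simp add: field_simps)
        also have "\<dots> \<le> (d - 1) * (1 - \<theta>)" using \<theta>' d1 mult_left_mono[of "1 / p" "1 - \<theta>" "d - 1"] by simp
        also have "\<dots> \<le> d - 1 + J * \<theta>"
        proof -
          have "(-1) * \<theta> \<le> J * \<theta>" "2 * \<theta> \<le> d * \<theta>" using J \<theta> \<open>d \<ge> 2\<close> by (intro mult_right_mono; simp)+
          moreover have "(d - 1) * (1 - \<theta>) = d - 1 - d * \<theta> + \<theta>" by (simp add: algebra_simps)
          ultimately show ?thesis by linarith
        qed
        finally show ?thesis .
      qed
      show "1 \<le> 2 * a" using a by simp
      show "0 \<le> 2 * a" using a by simp
      show "0 \<le> d / (2 * p)" using d1 by simp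
    qed
    finally have "Lx + Ly \<ge> d / (2 * p)" by simp
    moreover have "22 * (e * d) < d / (2 * p)"
    proof -
      have "100 * e * d \<le> 1 / p * d" using e d1 by (intro mult_right_mono) auto
      then have "100 * (e * d) \<le> 2 * (d / (2 * p))" by simp
      moreover have "e * d > 0" using e d1 by simp
      ultimately show ?thesis by linarith
    qed
    ultimately have "0 < y v * \<Delta> x + x v * \<Delta> y" using S by linarith
    then have "0 < (spec_rad n ?G' - spec_rad n ?G) * (\<Sum>u<n. x u * y u)"
      using spec_rad_difference[OF simple_G Y'.simple_G vn off x y] by (simp add: \<Delta>_def)
    moreover have "0 \<le> (\<Sum>u<n. x u * y u)" using x y by (intro sum_nonneg) (auto simp: perron_def)
    ultimately show "spec_rad n ?G < spec_rad n (Y_col n (c(v := j)) u0 u1 u2)"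
      unfolding c'_def[symmetric] by (simp add: zero_less_mult_iff)
  qed
qed

text \<open>The conditions under which \<open>spec_rad_move\<close> offers no improvement: the sizes
  of a Turan graph, with no special class larger than an ordinary one.\<close>

definition balanced :: "nat \<Rightarrow> nat \<Rightarrow> (nat \<Rightarrow> nat) \<Rightarrow> nat \<Rightarrow> nat \<Rightarrow> nat \<Rightarrow> bool" where
  "balanced p n c u0 u1 u2 \<longleftrightarrow> (\<forall>i<p. \<forall>j<p. card (part n c u0 i) \<le> card (part n c u0 j) + 1 \<and>
     (i \<in> {c u1, c u2} \<and> j \<notin> {c u1, c u2} \<longrightarrow> card (part n c u0 i) \<le> card (part n c u0 j)))"

lemma unbalanced_improvable:
  fixes p :: nat and C0 :: real
  assumes p: "p \<ge> 3"
  shows "\<forall>\<^sub>F n in sequentially. \<forall>c u0 u1 u2. Y_structure p n c u0 u1 u2 \<longrightarrow>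
    (1 - 1 / p) * n - C0 \<le> spec_rad n (Y_col n c u0 u1 u2) \<longrightarrow> \<not> balanced p n c u0 u1 u2 \<longrightarrow>
    (\<exists>c'. Y_structure p n c' u0 u1 u2 \<and> spec_rad n (Y_col n c u0 u1 u2) < spec_rad n (Y_col n c' u0 u1 u2))"
proof -
  have p2: "p \<ge> 2" using p by simp
  \<comment> \<open>\<open>n / p - e * n = e * n\<close>, so the oversized class has at least three
    vertices and hence one other than \<open>u1\<close> and \<open>u2\<close> that can be
    moved.\<close>
  define e where "e = 1 / (2 * real p)"
  have e: "e > 0" using p by (simp add: e_def)
  have "\<forall>\<^sub>F n in sequentially. 3 \<le> e * real n" using e by real_asymp
  then show ?thesis using spec_rad_move[OF p, of C0] Y_perron_entries[OF p2 e, of C0]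
  proof (eventually_elim, intro allI impI)
    fix n c u0 u1 u2
    assume n: "3 \<le> e * real n"
      and M: "\<forall>c u0 u1 u2 v j. Y_structure p n c u0 u1 u2 \<longrightarrow>
        (1 - 1 / p) * n - C0 \<le> spec_rad n (Y_col n c u0 u1 u2) \<longrightarrow>
        v < n \<longrightarrow> v \<notin> {u0, u1, u2} \<longrightarrow> j < p \<longrightarrow>
        card (part n c u0 j) + 2 \<le> card (part n c u0 (c v)) \<or>
          card (part n c u0 j) + 1 \<le> card (part n c u0 (c v)) \<and> c v \<in> {c u1, c u2} \<and> j \<notin> {c u1, c u2} \<longrightarrow>
        spec_rad n (Y_col n c u0 u1 u2) < spec_rad n (Y_col n (c(v := j)) u0 u1 u2)"
      and A: "\<forall>c u0 u1 u2 x. Y_structure p n c u0 u1 u2 \<longrightarrow>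
        perron n (Y_col n c u0 u1 u2) x \<longrightarrow> (1 - 1 / p) * n - C0 \<le> spec_rad n (Y_col n c u0 u1 u2) \<longrightarrow>
        (\<forall>i<p. \<bar>real (card (part n c u0 i)) - n / p\<bar> \<le> e * n) \<and>
        (\<forall>v<n. v \<noteq> u0 \<longrightarrow> \<bar>x v - 1\<bar> \<le> e) \<and> \<bar>x u0 - (real p - 2) / (real p - 1)\<bar> \<le> e"
      and Y: "Y_structure p n c u0 u1 u2" and \<rho>: "(1 - 1 / p) * n - C0 \<le> spec_rad n (Y_col n c u0 u1 u2)"
      and nb: "\<not> balanced p n c u0 u1 u2"
    interpret Y_structure p n c u0 u1 u2 by (rule Y)
    obtain i j where ij: "i < p" "j < p" "card (P j) + 2 \<le> card (P i) \<or>
        card (P j) + 1 \<le> card (P i) \<and> i \<in> {c u1, c u2} \<and> j \<notin> {c u1, c u2}"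
      using nb unfolding balanced_def by (auto simp: not_le)
    obtain x where x: "perron n G x" using perron_exists[OF simple_G] u0n by fastforce
    have "\<bar>real (card (P i)) - n / p\<bar> \<le> e * n" using A Y x \<rho> ij by blast
    moreover have "n / p = 2 * (e * n)" using p by (simp add: e_def)
    ultimately have "real (card (P i)) \<ge> 3" using n by linarith
    then have "card (P i) \<ge> 3" by simp
    moreover have "card {u1, u2} \<le> 2" by (simp add: card_insert_if)
    ultimately have "\<not> P i \<subseteq> {u1, u2}" using card_mono[of "{u1, u2}" "P i"] by auto
    then obtain v where v: "v \<in> P i" "v \<notin> {u1, u2}" by blast
    have v': "v < n" "v \<notin> {u0, u1, u2}" "c v = i" using v by (auto simp: part_def)
    have "spec_rad n G < spec_rad n (Y_col n (c(v := j)) u0 u1 u2)"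
      using M[rule_format, OF Y \<rho> v'(1,2) ij(2)] ij(3) v'(3) by simp
    moreover have "Y_structure p n (c(v := j)) u0 u1 u2"
      using p2 u0n u1n u2n u01 u02 c12 cp ij v' by unfold_locales auto
    ultimately show "\<exists>c'. Y_structure p n c' u0 u1 u2 \<and> spec_rad n G < spec_rad n (Y_col n c' u0 u1 u2)" by blast
  qed
qed

section \<open>Isomorphism of balanced structures\<close>

lemma card_residue_class:
  fixes N p i :: nat
  assumes "i < p"
  shows "card {t. t < N \<and> t mod p = i} = N div p + of_bool (i < N mod p)"
proof -
  define k where "k = N div p + of_bool (i < N mod p)"
  have p0: "p > 0" using assms by simp
  have iff: "q * p + i < N \<longleftrightarrow> q < k" for q
  proof -
    have N: "N = N div p * p + N mod p" "N mod p < p" using p0 by auto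
    consider "q < N div p" | "q = N div p" | "q > N div p" by linarith
    then show ?thesis
    proof cases
      case 1
      then have "Suc q * p \<le> N div p * p" by (intro mult_le_mono1) simp
      moreover have "N div p * p \<le> N" by simp
      ultimately have "q * p + p \<le> N" unfolding mult_Suc by linarith
      then have "q * p + i < N" using assms by simp
      then show ?thesis using 1 by (simp add: k_def)
    next
      case 2
      have "N div p * p + i < N \<longleftrightarrow> i < N mod p" using N(1) by linarith
      then show ?thesis using 2 by (simp add: k_def)
    next
      case 3
      then have "Suc (N div p) * p \<le> q * p" by (intro mult_le_mono1) simp
      then have "N div p * p + p \<le> q * p" by simp
      then have "\<not> q * p + i < N" using N by linarith
      then show ?thesis using 3 by (simp add: k_def)
    qed
  qed
  have "{t. t < N \<and> t mod p = i} = (\<lambda>q. q * p + i) ` {..<k}"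
  proof (intro equalityI subsetI)
    fix t assume t: "t \<in> {t. t < N \<and> t mod p = i}"
    then have eq: "t div p * p + i = t" by (metis (mono_tags) div_mult_mod_eq mem_Collect_eq)
    have "t div p < k" using iff[of "t div p"] t unfolding eq by simp
    then show "t \<in> (\<lambda>q. q * p + i) ` {..<k}" by (intro image_eqI[of _ _ "t div p"]) (simp_all only: eq lessThan_iff)
  next
    fix t assume "t \<in> (\<lambda>q. q * p + i) ` {..<k}"
    then obtain q where "q < k" "t = q * p + i" by blast
    then show "t \<in> {t. t < N \<and> t mod p = i}" using iff[of q] assms by simp
  qed
  moreover have "inj_on (\<lambda>q. q * p + i) {..<k}" using p0 by (auto simp: inj_on_def)
  ultimately show ?thesis by (simp add: card_image k_def)
qed

text \<open>Truncated subtraction gives vertex 0 the colour \<open>(0 - 1) mod p = 0\<close>, which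
  is harmless because vertex 0 plays \<open>u0\<close>, whose colour is never consulted.\<close>

lemma Y_graph_eq:
  assumes "p \<ge> 3"
  shows "Y_graph p n = Y_col n (\<lambda>v. (v - 1) mod p) 0 p (p - 1)"
proof (intro ext)
  fix u v :: nat
  have m: "(p - 1) mod p = p - 1" "(p - 1 - 1) mod p = p - 2" using assms by auto
  have lt: "(w - 1) mod p < p - 2 \<longleftrightarrow> (w - 1) mod p \<noteq> p - 1 \<and> (w - 1) mod p \<noteq> p - 2" for w
  proof -
    have "(w - 1) mod p < p" using assms by simp
    then show ?thesis using assms by linarith
  qed
  have att: "attached (\<lambda>v. (v - 1) mod p) p (p - 1) w \<longleftrightarrow> (w - 1) mod p < p - 2 \<or> w = p - 1 \<or> w = p" for w
    unfolding attached_def m lt by auto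
  have pp: "p \<noteq> 0" "p - 1 \<noteq> 0" "p - 1 \<noteq> p" using assms by auto
  consider "u = 0" | "v = 0" "u \<noteq> 0" | "u \<noteq> 0" "v \<noteq> 0" by blast
  then show "Y_graph p n u v = Y_col n (\<lambda>v. (v - 1) mod p) 0 p (p - 1) u v"
  proof cases
    case 1
    then show ?thesis unfolding Y_graph_def Y_col_def att by auto
  next
    case 2
    then show ?thesis unfolding Y_graph_def Y_col_def att by auto
  next
    case 3
    then have "{u, v} \<noteq> {p - 1, p} \<longleftrightarrow> \<not> (u = p \<and> v = p - 1) \<and> \<not> (u = p - 1 \<and> v = p)"
      by (auto simp: doubleton_eq_iff)
    then show ?thesis using 3 unfolding Y_graph_def Y_col_def by auto
  qed
qed

lemma Y_graph_structure:
  assumes "p \<ge> 3" "n > p"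
  shows "Y_structure p n (\<lambda>v. (v - 1) mod p) 0 p (p - 1)"
  using assms by unfold_locales auto

lemma Y_graph_sizes:
  assumes "i < p"
  shows "card (part n (\<lambda>v. (v - 1) mod p) 0 i) = (n - 1) div p + of_bool (i < (n - 1) mod p)"
proof -
  have "part n (\<lambda>v. (v - 1) mod p) 0 i = Suc ` {t. t < n - 1 \<and> t mod p = i}"
  proof (intro equalityI subsetI)
    fix w assume "w \<in> part n (\<lambda>v. (v - 1) mod p) 0 i"
    then show "w \<in> Suc ` {t. t < n - 1 \<and> t mod p = i}"
      by (intro image_eqI[of _ _ "w - 1"]) (auto simp: part_def)
  qed (auto simp: part_def)
  then show ?thesis using card_residue_class[OF assms] by (simp add: card_image)
qed

text \<open>The enlarged classes are those of index below \<open>(n - 1) mod p\<close>, and the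
  special indices \<open>p - 2\<close> and \<open>p - 1\<close> come last.\<close>

lemma Y_graph_balanced:
  assumes "p \<ge> 3"
  shows "balanced p n (\<lambda>v. (v - 1) mod p) 0 p (p - 1)"
proof -
  have "(p - 1) mod p = p - 1" "(p - 1 - 1) mod p = p - 2" using assms by auto
  moreover have "(n - 1) mod p < p" using assms by simp
  ultimately show ?thesis unfolding balanced_def by (auto simp: Y_graph_sizes simp del: One_nat_def)
qed

context Y_structure
begin

lemma swap: "Y_structure p n c u0 u2 u1"
  using p2 u0n u1n u2n u01 u02 c12 cp by unfold_locales auto

lemma Y_col_swap: "Y_col n c u0 u2 u1 = G"
proof -
  have "attached c u2 u1 = attached c u1 u2" by (auto simp: attached_def)
  then show ?thesis unfolding Y_col_def by (intro ext) auto
qed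

lemma Y_col_cong:
  assumes "\<And>v. v < n \<Longrightarrow> v \<noteq> u0 \<Longrightarrow> d v = c v"
  shows "Y_col n d u0 u1 u2 = G"
proof (intro ext)
  fix u v
  have d: "d u1 = c u1" "d u2 = c u2" using assms u1n u2n u01 u02 by auto
  show "Y_col n d u0 u1 u2 u v = G u v"
  proof (cases "u < n \<and> v < n")
    case True
    then show ?thesis using assms[of u] assms[of v] d u0n
      unfolding Y_col_def attached_def by (cases "u = u0"; cases "v = u0") simp_all
  qed (auto simp: Y_col_def)
qed

lemma balanced_swap: "balanced p n c u0 u1 u2 \<Longrightarrow> balanced p n c u0 u2 u1"
  unfolding balanced_def by (simp add: insert_commute)

text \<open>The first special class has minimal size, so fewer than \<open>p\<close> classes are
  enlarged and division with remainder determines their number. The second special class can be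
  enlarged only when all ordinary ones are, that is, for remainder \<open>p - 1\<close>.\<close>

lemma balanced_sizes:
  assumes b: "balanced p n c u0 u1 u2" and le: "card (P (c u1)) \<le> card (P (c u2))"
  defines "m \<equiv> (n - 1) div p" and "r \<equiv> (n - 1) mod p"
  shows "card (P (c u1)) = m" "card (P (c u2)) = m + of_bool (r = p - 1)"
    and "\<And>i. i < p \<Longrightarrow> card (P i) = m \<or> card (P i) = m + 1"
    and "card {i. i < p \<and> i \<notin> {c u1, c u2} \<and> card (P i) = m + 1} = r - of_bool (r = p - 1)"
proof -
  define k where "k = card (P (c u1))"
  have k: "card (P i) = k \<or> card (P i) = k + 1" if i: "i < p" for i
  proof -
    have "card (P i) \<le> k + 1" using b i special by (auto simp: balanced_def k_def)
    moreover have "k \<le> card (P i)"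
      using b i special le unfolding balanced_def k_def by (cases "i \<in> {c u1, c u2}") auto
    ultimately show ?thesis by linarith
  qed
  define B where "B = {i. i < p \<and> card (P i) = k + 1}"
  have finB: "finite B" by (simp add: B_def)
  have Bsub: "B \<subseteq> {..<p} - {c u1}" by (auto simp: B_def k_def)
  have cB: "card B < p"
    using card_mono[OF _ Bsub] special p2 by simp
  have "n - 1 = (\<Sum>i<p. card (P i))" by (rule sum_sizes[symmetric])
  also have "\<dots> = (\<Sum>i<p. k + of_bool (i \<in> B))" using k by (intro sum.cong) (auto simp: B_def)
  also have "\<dots> = p * k + card ({..<p} \<inter> B)" by (simp only: sum.distrib) simp
  also have "{..<p} \<inter> B = B" by (auto simp: B_def)
  finally have N: "n - 1 = p * k + card B" .
  have mk: "m = k" and rB: "r = card B" using N cB by (simp_all add: m_def r_def)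
  show "card (P (c u1)) = m" by (simp add: mk k_def)
  show sz: "card (P i) = m \<or> card (P i) = m + 1" if "i < p" for i using k[OF that] mk by simp
  have u2B: "c u2 \<in> B \<longleftrightarrow> r = p - 1"
  proof
    assume u: "c u2 \<in> B"
    have "{..<p} - {c u1} \<subseteq> B"
    proof
      fix j assume j: "j \<in> {..<p} - {c u1}"
      show "j \<in> B"
      proof (cases "j = c u2")
        case False
        then have "card (P (c u2)) \<le> card (P j)" using b j special unfolding balanced_def by auto
        then show ?thesis using u k[of j] j by (auto simp: B_def)
      qed (use u in simp)
    qed
    then have "B = {..<p} - {c u1}" using Bsub by blast
    then show "r = p - 1" using special by (simp add: rB)
  next
    assume "r = p - 1"
    then have "B = {..<p} - {c u1}" using Bsub special by (intro card_subset_eq) (simp_all add: rB)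
    then show "c u2 \<in> B" using special c12 by auto
  qed
  then show "card (P (c u2)) = m + of_bool (r = p - 1)"
    using k[OF special(2)] special by (auto simp: B_def mk)
  have "{i. i < p \<and> i \<notin> {c u1, c u2} \<and> card (P i) = m + 1} = B - {c u2}"
    using Bsub by (auto simp: B_def mk)
  then show "card {i. i < p \<and> i \<notin> {c u1, c u2} \<and> card (P i) = m + 1} = r - of_bool (r = p - 1)"
    using u2B finB by (auto simp: rB)
qed

end

text \<open>By \<open>balanced_sizes\<close> both structures have equally many enlarged ordinary
  classes, so special, enlarged and remaining colours can be matched separately.\<close>

lemma colour_bijection:
  assumes Y: "Y_structure p n c u0 u1 u2" and b: "balanced p n c u0 u1 u2"
    and le: "card (part n c u0 (c u1)) \<le> card (part n c u0 (c u2))"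
    and Y': "Y_structure p n d w0 w1 w2" and b': "balanced p n d w0 w1 w2"
    and le': "card (part n d w0 (d w1)) \<le> card (part n d w0 (d w2))"
  shows "\<exists>\<pi>. bij_betw \<pi> {..<p} {..<p} \<and> \<pi> (c u1) = d w1 \<and> \<pi> (c u2) = d w2 \<and>
    (\<forall>i<p. card (part n d w0 (\<pi> i)) = card (part n c u0 i))"
proof -
  interpret A: Y_structure p n c u0 u1 u2 by (rule Y)
  interpret B: Y_structure p n d w0 w1 w2 by (rule Y')
  note sA = A.balanced_sizes[OF b le] and sB = B.balanced_sizes[OF b' le']
  define m where "m = (n - 1) div p"
  define R where "R = {i. i < p \<and> i \<notin> {c u1, c u2} \<and> card (A.P i) = m + 1}"
  define R' where "R' = {i. i < p \<and> i \<notin> {d w1, d w2} \<and> card (B.P i) = m + 1}"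
  define S where "S = {..<p} - {c u1, c u2} - R"
  define S' where "S' = {..<p} - {d w1, d w2} - R'"
  have fin: "finite R" "finite R'" "finite S" "finite S'" by (auto simp: R_def R'_def S_def S'_def)
  have cR: "card R = card R'" using sA(4) sB(4) by (simp add: R_def R'_def m_def)
  have "card ({..<p} - {c u1, c u2}) = p - 2" using A.special A.c12 by (subst card_Diff_subset) auto
  moreover have "card ({..<p} - {d w1, d w2}) = p - 2" using B.special B.c12 by (subst card_Diff_subset) auto
  moreover have "R \<subseteq> {..<p} - {c u1, c u2}" "R' \<subseteq> {..<p} - {d w1, d w2}" by (auto simp: R_def R'_def)
  ultimately have cS: "card S = card S'" unfolding S_def S'_def using cR fin by (simp add: card_Diff_subset)
  obtain f g where f: "bij_betw f R R'" and g: "bij_betw g S S'"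
    using finite_same_card_bij[OF fin(1,2) cR] finite_same_card_bij[OF fin(3,4) cS] by blast
  define \<pi> where "\<pi> i = (if i \<in> R then f i else if i \<in> S then g i else if i = c u1 then d w1 else d w2)" for i
  have "bij_betw \<pi> R R'" using f by (rule bij_betw_cong[THEN iffD1, rotated]) (simp add: \<pi>_def)
  moreover have "bij_betw \<pi> S S'" using g by (rule bij_betw_cong[THEN iffD1, rotated]) (auto simp: \<pi>_def S_def)
  moreover have RS': "R' \<inter> S' = {}" by (auto simp: S'_def)
  ultimately have 1: "bij_betw \<pi> (R \<union> S) (R' \<union> S')" by (rule bij_betw_combine)
  have u1: "\<pi> (c u1) = d w1" and u2: "\<pi> (c u2) = d w2" using A.c12 by (auto simp: \<pi>_def R_def S_def)
  have 2: "bij_betw \<pi> {c u1, c u2} {d w1, d w2}"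
    using u1 u2 A.c12 B.c12 by (auto simp: bij_betw_def inj_on_def)
  have "(R' \<union> S') \<inter> {d w1, d w2} = {}" by (auto simp: R'_def S'_def)
  from bij_betw_combine[OF 1 2 this]
  have "bij_betw \<pi> ((R \<union> S) \<union> {c u1, c u2}) ((R' \<union> S') \<union> {d w1, d w2})" .
  moreover have "(R \<union> S) \<union> {c u1, c u2} = {..<p}" using A.special by (auto simp: R_def S_def)
  moreover have "(R' \<union> S') \<union> {d w1, d w2} = {..<p}" using B.special by (auto simp: R'_def S'_def)
  ultimately have bij: "bij_betw \<pi> {..<p} {..<p}" by simp
  have "card (B.P (\<pi> i)) = card (A.P i)" if i: "i < p" for i
  proof -
    consider "i = c u1" | "i = c u2" | "i \<in> R" | "i \<in> S" using i by (auto simp: S_def)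
    then show ?thesis
    proof cases
      case 1
      then show ?thesis using u1 sA(1) sB(1) by simp
    next
      case 2
      then show ?thesis using u2 sA(2) sB(2) by simp
    next
      case 3
      then have "\<pi> i \<in> R'" using \<open>bij_betw \<pi> R R'\<close> by (auto simp: bij_betw_def)
      then show ?thesis using 3 by (simp add: R_def R'_def)
    next
      case 4
      then have "\<pi> i \<in> S'" using \<open>bij_betw \<pi> S S'\<close> by (auto simp: bij_betw_def)
      then have "\<pi> i < p" "card (B.P (\<pi> i)) \<noteq> m + 1" by (auto simp: S'_def R'_def)
      moreover have "card (A.P i) \<noteq> m + 1" using 4 by (auto simp: S_def R_def)
      ultimately show ?thesis using sA(3)[OF i] sB(3)[of "\<pi> i"] by (auto simp: m_def)
    qed
  qed
  then show ?thesis using bij u1 u2 by blast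
qed

text \<open>Adjacency depends only on the colours and on being \<open>u0\<close>, \<open>u1\<close>
  or \<open>u2\<close>, so arbitrary bijections between matched classes that respect these vertices
  glue to an isomorphism.\<close>

lemma Y_col_iso_of_colour_bijection:
  assumes Y: "Y_structure p n c u0 u1 u2" and Y': "Y_structure p n d w0 w1 w2"
    and \<pi>: "bij_betw \<pi> {..<p} {..<p}" "\<pi> (c u1) = d w1" "\<pi> (c u2) = d w2"
    and sizes: "\<And>i. i < p \<Longrightarrow> card (part n d w0 (\<pi> i)) = card (part n c u0 i)"
  shows "graph_iso n (Y_col n c u0 u1 u2) (Y_col n d w0 w1 w2)"
proof -
  interpret A: Y_structure p n c u0 u1 u2 by (rule Y)
  interpret B: Y_structure p n d w0 w1 w2 by (rule Y')
  have \<pi>inj: "\<pi> i = \<pi> j \<longleftrightarrow> i = j" if "i < p" "j < p" for i j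
    using \<pi>(1) that by (auto simp: bij_betw_def inj_on_def)
  \<comment> \<open>The images of the special vertices are prescribed; without them matched classes
    still have equal size.\<close>
  have "card (A.P i - {u1, u2}) = card (B.P (\<pi> i) - {w1, w2})" if i: "i < p" for i
  proof -
    have uP: "u1 \<in> A.P i \<longleftrightarrow> i = c u1" "u2 \<in> A.P i \<longleftrightarrow> i = c u2"
      using A.u1n A.u2n A.u01 A.u02 by (auto simp: part_def)
    have wP: "w1 \<in> B.P (\<pi> i) \<longleftrightarrow> i = c u1" "w2 \<in> B.P (\<pi> i) \<longleftrightarrow> i = c u2"
      using B.u1n B.u2n B.u01 B.u02 \<pi>inj[OF i A.special(1)] \<pi>inj[OF i A.special(2)] \<pi>(2,3) by (auto simp: part_def)
    have "card (A.P i \<inter> {u1, u2}) = card (B.P (\<pi> i) \<inter> {w1, w2})"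
    proof -
      consider "i = c u1" | "i = c u2" | "i \<noteq> c u1" "i \<noteq> c u2" by blast
      then show ?thesis
      proof cases
        case 1
        then have "A.P i \<inter> {u1, u2} = {u1}" "B.P (\<pi> i) \<inter> {w1, w2} = {w1}" using uP wP A.c12 by auto
        then show ?thesis by simp
      next
        case 2
        then have "A.P i \<inter> {u1, u2} = {u2}" "B.P (\<pi> i) \<inter> {w1, w2} = {w2}" using uP wP A.c12 by auto
        then show ?thesis by simp
      next
        case 3
        then have "A.P i \<inter> {u1, u2} = {}" "B.P (\<pi> i) \<inter> {w1, w2} = {}" using uP wP by auto
        then show ?thesis by simp
      qed
    qed
    then show ?thesis using sizes[OF i] by (simp add: card_Diff_subset_Int)
  qed
  then have "\<forall>i. \<exists>h. i < p \<longrightarrow> bij_betw h (A.P i - {u1, u2}) (B.P (\<pi> i) - {w1, w2})"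
    using finite_same_card_bij by (metis finite_Diff finite_part)
  then obtain h where h: "\<And>i. i < p \<Longrightarrow> bij_betw (h i) (A.P i - {u1, u2}) (B.P (\<pi> i) - {w1, w2})"
    by metis
  define F where "F v = (if v = u0 then w0 else if v = u1 then w1 else if v = u2 then w2 else h (c v) v)" for v
  have Fr: "F v \<in> B.P (\<pi> (c v)) - {w1, w2}" if "v < n" "v \<notin> {u0, u1, u2}" for v
  proof -
    have "c v < p" using A.cp that by auto
    moreover have "v \<in> A.P (c v) - {u1, u2}" using that by (auto simp: part_def)
    ultimately have "h (c v) v \<in> B.P (\<pi> (c v)) - {w1, w2}" using h[of "c v"] by (auto simp: bij_betw_def)
    then show ?thesis using that by (simp add: F_def)
  qed
  have F012: "F u0 = w0" "F u1 = w1" "F u2 = w2" using A.u01 A.u02 A.u12 by (auto simp: F_def)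
  have Fn: "F v < n" if "v < n" for v
    using that Fr[of v] F012 B.u0n B.u1n B.u2n by (cases "v \<in> {u0, u1, u2}") (auto simp: part_def)
  have F0: "F v = w0 \<longleftrightarrow> v = u0" if "v < n" for v
    using that Fr[of v] F012 B.u01 B.u02 by (cases "v \<in> {u0, u1, u2}") (auto simp: part_def)
  have F1: "F v = w1 \<longleftrightarrow> v = u1" if "v < n" for v
    using that Fr[of v] F012 B.u01 B.u12 A.u01 A.u12 by (cases "v \<in> {u0, u1, u2}") (auto simp: part_def)
  have F2: "F v = w2 \<longleftrightarrow> v = u2" if "v < n" for v
    using that Fr[of v] F012 B.u02 B.u12 A.u02 A.u12 by (cases "v \<in> {u0, u1, u2}") (auto simp: part_def)
  have dF: "d (F v) = \<pi> (c v)" if "v < n" "v \<noteq> u0" for v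
    using that Fr[of v] F012 \<pi>(2,3) by (cases "v \<in> {u0, u1, u2}") (auto simp: part_def)
  have dd: "d (F u) = d (F v) \<longleftrightarrow> c u = c v" if "u < n" "u \<noteq> u0" "v < n" "v \<noteq> u0" for u v
    using that dF \<pi>inj A.cp by simp
  have inj: "inj_on F {..<n}"
  proof (rule inj_onI)
    fix u v assume uv: "u \<in> {..<n}" "v \<in> {..<n}" "F u = F v"
    show "u = v"
    proof (cases "u \<in> {u0, u1, u2} \<or> v \<in> {u0, u1, u2}")
      case True
      then show ?thesis using uv F0[of u] F0[of v] F1[of u] F1[of v] F2[of u] F2[of v] F012 by auto
    next
      case False
      then have c: "c u = c v" using dd[of u v] uv by auto
      have "c u < p" using A.cp uv False by auto
      then have "inj_on (h (c u)) (A.P (c u) - {u1, u2})" using h by (auto simp: bij_betw_def)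
      moreover have "u \<in> A.P (c u) - {u1, u2}" "v \<in> A.P (c u) - {u1, u2}" using uv False c by (auto simp: part_def)
      moreover have "h (c u) u = h (c u) v" using uv(3) False c by (simp add: F_def)
      ultimately show ?thesis by (metis inj_onD)
    qed
  qed
  have "F ` {..<n} \<subseteq> {..<n}" using Fn by auto
  then have bij: "bij_betw F {..<n} {..<n}" using inj by (simp add: bij_betw_def endo_inj_surj)
  have att: "attached d w1 w2 (F v) \<longleftrightarrow> attached c u1 u2 v" if "v < n" "v \<noteq> u0" for v
    using dd[OF that A.u1n] dd[OF that A.u2n] A.u01 A.u02 F012 F1[OF that(1)] F2[OF that(1)]
    unfolding attached_def by simp
  have "A.G u v \<longleftrightarrow> B.G (F u) (F v)" if uv: "u < n" "v < n" for u v
  proof -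
    consider "u = u0" "v = u0" | "u = u0" "v \<noteq> u0" | "u \<noteq> u0" "v = u0" | "u \<noteq> u0" "v \<noteq> u0" by blast
    then show ?thesis
    proof cases
      case 1
      then show ?thesis by (simp add: Y_col_def)
    next
      case 2
      then show ?thesis using uv Fn[OF uv(2)] F0[OF uv(2)] att[OF uv(2) 2(2)] A.u0n B.u0n F012(1)
        unfolding Y_col_def by auto
    next
      case 3
      then show ?thesis using uv Fn[OF uv(1)] F0[OF uv(1)] att[OF uv(1) 3(1)] A.u0n B.u0n F012(1)
        unfolding Y_col_def by auto
    next
      case 4
      have "A.G u v \<longleftrightarrow> c u \<noteq> c v \<and> \<not> (u = u1 \<and> v = u2) \<and> \<not> (u = u2 \<and> v = u1)"
        using uv 4 unfolding Y_col_def by auto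
      moreover have "F u \<noteq> w0" "F v \<noteq> w0" using F0 uv 4 by simp_all
      then have "B.G (F u) (F v) \<longleftrightarrow> d (F u) \<noteq> d (F v) \<and> \<not> (F u = w1 \<and> F v = w2) \<and> \<not> (F u = w2 \<and> F v = w1)"
        using Fn[OF uv(1)] Fn[OF uv(2)] unfolding Y_col_def by auto
      ultimately show ?thesis
        unfolding dd[OF uv(1) 4(1) uv(2) 4(2)] F1[OF uv(1)] F1[OF uv(2)] F2[OF uv(1)] F2[OF uv(2)] by simp
    qed
  qed
  then show ?thesis unfolding graph_iso_def using bij by (auto simp: atLeast0LessThan)
qed

text \<open>Exchanging \<open>u1\<close> and \<open>u2\<close> leaves the graph unchanged, so the
  smaller special class may be listed first in both structures.\<close>

lemma balanced_iso:
  assumes Y: "Y_structure p n c u0 u1 u2" and b: "balanced p n c u0 u1 u2"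
    and Y': "Y_structure p n d w0 w1 w2" and b': "balanced p n d w0 w1 w2"
  shows "graph_iso n (Y_col n c u0 u1 u2) (Y_col n d w0 w1 w2)"
proof -
  have ordered: "\<exists>v1 v2. Y_structure p n c u0 v1 v2 \<and> balanced p n c u0 v1 v2 \<and>
      card (part n c u0 (c v1)) \<le> card (part n c u0 (c v2)) \<and> Y_col n c u0 v1 v2 = Y_col n c u0 u1 u2"
    if "Y_structure p n c u0 u1 u2" "balanced p n c u0 u1 u2" for c u0 u1 u2
    using that Y_structure.swap Y_structure.Y_col_swap Y_structure.balanced_swap by (metis nat_le_linear)
  obtain v1 v2 where v: "Y_structure p n c u0 v1 v2" "balanced p n c u0 v1 v2"
      "card (part n c u0 (c v1)) \<le> card (part n c u0 (c v2))" "Y_col n c u0 v1 v2 = Y_col n c u0 u1 u2"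
    using ordered[OF Y b] by blast
  obtain x1 x2 where x: "Y_structure p n d w0 x1 x2" "balanced p n d w0 x1 x2"
      "card (part n d w0 (d x1)) \<le> card (part n d w0 (d x2))" "Y_col n d w0 x1 x2 = Y_col n d w0 w1 w2"
    using ordered[OF Y' b'] by blast
  obtain \<pi> where "bij_betw \<pi> {..<p} {..<p}" "\<pi> (c v1) = d x1" "\<pi> (c v2) = d x2"
    "\<forall>i<p. card (part n d w0 (\<pi> i)) = card (part n c u0 i)"
    using colour_bijection[OF v(1-3) x(1-3)] by blast
  then show ?thesis using Y_col_iso_of_colour_bijection[OF v(1) x(1), of \<pi>] v(4) x(4) by simp
qed

section \<open>Isomorphism invariance and colourings of maximal spectral radius\<close>

lemma graph_iso_eigenvalue:
  assumes iso: "graph_iso n E F" and E: "simple_graph n E" and F: "simple_graph n F"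
    and k: "eigenvalue (adj_mat n F) k"
  shows "eigenvalue (adj_mat n E) k"
proof -
  obtain f where f: "bij_betw f {..<n} {..<n}" "\<And>u v. u < n \<Longrightarrow> v < n \<Longrightarrow> E u v \<longleftrightarrow> F (f u) (f v)"
    using iso by (auto simp: graph_iso_def atLeast0LessThan)
  obtain g where g: "\<exists>i<n. g i \<noteq> 0" "\<And>i. i < n \<Longrightarrow> nsum n F g i = k * g i"
    using k unfolding eigenvalue_adj_mat[OF F] by blast
  have fn: "f i < n" if "i < n" for i using f(1) that by (auto simp: bij_betw_def)
  have "nsum n E (\<lambda>i. g (f i)) i = k * g (f i)" if i: "i < n" for i
  proof -
    have "nsum n E (\<lambda>i. g (f i)) i = (\<Sum>j<n. of_bool (F (f i) (f j)) * g (f j))"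
      unfolding nsum_def using f(2) i by (intro sum.cong) auto
    also have "\<dots> = nsum n F g (f i)"
      unfolding nsum_def by (rule sum.reindex_bij_betw[OF f(1)])
    finally show ?thesis using g(2)[OF fn[OF i]] by simp
  qed
  moreover have "\<exists>i<n. g (f i) \<noteq> 0"
  proof -
    obtain j where "j < n" "g j \<noteq> 0" using g(1) by blast
    moreover have "j \<in> f ` {..<n}" using f(1) \<open>j < n\<close> by (simp add: bij_betw_def)
    then obtain i where "i < n" "f i = j" by auto
    ultimately show ?thesis by blast
  qed
  ultimately show ?thesis unfolding eigenvalue_adj_mat[OF E] by (intro exI[of _ "\<lambda>i. g (f i)"]) blast
qed

lemma graph_iso_sym:
  assumes "graph_iso n E F"
  shows "graph_iso n F E"
proof -
  obtain f where f: "bij_betw f {0..<n} {0..<n}" "\<And>u v. u < n \<Longrightarrow> v < n \<Longrightarrow> E u v \<longleftrightarrow> F (f u) (f v)"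
    using assms by (auto simp: graph_iso_def)
  define g where "g = inv_into {0..<n} f"
  have g: "bij_betw g {0..<n} {0..<n}" unfolding g_def using f(1) by (rule bij_betw_inv_into)
  have fg: "f (g i) = i" "g i < n" if "i < n" for i
  proof -
    show "f (g i) = i" unfolding g_def using bij_betw_inv_into_right[OF f(1), of i] that by simp
    show "g i < n" using g that by (auto simp: bij_betw_def)
  qed
  then have "\<forall>u<n. \<forall>v<n. F u v \<longleftrightarrow> E (g u) (g v)" using f(2) by simp
  then show ?thesis using g unfolding graph_iso_def by blast
qed

lemma graph_iso_spec_rad:
  assumes "graph_iso n E F" "simple_graph n E" "simple_graph n F"
  shows "spec_rad n E = spec_rad n F"
proof -
  have "{k. eigenvalue (adj_mat n E) k} = {k. eigenvalue (adj_mat n F) k}"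
    using graph_iso_eigenvalue[OF assms] graph_iso_eigenvalue[OF graph_iso_sym[OF assms(1)] assms(3,2)] by blast
  then show ?thesis by (simp add: spec_rad_def)
qed

text \<open>Only finitely many graphs \<open>Y_col n c u0 u1 u2\<close> arise, so one of maximal spectral radius exists, and it is balanced.\<close>

lemma spec_rad_Y_le:
  fixes p :: nat and C0 :: real
  assumes p: "p \<ge> 3"
  shows "\<forall>\<^sub>F n in sequentially. \<forall>c u0 u1 u2. Y_structure p n c u0 u1 u2 \<longrightarrow>
    (1 - 1 / p) * n - C0 \<le> spec_rad n (Y_col n c u0 u1 u2) \<longrightarrow>
    spec_rad n (Y_col n c u0 u1 u2) < spec_rad n (Y_graph p n) \<or> graph_iso n (Y_col n c u0 u1 u2) (Y_graph p n)"
  using unbalanced_improvable[OF p, of C0] eventually_gt_at_top[of p]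
proof (eventually_elim, intro allI impI)
  fix n c u0 u1 u2
  assume imp: "\<forall>c u0 u1 u2. Y_structure p n c u0 u1 u2 \<longrightarrow>
    (1 - 1 / p) * n - C0 \<le> spec_rad n (Y_col n c u0 u1 u2) \<longrightarrow> \<not> balanced p n c u0 u1 u2 \<longrightarrow>
    (\<exists>c'. Y_structure p n c' u0 u1 u2 \<and> spec_rad n (Y_col n c u0 u1 u2) < spec_rad n (Y_col n c' u0 u1 u2))"
    and pn: "p < n" and Y: "Y_structure p n c u0 u1 u2"
    and \<rho>: "(1 - 1 / p) * n - C0 \<le> spec_rad n (Y_col n c u0 u1 u2)"
  define f where "f c' = spec_rad n (Y_col n c' u0 u1 u2)" for c'
  have iso: "graph_iso n (Y_col n c' u0 u1 u2) (Y_graph p n)"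
    if "Y_structure p n c' u0 u1 u2" "balanced p n c' u0 u1 u2" for c'
    unfolding Y_graph_eq[OF p]
    using that Y_graph_structure[OF p pn] Y_graph_balanced[OF p] by (rule balanced_iso)
  define M where "M = f ` {c'. Y_structure p n c' u0 u1 u2}"
  \<comment> \<open>Infinitely many functions give the same graph; restricting them to
    \<open>{..<n}\<close> and setting the meaningless colour of \<open>u0\<close> to 0 leaves
    finitely many.\<close>
  have "M \<subseteq> f ` ({..<n} \<rightarrow>\<^sub>E {..<p})"
  proof
    fix t assume "t \<in> M"
    then obtain c' where c': "Y_structure p n c' u0 u1 u2" "t = f c'" by (auto simp: M_def)
    interpret Y': Y_structure p n c' u0 u1 u2 by (rule c'(1))
    define c'' where "c'' = restrict (\<lambda>v. if v = u0 then 0 else c' v) {..<n}"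
    have "c'' \<in> {..<n} \<rightarrow>\<^sub>E {..<p}" using Y'.cp Y'.p2 by (auto simp: c''_def)
    moreover have "Y_col n c'' u0 u1 u2 = Y_col n c' u0 u1 u2"
      by (rule Y'.Y_col_cong) (simp add: c''_def)
    then have "t = f c''" using c'(2) by (simp add: f_def)
    ultimately show "t \<in> f ` ({..<n} \<rightarrow>\<^sub>E {..<p})" by blast
  qed
  then have finM: "finite M" by (rule finite_subset) (intro finite_imageI finite_PiE; simp)
  have "f c \<in> M" using Y by (auto simp: M_def)
  then have "Max M \<in> M" "f c \<le> Max M" using finM by (auto intro: Max_in)
  then obtain b where b: "Y_structure p n b u0 u1 u2" "f b = Max M" "f c \<le> f b" by (auto simp: M_def)
  have max: "f c' \<le> f b" if "Y_structure p n c' u0 u1 u2" for c'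
    using that finM b(2) by (auto simp: M_def)
  \<comment> \<open>The maximiser inherits the lower bound on the spectral radius, so an unbalanced
    one could still be improved.\<close>
  have bal: "balanced p n b u0 u1 u2"
  proof (rule ccontr)
    assume "\<not> ?thesis"
    moreover have "(1 - 1 / p) * n - C0 \<le> spec_rad n (Y_col n b u0 u1 u2)" using \<rho> b(3) by (simp add: f_def)
    ultimately obtain c' where "Y_structure p n c' u0 u1 u2" "f b < f c'" using imp b(1) unfolding f_def by blast
    then show False using max[of c'] by simp
  qed
  have "simple_graph n (Y_graph p n)"
    unfolding Y_graph_eq[OF p] by (rule Y_structure.simple_G[OF Y_graph_structure[OF p pn]])
  then have fb: "f b = spec_rad n (Y_graph p n)"
    unfolding f_def by (intro graph_iso_spec_rad iso b(1) bal Y_structure.simple_G[OF b(1)])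
  show "spec_rad n (Y_col n c u0 u1 u2) < spec_rad n (Y_graph p n) \<or> graph_iso n (Y_col n c u0 u1 u2) (Y_graph p n)"
  proof (cases "balanced p n c u0 u1 u2")
    case True
    then show ?thesis using iso Y by blast
  next
    case False
    then obtain c' where "Y_structure p n c' u0 u1 u2" "f c < f c'" using imp Y \<rho> unfolding f_def by blast
    then show ?thesis using max[of c'] fb by (simp add: f_def)
  qed
qed

section \<open>A single vertex of low degree\<close>

text \<open>Each low-degree vertex adds at least \<open>\<epsilon>\<^sup>2 / 4\<close> to a bounded
  sum of squares, so their number \<open>l\<close> is bounded. On the rest \<open>H\<close> the
  Turan inequality holds without error term, and Cauchy-Schwarz bounds the squared sum of entries by
  \<open>(n - l) * (n - S)\<close>, where \<open>S\<close> is the sum of the squared entries on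
  \<open>L\<close>. The edges at \<open>L\<close> contribute at most \<open>2 * \<rho> * S\<close>.
  Altogether \<rho> is at most \<open>a * (n - (l - S))\<close> up to O(1/n).\<close>

lemma low_degree_cost:
  fixes p q :: nat and \<epsilon> \<eta> :: real
  assumes p: "p \<ge> 2" and q: "q \<ge> 1" and \<epsilon>: "\<epsilon> > 0" "\<epsilon> \<le> 1 / (4 * p^2)" and \<eta>: "\<eta> > 0" "\<eta> \<le> 1"
  defines "\<theta> \<equiv> (real p - 2) / (real p - 1)"
  shows "\<forall>\<^sub>F n in sequentially. \<forall>E x. simple_graph n E \<longrightarrow> \<not> contains_book n E p q \<longrightarrow> perron n E x \<longrightarrow>
    (1 - 1 / p) * (real n - (1 - \<theta>\<^sup>2) - \<eta>) \<le> spec_rad n E \<longrightarrow>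
    card {v. v < n \<and> deg n E v < (1 - 1 / p - \<epsilon>) * n} \<le> \<epsilon> * n \<and>
    (\<Sum>v | v < n \<and> deg n E v < (1 - 1 / p - \<epsilon>) * n. 1 - (x v)\<^sup>2) \<le> 1 - \<theta>\<^sup>2 + 2 * \<eta> \<and>
    (\<forall>v<n. \<bar>x v - deg n E v / ((1 - 1 / p) * n)\<bar> \<le> \<epsilon> / 2)"
proof -
  define a where "a = 1 - 1 / real p"
  have a: "a \<ge> 1/2" "a \<le> 1" using p by (auto simp: a_def field_simps)
  have \<theta>: "0 \<le> \<theta>" "\<theta> \<le> 1" using p by (auto simp: \<theta>_def)
  have \<epsilon>2: "\<epsilon> / 2 > 0" using \<epsilon> by simp
  obtain C where C: "\<forall>\<^sub>F n in sequentially. \<forall>E x. simple_graph n E \<longrightarrow> \<not> contains_book n E p q \<longrightarrow> perron n E x \<longrightarrow>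
    (1 - 1 / p) * n - 2 \<le> spec_rad n E \<longrightarrow>
    (\<Sum>i<n. (x i - 1)\<^sup>2) \<le> C \<and> spec_rad n E \<le> (1 - 1 / p) * n + C \<and> (\<forall>i<n. x i \<le> 3)"
    using perron_near_uniform[OF p q] by blast
  define l0 where "l0 = 4 * \<bar>C\<bar> / \<epsilon>\<^sup>2"
  define M where "M = l0 * (9 * l0) + 2 * \<bar>C\<bar> * (9 * l0)"
  have l0: "l0 \<ge> 0" by (simp add: l0_def)
  have "\<forall>\<^sub>F n in sequentially. 1 + 2 * real (p + 1) * q + l0 \<le> \<epsilon> * real n" using \<epsilon>(1) by real_asymp
  moreover have "\<forall>\<^sub>F n in sequentially. 2 * M \<le> \<eta> * real n" using \<eta>(1) by real_asymp
  ultimately show ?thesis using C perron_entry_degree[OF p q \<epsilon>2, of 2]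
  proof (eventually_elim, intro allI impI)
    fix n E x
    assume n1: "1 + 2 * real (p + 1) * q + l0 \<le> \<epsilon> * real n" and n2: "2 * M \<le> \<eta> * real n"
      and C: "\<forall>E x. simple_graph n E \<longrightarrow> \<not> contains_book n E p q \<longrightarrow> perron n E x \<longrightarrow>
        (1 - 1 / p) * n - 2 \<le> spec_rad n E \<longrightarrow>
        (\<Sum>i<n. (x i - 1)\<^sup>2) \<le> C \<and> spec_rad n E \<le> (1 - 1 / p) * n + C \<and> (\<forall>i<n. x i \<le> 3)"
      and D: "\<forall>E x. simple_graph n E \<longrightarrow> \<not> contains_book n E p q \<longrightarrow> perron n E x \<longrightarrow>
        (1 - 1 / p) * n - 2 \<le> spec_rad n E \<longrightarrow> (\<forall>i<n. \<bar>x i - deg n E i / ((1 - 1 / p) * n)\<bar> \<le> \<epsilon> / 2)"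
      and E: "simple_graph n E" and nb: "\<not> contains_book n E p q" and x: "perron n E x"
      and \<rho>': "(1 - 1 / p) * (real n - (1 - \<theta>\<^sup>2) - \<eta>) \<le> spec_rad n E"
    define \<rho> where "\<rho> = spec_rad n E"
    have "0 \<le> 1 - \<theta>\<^sup>2" "1 - \<theta>\<^sup>2 \<le> 1" using \<theta> by (auto simp: power_le_one)
    then have "a * ((1 - \<theta>\<^sup>2) + \<eta>) \<le> 1 * 2"
      using a \<eta> by (intro mult_mono) linarith+
    then have \<rho>2: "(1 - 1 / p) * n - 2 \<le> spec_rad n E" using \<rho>' by (simp add: a_def algebra_simps)
    note C' = C[rule_format, OF E nb x \<rho>2] and D' = D[rule_format, OF E nb x \<rho>2]
    have n0: "n > 0"
    proof (rule gr0I)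
      assume "n = 0"
      then have "1 + 2 * real (p + 1) * q + l0 \<le> 0" using n1 by simp
      moreover have "0 \<le> 2 * real (p + 1) * q" by simp
      ultimately show False using l0 by linarith
    qed
    have an: "a * n > 0" using a n0 by simp
    have x0: "0 \<le> x v" if "v < n" for v using x that by (simp add: perron_def)
    have x3: "x v \<le> 3" if "v < n" for v using C' that by blast
    have C0: "0 \<le> C" using C' sum_nonneg[of "{..<n}" "\<lambda>i. (x i - 1)\<^sup>2"] by auto
    define L where "L = {v. v < n \<and> deg n E v < (a - \<epsilon>) * n}"
    have L: "L \<subseteq> {..<n}" "finite L" by (auto simp: L_def)
    define H where "H = {..<n} - L"
    define S where "S = (\<Sum>v\<in>L. (x v)\<^sup>2)"
    define l where "l = real (card L)"
    have "\<epsilon>\<^sup>2 / 4 \<le> (x v - 1)\<^sup>2" if v: "v \<in> L" for v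
    proof -
      have vn: "v < n" using v by (auto simp: L_def)
      have "real (deg n E v) \<le> (a - \<epsilon>) * n" using v by (auto simp: L_def)
      also have "(a - \<epsilon>) * n \<le> (1 - \<epsilon>) * (a * n)"
        using a n0 \<epsilon>(1) mult_right_mono[of a 1 "\<epsilon> * n"] by (simp add: algebra_simps)
      finally have "deg n E v / (a * n) \<le> 1 - \<epsilon>" using an by (simp add: pos_divide_le_eq)
      then have "\<epsilon> / 2 \<le> 1 - x v" using D'[OF vn] unfolding a_def[symmetric] by linarith
      then have "(\<epsilon> / 2)\<^sup>2 \<le> (1 - x v)\<^sup>2" using \<epsilon> by (intro power_mono) auto
      then show ?thesis by (simp add: power_divide power2_commute)
    qed
    then have "(\<Sum>v\<in>L. \<epsilon>\<^sup>2 / 4) \<le> (\<Sum>v\<in>L. (x v - 1)\<^sup>2)" by (rule sum_mono)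
    also have "\<dots> \<le> (\<Sum>v<n. (x v - 1)\<^sup>2)" using L by (intro sum_mono2) auto
    also have "\<dots> \<le> \<bar>C\<bar>" using C' by auto
    finally have "l * (\<epsilon>\<^sup>2 / 4) \<le> \<bar>C\<bar>" by (simp add: l_def)
    then have ll0: "l \<le> l0" using \<epsilon> by (simp add: l0_def field_simps)
    have l: "0 \<le> l" by (simp add: l_def)
    have S9: "S \<le> 9 * l" "0 \<le> S"
    proof -
      have "(x v)\<^sup>2 \<le> 9" if "v \<in> L" for v
        using power_mono[of "x v" 3 2] x3 x0 that L by auto
      then have "S \<le> (\<Sum>v\<in>L. 9)" unfolding S_def by (intro sum_mono) auto
      then show "S \<le> 9 * l" by (simp add: l_def)
    qed (simp add: S_def sum_nonneg)
    have free: "\<not> book_on H E p 1"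
    proof
      assume "book_on H E p 1"
      then obtain K Q where KQ: "K \<subseteq> H" "Q \<subseteq> H" "K \<inter> Q = {}" "card K = p" "card Q = 1"
        "\<forall>u\<in>K. \<forall>v\<in>K. u \<noteq> v \<longrightarrow> E u v" "\<forall>u\<in>K. \<forall>v\<in>Q. E u v" unfolding book_on_def by blast
      obtain w where w: "Q = {w}" using KQ(5) card_1_singletonE by blast
      have finK: "finite K" using KQ(1) finite_subset[of K H] by (simp add: H_def)
      have "clique E (insert w K)" using KQ(6,7) w simple_graphD(1)[OF E] unfolding clique_def by blast
      moreover have "card (insert w K) = Suc p" using KQ(3,4) w finK by simp
      moreover have sub: "insert w K \<subseteq> H" using KQ(1,2) w by simp
      then have "insert w K \<subseteq> {..<n}" by (auto simp: H_def)
      moreover have "(1 - 1 / p - \<epsilon>) * n \<le> deg n E v" if "v \<in> insert w K" for v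
        using that sub by (auto simp: H_def L_def a_def not_less)
      moreover have "2 * real (p + 1) * q \<le> \<epsilon> * n" using n1 l0 by linarith
      ultimately show False using no_high_degree_clique[OF E nb p n0 \<epsilon>] by blast
    qed
    \<comment> \<open>Applied with \<open>q = 1\<close>, where the error term vanishes: high degrees
      exclude the bare clique on \<open>p + 1\<close> vertices, not just a book.\<close>
    have "(\<Sum>u\<in>H. x u * (\<Sum>v\<in>H. of_bool (E u v) * x v)) \<le> (1 - 1 / p) * (\<Sum>u\<in>H. x u)\<^sup>2 + real (1 - 1) * 3 * (\<Sum>u\<in>H. x u)"
      using simple_graphD(1,2)[OF E] free x0 x3 p by (intro weighted_turan) (auto simp: H_def)
    then have T: "(\<Sum>u\<in>H. x u * (\<Sum>v\<in>H. of_bool (E u v) * x v)) \<le> a * (\<Sum>u\<in>H. x u)\<^sup>2" by (simp add: a_def)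
    have "(\<Sum>u\<in>H. x u)\<^sup>2 \<le> (\<Sum>u\<in>H. 1\<^sup>2) * (\<Sum>u\<in>H. (x u)\<^sup>2)"
      using Cauchy_Schwarz_ineq_sum[of "\<lambda>_. 1" x H] by simp
    moreover have "(\<Sum>u\<in>H. (x u)\<^sup>2) = n - S"
    proof -
      have "(\<Sum>u<n. (x u)\<^sup>2) = (\<Sum>u\<in>H. (x u)\<^sup>2) + S" unfolding H_def S_def using L by (intro sum.subset_diff) auto
      then show ?thesis using x by (simp add: perron_def)
    qed
    moreover have "real (card H) = n - l"
    proof -
      have "card L \<le> n" using card_mono[OF _ L(1)] by simp
      then show ?thesis using L by (simp add: H_def l_def card_Diff_subset of_nat_diff)
    qed
    ultimately have XH: "(\<Sum>u\<in>H. x u)\<^sup>2 \<le> (n - l) * (n - S)" by simp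
    have ns: "nsum n E x u = \<rho> * x u" if "u < n" for u using x that by (simp add: perron_def \<rho>_def)
    have split: "nsum n E x u = (\<Sum>v\<in>H. of_bool (E u v) * x v) + (\<Sum>v\<in>L. of_bool (E u v) * x v)" for u
      unfolding nsum_def H_def using L by (intro sum.subset_diff) auto
    have "\<rho> * n = (\<Sum>u<n. x u * nsum n E x u)" using quad_perron[OF x] by (simp add: \<rho>_def quad_def)
    also have "\<dots> = (\<Sum>u\<in>H. x u * nsum n E x u) + (\<Sum>u\<in>L. x u * nsum n E x u)"
      unfolding H_def using L by (intro sum.subset_diff) auto
    also have "(\<Sum>u\<in>L. x u * nsum n E x u) = \<rho> * S"
      unfolding S_def sum_distrib_left using L ns by (intro sum.cong) (auto simp: power2_eq_square)
    also have "(\<Sum>u\<in>H. x u * nsum n E x u) = (\<Sum>u\<in>H. x u * (\<Sum>v\<in>H. of_bool (E u v) * x v)) + (\<Sum>u\<in>H. x u * (\<Sum>v\<in>L. of_bool (E u v) * x v))"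
      unfolding split by (simp add: distrib_left sum.distrib)
    also have "(\<Sum>u\<in>H. x u * (\<Sum>v\<in>L. of_bool (E u v) * x v)) = (\<Sum>v\<in>L. x v * (\<Sum>u\<in>H. of_bool (E v u) * x u))"
    proof -
      have "(\<Sum>u\<in>H. x u * (\<Sum>v\<in>L. of_bool (E u v) * x v)) = (\<Sum>v\<in>L. \<Sum>u\<in>H. x u * (of_bool (E u v) * x v))"
        unfolding sum_distrib_left by (rule sum.swap)
      also have "\<dots> = (\<Sum>v\<in>L. \<Sum>u\<in>H. x v * (of_bool (E v u) * x u))"
        using simple_graphD(1)[OF E] by (intro sum.cong refl) (auto simp: of_bool_def)
      finally show ?thesis by (simp add: sum_distrib_left)
    qed
    \<comment> \<open>Edges inside \<open>L\<close> are counted once more here; the excess is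
      nonnegative and the bound closes up as \<open>\<rho> * S\<close>.\<close>
    also have "\<dots> \<le> (\<Sum>v\<in>L. x v * nsum n E x v)"
    proof (intro sum_mono mult_left_mono)
      fix v assume "v \<in> L"
      show "(\<Sum>u\<in>H. of_bool (E v u) * x u) \<le> nsum n E x v"
        unfolding split using x0 L by (simp add: sum_nonneg subset_iff)
    qed (use L x0 in auto)
    also have "\<dots> = \<rho> * S"
      unfolding S_def sum_distrib_left using L ns by (intro sum.cong) (auto simp: power2_eq_square)
    finally have "\<rho> * n \<le> a * (\<Sum>u\<in>H. x u)\<^sup>2 + \<rho> * S + \<rho> * S" using T by linarith
    also have "\<rho> * S \<le> (a * n + \<bar>C\<bar>) * S" using C' S9 by (intro mult_right_mono) (auto simp: a_def \<rho>_def)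
    also have "a * (\<Sum>u\<in>H. x u)\<^sup>2 \<le> a * ((n - l) * (n - S))" using XH a by (intro mult_left_mono) auto
    finally have "\<rho> * n \<le> a * ((n - l) * (n - S)) + (a * n + \<bar>C\<bar>) * S + (a * n + \<bar>C\<bar>) * S" by simp
    also have "\<dots> = a * n * (n - (l - S)) + (a * (l * S) + 2 * \<bar>C\<bar> * S)" by (simp add: algebra_simps)
    also have "a * (l * S) + 2 * \<bar>C\<bar> * S \<le> M"
    proof -
      have "a * (l * S) \<le> 1 * (l0 * (9 * l0))" using a l ll0 S9 by (intro mult_mono) auto
      moreover have "2 * \<bar>C\<bar> * S \<le> 2 * \<bar>C\<bar> * (9 * l0)" using S9 ll0 by (intro mult_left_mono) auto
      ultimately show ?thesis unfolding M_def by linarith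
    qed
    finally have "\<rho> * n \<le> a * n * (n - (l - S)) + M" by simp
    moreover have "a * (real n - (1 - \<theta>\<^sup>2) - \<eta>) * n \<le> \<rho> * n"
      using mult_right_mono[OF \<rho>', of "real n"] by (simp add: \<rho>_def a_def)
    ultimately have "a * n * (l - S) \<le> a * n * (1 - \<theta>\<^sup>2 + \<eta>) + M" by (simp add: algebra_simps)
    also have "M \<le> a * n * \<eta>"
    proof -
      have "M \<le> 1/2 * (n * \<eta>)" using n2 by (simp add: mult.commute)
      also have "\<dots> \<le> a * (n * \<eta>)" using a \<eta> by (intro mult_right_mono) auto
      finally show ?thesis by simp
    qed
    finally have "a * n * (l - S) \<le> a * n * (1 - \<theta>\<^sup>2 + 2 * \<eta>)" by (simp add: algebra_simps)
    then have "l - S \<le> 1 - \<theta>\<^sup>2 + 2 * \<eta>" using an mult_le_cancel_left_pos by blast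
    moreover have "l - S = (\<Sum>v\<in>L. 1 - (x v)\<^sup>2)" by (simp add: l_def S_def sum_subtractf)
    moreover have "l \<le> \<epsilon> * n" using ll0 n1 by (smt (verit) mult_nonneg_nonneg of_nat_0_le_iff)
    ultimately show "card {v. v < n \<and> deg n E v < (1 - 1 / p - \<epsilon>) * n} \<le> \<epsilon> * n \<and>
      (\<Sum>v | v < n \<and> deg n E v < (1 - 1 / p - \<epsilon>) * n. 1 - (x v)\<^sup>2) \<le> 1 - \<theta>\<^sup>2 + 2 * \<eta> \<and>
      (\<forall>v<n. \<bar>x v - deg n E v / ((1 - 1 / p) * n)\<bar> \<le> \<epsilon> / 2)"
      using D' by (simp add: L_def a_def l_def)
  qed
qed

text \<open>Since \<open>t \<mapsto> 2 t - t\<^sup>2\<close> is concave, splitting a deficit \<open>s\<close> between two vertices costs more than concentrating it in one.\<close>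

lemma two_deficits:
  fixes A B s h :: real
  assumes "B \<le> A" "0 \<le> B" "A \<le> 1" "0 < s" "s \<le> 1/2" "0 \<le> h" "8 * h \<le> s"
    and AB: "s - 4 * h \<le> A + B" and cost: "(2 * A - A\<^sup>2) + (2 * B - B\<^sup>2) \<le> 2 * s - s\<^sup>2 + 2 * h"
  shows "s * B \<le> 20 * h"
proof (cases "A + B \<le> 1")
  \<comment> \<open>\<open>2 * t - t\<^sup>2\<close> increases only up to 1, so a larger sum is
    treated apart: there the cost exceeds 1, beyond the budget of at most
    \<open>3/4 + 2 * h\<close>.\<close>
  case False
  have "A\<^sup>2 \<le> A" "B\<^sup>2 \<le> B" using assms(1-3) by (auto simp: power2_eq_square mult_left_le)
  then have "1 < 2 * s - s\<^sup>2 + 2 * h" using cost False by linarith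
  moreover have "2 * s - s\<^sup>2 \<le> 3/4"
  proof -
    have "0 \<le> (1/2 - s) * (3/2 - s)" using assms by (intro mult_nonneg_nonneg) auto
    moreover have "(1/2 - s) * (3/2 - s) = 3/4 - 2 * s + s\<^sup>2" by (simp add: field_simps power2_eq_square)
    ultimately show ?thesis by linarith
  qed
  ultimately show ?thesis using assms by linarith
next
  \<comment> \<open>The term \<open>2 * (A * B)\<close> is exactly the extra cost of splitting. It
    is at most \<open>10 * h\<close>, while the larger deficit \<open>A\<close> is at least
    \<open>s / 4\<close>.\<close>
  case True
  define t where "t = A + B"
  have "0 \<le> (t - (s - 4 * h)) * (2 - t - (s - 4 * h))"
    using AB True assms by (intro mult_nonneg_nonneg) (auto simp: t_def)
  then have "2 * (s - 4 * h) - (s - 4 * h)\<^sup>2 \<le> 2 * t - t\<^sup>2" by (simp add: algebra_simps power2_eq_square)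
  moreover have "(s - 4 * h)\<^sup>2 \<le> s\<^sup>2" using assms by (intro power_mono) auto
  moreover have "2 * t - t\<^sup>2 + 2 * (A * B) = (2 * A - A\<^sup>2) + (2 * B - B\<^sup>2)"
    by (simp add: t_def algebra_simps power2_eq_square)
  moreover have "X - Y \<le> Z \<Longrightarrow> Y \<le> S \<Longrightarrow> Z + 2 * P = Q \<Longrightarrow> Q \<le> 2 * s - S + 2 * h \<Longrightarrow> X = 2 * (s - 4 * h) \<Longrightarrow> P \<le> 5 * h"
    for X Y Z S P Q by simp
  ultimately have "A * B \<le> 5 * h" using cost by blast
  moreover have "s / 4 * B \<le> A * B" using AB assms by (intro mult_right_mono) auto
  ultimately show ?thesis by simp
qed

text \<open>Without a \<open>p\<close>-colouring, a degree hypothesis of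
  \<open>partial_colouring\<close> fails for the whole vertex set. A single bad vertex has entry at
  most about \<theta>; a bad pair has entry sum at most about \<open>1 + \<theta>\<close>, and
  \<open>two_deficits\<close> concentrates the loss. Then \<open>u0\<close> exhausts the budget
  \<open>1 - \<theta>\<^sup>2\<close>, which leaves every other entry at least nearly 1.\<close>

lemma one_bad_vertex:
  fixes p q :: nat and \<eta> :: real
  assumes p: "p \<ge> 3" and q: "q \<ge> 1" and \<eta>: "\<eta> > 0" "\<eta> \<le> 1"
  defines "\<theta> \<equiv> (real p - 2) / (real p - 1)"
  shows "\<exists>h>0. \<forall>\<^sub>F n in sequentially. \<forall>E x. simple_graph n E \<longrightarrow> \<not> contains_book n E p q \<longrightarrow> \<not> colorable n E p \<longrightarrow>
    perron n E x \<longrightarrow> (1 - 1 / p) * (real n - (1 - \<theta>\<^sup>2) - h) \<le> spec_rad n E \<longrightarrow>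
    (\<exists>u0<n. \<bar>x u0 - \<theta>\<bar> \<le> \<eta> \<and> (\<forall>v<n. v \<noteq> u0 \<longrightarrow> 1 - \<eta> \<le> x v) \<and>
      (\<forall>v<n. \<bar>x v - deg n E v / ((1 - 1 / p) * n)\<bar> \<le> \<eta>))"
proof -
  have p2: "p \<ge> 2" using p by simp
  define a where "a = 1 - 1 / real p"
  have a: "a \<ge> 1/2" "a \<le> 1" using p by (auto simp: a_def field_simps)
  have th1: "(1 - 2 / p) / a = \<theta>" and th2: "(2 - 3 / p) / a = 1 + \<theta>"
    using p by (simp_all add: a_def \<theta>_def field_simps)
  define s where "s = 1 - \<theta>"
  have sp: "s * (real p - 1) = 1" using p by (simp add: s_def \<theta>_def field_simps)
  have s: "0 < s" "s \<le> 1/2" "1 \<le> s * p"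
  proof -
    show "0 < s" "s \<le> 1/2" using p by (auto simp: s_def \<theta>_def field_simps)
    then show "1 \<le> s * p" using sp by (simp add: algebra_simps)
  qed
  \<comment> \<open>\<open>two_deficits\<close> is divided by \<open>s\<close>, and
    \<open>1 / s \<le> p\<close>; with this \<open>h\<close>, \<open>300 * (p * h)\<close> is at
    most \<eta> and \<open>100 * (p * h)\<close> at most \<open>s\<close>.\<close>
  define h where "h = \<eta> / (100 * real p ^ 2)"
  \<comment> \<open>\<open>20 * (p * h)\<close> comes from \<open>two_deficits\<close>, and the
    slack \<open>4 * h\<close> of the entry sum is absorbed in the rest.\<close>
  define g where "g = 24 * p * h"
  define \<epsilon> where "\<epsilon> = h / (8 * (real p + 1)^2)"
  have h: "h > 0" using \<eta> p by (simp add: h_def)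
  have php: "100 * (p * (p * h)) = \<eta>" using p by (simp add: h_def power2_eq_square)
  have ph: "100 * (p * h) \<le> s" "300 * (p * h) \<le> \<eta>" "3 * h \<le> p * h"
  proof -
    have ph0: "0 \<le> p * h" using h by simp
    have "100 * (p * h) \<le> 100 * (p * h) * (s * p)" using mult_left_mono[OF s(3), of "100 * (p * h)"] ph0 by simp
    also have "\<dots> = \<eta> * s" using php by (simp add: mult_ac)
    also have "\<dots> \<le> 1 * s" using \<eta> s by (intro mult_right_mono) auto
    finally show "100 * (p * h) \<le> s" by simp
    have "3 * (p * h) \<le> p * (p * h)" using p ph0 by (intro mult_right_mono) auto
    then show "300 * (p * h) \<le> \<eta>" using php by linarith
    show "3 * h \<le> p * h" using p h by (intro mult_right_mono) auto
  qed
  have h1': "h \<le> 1" using ph \<eta> h by linarith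
  have gph: "g = 24 * (p * h)" by (simp add: g_def)
  have h1: "h \<le> 1/300" using ph \<eta> h by linarith
  have \<epsilon>: "\<epsilon> > 0" "\<epsilon> \<le> h / 8" "8 * (real p + 1)^2 * \<epsilon> \<le> h" "\<epsilon> \<le> 1 / (4 * p^2)"
  proof -
    show "\<epsilon> > 0" using h by (simp add: \<epsilon>_def)
    show "8 * (real p + 1)^2 * \<epsilon> \<le> h" using p by (simp add: \<epsilon>_def)
    have "1 \<le> (real p + 1)^2" by simp
    then have "h / (8 * (real p + 1)^2) \<le> h / (8 * 1)" using h by (intro divide_left_mono) auto
    then show "\<epsilon> \<le> h / 8" by (simp add: \<epsilon>_def)
    have "h / (8 * (real p + 1)^2) \<le> 1 / (4 * real p ^ 2)"
    proof (rule frac_le)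
      show "4 * real p ^ 2 \<le> 8 * (real p + 1)^2" by (simp add: power2_eq_square algebra_simps)
    qed (use h1 p in auto)
    then show "\<epsilon> \<le> 1 / (4 * p^2)" by (simp add: \<epsilon>_def)
  qed
  have "\<forall>\<^sub>F n in sequentially. 2 * real (p + 1) * q \<le> \<epsilon> * real n" using \<epsilon>(1) by real_asymp
  then have "\<forall>\<^sub>F n in sequentially. \<forall>E x. simple_graph n E \<longrightarrow> \<not> contains_book n E p q \<longrightarrow> \<not> colorable n E p \<longrightarrow>
    perron n E x \<longrightarrow> (1 - 1 / p) * (real n - (1 - \<theta>\<^sup>2) - h) \<le> spec_rad n E \<longrightarrow>
    (\<exists>u0<n. \<bar>x u0 - \<theta>\<bar> \<le> \<eta> \<and> (\<forall>v<n. v \<noteq> u0 \<longrightarrow> 1 - \<eta> \<le> x v) \<and>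
      (\<forall>v<n. \<bar>x v - deg n E v / ((1 - 1 / p) * n)\<bar> \<le> \<eta>))"
    using low_degree_cost[OF p2 q \<epsilon>(1,4) h h1'] eventually_gt_at_top[of 0]
  proof (eventually_elim, intro allI impI)
    fix n E x
    assume n: "2 * real (p + 1) * q \<le> \<epsilon> * real n" and n0: "0 < n"
      and cost: "\<forall>E x. simple_graph n E \<longrightarrow> \<not> contains_book n E p q \<longrightarrow> perron n E x \<longrightarrow>
        (1 - 1 / p) * (real n - (1 - ((real p - 2) / (real p - 1))\<^sup>2) - h) \<le> spec_rad n E \<longrightarrow>
        card {v. v < n \<and> deg n E v < (1 - 1 / p - \<epsilon>) * n} \<le> \<epsilon> * n \<and>
        (\<Sum>v | v < n \<and> deg n E v < (1 - 1 / p - \<epsilon>) * n. 1 - (x v)\<^sup>2) \<le> 1 - ((real p - 2) / (real p - 1))\<^sup>2 + 2 * h \<and>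
        (\<forall>v<n. \<bar>x v - deg n E v / ((1 - 1 / p) * n)\<bar> \<le> \<epsilon> / 2)"
      and E: "simple_graph n E" and nb: "\<not> contains_book n E p q" and nc: "\<not> colorable n E p"
      and x: "perron n E x" and \<rho>: "(1 - 1 / p) * (real n - (1 - \<theta>\<^sup>2) - h) \<le> spec_rad n E"
    define L where "L = {v. v < n \<and> deg n E v < (1 - 1 / p - \<epsilon>) * n}"
    have L: "L \<subseteq> {..<n}" "finite L" by (auto simp: L_def)
    have cL: "card L \<le> \<epsilon> * n" and sL: "(\<Sum>v\<in>L. 1 - (x v)\<^sup>2) \<le> 1 - \<theta>\<^sup>2 + 2 * h"
      and ent: "\<And>v. v < n \<Longrightarrow> \<bar>x v - deg n E v / (a * n)\<bar> \<le> \<epsilon> / 2"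
      using cost[rule_format, OF E nb x] \<rho> unfolding L_def \<theta>_def a_def by blast+
    have an: "a * n > 0" using a n0 by simp
    have x0: "0 \<le> x v" if "v < n" for v using x that by (simp add: perron_def)
    have ub: "x v \<le> t / a + \<epsilon> / 2" if "v < n" "real (deg n E v) \<le> t * n" for v and t :: real
    proof -
      have "deg n E v / (a * n) \<le> t * n / (a * n)" using that(2) an by (intro divide_right_mono) auto
      also have "\<dots> = t / a" using n0 by simp
      finally show ?thesis using ent[OF that(1)] by linarith
    qed
    have ha: "h / a \<le> 2 * h" using a h mult_right_mono[of "1/2" a "2 * h"] by (simp add: divide_le_eq mult.commute)
    have notL: "1 - 2 * h \<le> x v" if "v < n" "v \<notin> L" for v
    proof -
      have "(a - \<epsilon>) * n / (a * n) \<le> deg n E v / (a * n)"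
        using that an by (intro divide_right_mono) (auto simp: L_def a_def)
      moreover have "(a - \<epsilon>) * n / (a * n) = 1 - \<epsilon> / a" using a n0 by (simp add: field_simps)
      moreover have "\<epsilon> / a \<le> h / a" using \<epsilon> h a by (intro divide_right_mono) auto
      moreover have "\<epsilon> / a \<le> 2 * \<epsilon>" using a \<epsilon>(1) mult_right_mono[of "1/2" a "2 * \<epsilon>"] by (simp add: divide_le_eq mult.commute)
      ultimately show ?thesis using ent[OF that(1)] \<epsilon>(2) by linarith
    qed
    have inL: "x v \<le> 1" if "v \<in> L" for v
    proof -
      have "x v \<le> (a - \<epsilon>) / a + \<epsilon> / 2" using that by (intro ub) (auto simp: L_def a_def)
      also have "(a - \<epsilon>) / a = 1 - \<epsilon> / a" using a by (simp add: field_simps)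
      finally have "x v \<le> 1 - \<epsilon> / a + \<epsilon> / 2" .
      moreover have "\<epsilon> / 1 \<le> \<epsilon> / a" using a \<epsilon> by (intro divide_left_mono) auto
      ultimately show ?thesis using \<epsilon>(1) by linarith
    qed
    have nonneg: "0 \<le> 1 - (x v)\<^sup>2" if "v \<in> L" for v
      using inL[OF that] x0 that L by (auto simp: power_le_one)
    have \<theta>s: "1 - \<theta>\<^sup>2 = 2 * s - s\<^sup>2" by (simp add: s_def power2_eq_square algebra_simps)
    have "\<exists>u0<n. x u0 \<le> \<theta> + g"
    proof -
      have "\<not> ((\<forall>v\<in>{..<n}. deg n E v \<ge> (1 - 2 / p + h) * n) \<and>
         (\<forall>u\<in>{..<n}. \<forall>v\<in>{..<n}. u \<noteq> v \<longrightarrow> E u v \<longrightarrow> real (deg n E u) + deg n E v \<ge> (2 - 3 / p + h) * n))"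
      proof
        assume H: "(\<forall>v\<in>{..<n}. deg n E v \<ge> (1 - 2 / p + h) * n) \<and>
         (\<forall>u\<in>{..<n}. \<forall>v\<in>{..<n}. u \<noteq> v \<longrightarrow> E u v \<longrightarrow> real (deg n E u) + deg n E v \<ge> (2 - 3 / p + h) * n)"
        have "\<exists>c. (\<forall>v\<in>{..<n}. c v < p) \<and> (\<forall>u\<in>{..<n}. \<forall>v\<in>{..<n}. E u v \<longrightarrow> c u \<noteq> c v)"
          by (rule partial_colouring[OF E nb p2 q \<epsilon>(1,4) n L(1) cL _ \<epsilon>(3) order_refl])
             (use H in \<open>auto simp: L_def\<close>)
        then have "colorable n E p" by (auto simp: colorable_def)
        then show False using nc by simp
      qed
      then consider (one) v where "v < n" "deg n E v \<le> (1 - 2 / p + h) * n"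
        | (two) u v where "u < n" "v < n" "u \<noteq> v" "real (deg n E u) + deg n E v \<le> (2 - 3 / p + h) * n"
        by (force simp: not_le)
      then show ?thesis
      proof cases
        case one
        have "x v \<le> (1 - 2 / p + h) / a + \<epsilon> / 2" using one by (intro ub) auto
        also have "(1 - 2 / p + h) / a = \<theta> + h / a" by (simp only: add_divide_distrib th1)
        finally have "x v \<le> \<theta> + 3 * h" using ha \<epsilon>(2) h by linarith
        then show ?thesis using one(1) ph h unfolding gph by (intro exI[of _ v]) linarith
      next
        case two
        have sum: "x u + x v \<le> 1 + \<theta> + 4 * h"
        proof -
          have "deg n E u / (a * n) + deg n E v / (a * n) \<le> (2 - 3 / p + h) * n / (a * n)"
            unfolding add_divide_distrib[symmetric] using two(4) an by (intro divide_right_mono) auto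
          also have "\<dots> = (2 - 3 / p + h) / a" using n0 by simp
          also have "\<dots> = 1 + \<theta> + h / a" by (simp only: add_divide_distrib th2)
          finally show ?thesis using ent[OF two(1)] ent[OF two(2)] ha \<epsilon>(2) h by linarith
        qed
        have main: "\<exists>u0<n. x u0 \<le> \<theta> + g" if uv: "u < n" "v < n" "u \<noteq> v" "x u \<le> x v" and sum: "x u + x v \<le> 1 + \<theta> + 4 * h" for u v
        proof (cases "v \<in> L")
          case False
          then have "x u \<le> \<theta> + 6 * h" using notL[OF uv(2) False] sum by linarith
          then show ?thesis using uv(1) ph h unfolding gph by (intro exI[of _ u]) linarith
        next
          case True
          have "u \<in> L"
          proof (rule ccontr)
            assume uL: "u \<notin> L"
            have "2 - 4 * h \<le> 1 + \<theta> + 4 * h" using notL[OF uv(1) uL] uv(4) sum by linarith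
            then have "s \<le> 8 * h" by (simp add: s_def)
            then show False using ph h by linarith
          qed
          then have "(\<Sum>w\<in>{u, v}. 1 - (x w)\<^sup>2) \<le> (\<Sum>w\<in>L. 1 - (x w)\<^sup>2)"
            using True L nonneg by (intro sum_mono2) auto
          then have "(1 - (x u)\<^sup>2) + (1 - (x v)\<^sup>2) \<le> 2 * s - s\<^sup>2 + 2 * h" using sL uv(3) \<theta>s by simp
          moreover have "1 - (x w)\<^sup>2 = 2 * (1 - x w) - (1 - x w)\<^sup>2" for w
            by (simp add: power2_eq_square algebra_simps)
          ultimately have c: "(2 * (1 - x u) - (1 - x u)\<^sup>2) + (2 * (1 - x v) - (1 - x v)\<^sup>2) \<le> 2 * s - s\<^sup>2 + 2 * h" by simp
          have "s * (1 - x v) \<le> 20 * h"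
          proof (rule two_deficits[OF _ _ _ s(1,2) _ _ _ c])
            show "8 * h \<le> s" using ph h by linarith
            show "s - 4 * h \<le> 1 - x u + (1 - x v)" using sum by (simp add: s_def)
          qed (use uv inL[OF True] x0[OF uv(1)] h in auto)
          then have bnd: "(s * p) * (1 - x v) \<le> 20 * (p * h)" using mult_left_mono[of "s * (1 - x v)" "20 * h" "real p"] by (simp add: mult_ac)
          have "1 * (1 - x v) \<le> (s * p) * (1 - x v)" using s(3) inL[OF True] by (intro mult_right_mono) auto
          from order_trans[OF this bnd] have "1 - x v \<le> 20 * (p * h)" by simp
          then have "x u \<le> \<theta> + g" using sum ph h unfolding gph by linarith
          then show ?thesis using uv(1) by blast
        qed
        show ?thesis
          using main[of u v] main[of v u] two sum by (cases "x u \<le> x v") (auto simp: add.commute)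
      qed
    qed
    then obtain u0 where u0: "u0 < n" "x u0 \<le> \<theta> + g" by blast
    have u0L: "u0 \<in> L"
    proof (rule ccontr)
      assume "u0 \<notin> L"
      then have "1 - 2 * h \<le> \<theta> + g" using notL[OF u0(1) \<open>u0 \<notin> L\<close>] u0(2) by linarith
      then have "s \<le> 24 * (p * h) + 2 * h" by (simp add: s_def gph)
      then show False using ph h by linarith
    qed
    have \<theta>12: "1/2 \<le> \<theta>" "\<theta> \<le> 1" using s by (auto simp: s_def)
    have g: "0 \<le> g" "4 * g \<le> \<eta>" "2 * h \<le> g" "g \<le> 1" using ph h \<eta> unfolding gph by linarith+
    have split: "(\<Sum>v\<in>L. 1 - (x v)\<^sup>2) = (1 - (x u0)\<^sup>2) + (\<Sum>v\<in>L - {u0}. 1 - (x v)\<^sup>2)"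
      using u0L L by (simp add: sum.remove)
    have "(x u0)\<^sup>2 \<le> (\<theta> + g)\<^sup>2" using u0 x0[OF u0(1)] by (intro power_mono) auto
    also have "\<dots> = \<theta>\<^sup>2 + (2 * \<theta> + g) * g" by (simp add: power2_eq_square algebra_simps)
    also have "(2 * \<theta> + g) * g \<le> 3 * g" using \<theta>12 g by (intro mult_right_mono) auto
    finally have rest: "(\<Sum>v\<in>L - {u0}. 1 - (x v)\<^sup>2) \<le> 4 * g" using sL split g by linarith
    have others: "1 - \<eta> \<le> x v" if v: "v < n" "v \<noteq> u0" for v
    proof (cases "v \<in> L")
      case True
      then have "(\<Sum>w\<in>{v}. 1 - (x w)\<^sup>2) \<le> (\<Sum>w\<in>L - {u0}. 1 - (x w)\<^sup>2)"
        using v L nonneg by (intro sum_mono2) auto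
      then have "1 - (x v)\<^sup>2 \<le> 4 * g" using rest by simp
      moreover have "(x v)\<^sup>2 \<le> x v" using inL[OF True] x0[OF v(1)] by (simp add: power2_eq_square mult_left_le)
      ultimately show ?thesis using g by linarith
    next
      case False
      then show ?thesis using notL[OF v(1) False] g by linarith
    qed
    \<comment> \<open>An entry further below \<theta> would alone cost more than the whole
      budget.\<close>
    have lower: "\<theta> - \<eta> \<le> x u0"
    proof (rule ccontr)
      assume "\<not> ?thesis"
      then have "x u0 \<le> \<theta> - 4 * h" using g h by linarith
      then have "(x u0)\<^sup>2 \<le> (\<theta> - 4 * h)\<^sup>2" using x0[OF u0(1)] by (intro power_mono) auto
      also have "\<dots> = \<theta>\<^sup>2 - 4 * h * (2 * \<theta> - 4 * h)" by (simp add: power2_eq_square algebra_simps)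
      finally have "(x u0)\<^sup>2 \<le> \<theta>\<^sup>2 - 4 * h * (2 * \<theta> - 4 * h)" .
      moreover have "4 * h * (1/2) < 4 * h * (2 * \<theta> - 4 * h)" using \<theta>12 h h1 by (intro mult_strict_left_mono) auto
      ultimately have "1 - (x u0)\<^sup>2 > 1 - \<theta>\<^sup>2 + 2 * h" by simp
      moreover have "0 \<le> (\<Sum>v\<in>L - {u0}. 1 - (x v)\<^sup>2)" using nonneg by (intro sum_nonneg) auto
      ultimately show False using sL split by linarith
    qed
    have "\<bar>x v - deg n E v / ((1 - 1 / p) * n)\<bar> \<le> \<eta>" if "v < n" for v
      using ent[OF that] \<epsilon>(2) g h unfolding a_def by linarith
    moreover have "\<bar>x u0 - \<theta>\<bar> \<le> \<eta>" using lower u0(2) g by linarith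
    ultimately show "\<exists>u0<n. \<bar>x u0 - \<theta>\<bar> \<le> \<eta> \<and> (\<forall>v<n. v \<noteq> u0 \<longrightarrow> 1 - \<eta> \<le> x v) \<and>
      (\<forall>v<n. \<bar>x v - deg n E v / ((1 - 1 / p) * n)\<bar> \<le> \<eta>)" using u0(1) others by blast
  qed
  then show ?thesis using h by blast
qed

section \<open>Reduction to the graphs \<open>Y\<close>\<close>

text \<open>Colour classes are independent, so high degrees bound their sizes from above. The sizes
  add up to \<open>n - 1\<close>, which bounds them from below, and then a vertex has hardly any
  deficit left for the other classes.\<close>

lemma proper_colouring_core:
  fixes \<epsilon> :: real and p n :: nat
  assumes E: "simple_graph n E" and p: "p \<ge> 2" and u0: "u0 < n" and n: "1 \<le> \<epsilon> * n"
    and c: "\<And>v. v < n \<Longrightarrow> v \<noteq> u0 \<Longrightarrow> c v < p"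
      "\<And>u v. u < n \<Longrightarrow> v < n \<Longrightarrow> u \<noteq> u0 \<Longrightarrow> v \<noteq> u0 \<Longrightarrow> E u v \<Longrightarrow> c u \<noteq> c v"
    and d: "\<And>v. v < n \<Longrightarrow> v \<noteq> u0 \<Longrightarrow> deg n E v \<ge> (1 - 1 / p - \<epsilon>) * n"
  shows "\<And>i. i < p \<Longrightarrow> card (part n c u0 i) \<le> (1 / p + \<epsilon>) * n"
    and "\<And>i j u. i < p \<Longrightarrow> i \<noteq> j \<Longrightarrow> u \<in> part n c u0 i \<Longrightarrow>
       real (card (part n c u0 j - {w. E u w})) \<le> (real p + 1) * \<epsilon> * n"
proof -
  let ?P = "part n c u0"
  have e0: "0 \<le> \<epsilon> * n" using n by simp
  have indep: "\<not> E u w" if "u \<in> ?P i" "w \<in> ?P i" for u w i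
    using c(2)[of u w] that by (auto simp: part_def)
  have d': "real n - deg n E u \<le> (1 / p + \<epsilon>) * n" if "u \<in> ?P i" for u i
    using d[of u] that by (simp add: part_def algebra_simps)
  show up: "card (?P i) \<le> (1 / p + \<epsilon>) * n" if i: "i < p" for i
  proof (cases "?P i = {}")
    case True
    have "0 \<le> 1 / p * real n" by simp
    then show ?thesis using True e0 by (simp add: algebra_simps)
  next
    case False
    then obtain u where u: "u \<in> ?P i" by blast
    have "?P i \<subseteq> {w. w < n \<and> \<not> E u w}" using indep[OF u] by (auto simp: part_def)
    then have "card (?P i) \<le> n - deg n E u" unfolding deg_complement[symmetric] by (intro card_mono) auto
    then have "real (card (?P i)) \<le> real n - deg n E u" using deg_le[of n E u] by (simp add: of_nat_diff)
    also have "\<dots> \<le> (1 / p + \<epsilon>) * n" by (rule d'[OF u])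
    finally show ?thesis .
  qed
  have lo: "card (?P i) \<ge> n / p - p * (\<epsilon> * n)" if i: "i < p" for i
  proof -
    have "?P j = {x \<in> {..<n} - {u0}. c x = j}" for j by (auto simp: part_def)
    then have "(\<Sum>j<p. card (?P j)) = card ({..<n} - {u0})"
      using sum.group[of "{..<n} - {u0}" "{..<p}" c "\<lambda>_. 1::nat"] c(1) by auto
    then have "real n - 1 = (\<Sum>j<p. real (card (?P j)))"
      unfolding of_nat_sum[symmetric] using u0 by (simp add: of_nat_diff Suc_leI)
    also have "\<dots> = card (?P i) + (\<Sum>j\<in>{..<p}-{i}. real (card (?P j)))" using i by (simp add: sum.remove)
    also have "(\<Sum>j\<in>{..<p}-{i}. real (card (?P j))) \<le> (\<Sum>j\<in>{..<p}-{i}. (1 / p + \<epsilon>) * n)" using up by (intro sum_mono) auto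
    also have "\<dots> = (real p - 1) * ((1 / p + \<epsilon>) * n)" using i by (simp add: of_nat_diff)
    also have "\<dots> = n - n / p + p * (\<epsilon> * n) - \<epsilon> * n" using p by (simp add: field_simps)
    finally show ?thesis using n by linarith
  qed
  show "real (card (?P j - {w. E u w})) \<le> (real p + 1) * \<epsilon> * n"
    if ij: "i < p" "i \<noteq> j" and u: "u \<in> ?P i" for i j u
  proof -
    have "(?P j - {w. E u w}) \<union> ?P i \<subseteq> {w. w < n \<and> \<not> E u w}" using indep[OF u] by (auto simp: part_def)
    then have "card ((?P j - {w. E u w}) \<union> ?P i) \<le> n - deg n E u" unfolding deg_complement[symmetric] by (intro card_mono) auto
    moreover have "card ((?P j - {w. E u w}) \<union> ?P i) = card (?P j - {w. E u w}) + card (?P i)"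
      using ij by (intro card_Un_disjoint) (auto simp: part_def)
    ultimately have "real (card (?P j - {w. E u w})) + card (?P i) \<le> real n - deg n E u"
      using deg_le[of n E u] by (simp add: of_nat_diff flip: of_nat_add)
    also have "\<dots> \<le> (1 / p + \<epsilon>) * n" by (rule d'[OF u])
    finally show ?thesis using lo[OF ij(1)] by (simp add: algebra_simps)
  qed
qed

text \<open>A class without neighbours of \<open>u0\<close> would provide a colour for it. If
  \<open>u0\<close> had many neighbours in all classes but one, a neighbour in that one would start
  a greedy book, so there are two poor classes, and by its degree \<open>u0\<close> sees almost all
  of the others. An edge between its neighbours in the poor classes would give a triangle that
  extends to a book.\<close>

lemma bad_vertex_neighbourhoods:
  fixes \<epsilon> :: real and p q n :: nat
  assumes E: "simple_graph n E" and nb: "\<not> contains_book n E p q" and nc: "\<not> colorable n E p"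
    and p: "p \<ge> 3" and q: "q \<ge> 1" and u0: "u0 < n" and \<epsilon>: "\<epsilon> > 0" "100 * p * (real p + 1)^2 * \<epsilon> \<le> 1"
    and n: "real q + 1 \<le> \<epsilon> * n"
    and c: "\<And>v. v < n \<Longrightarrow> v \<noteq> u0 \<Longrightarrow> c v < p"
      "\<And>u v. u < n \<Longrightarrow> v < n \<Longrightarrow> u \<noteq> u0 \<Longrightarrow> v \<noteq> u0 \<Longrightarrow> E u v \<Longrightarrow> c u \<noteq> c v"
    and d: "\<And>v. v < n \<Longrightarrow> v \<noteq> u0 \<Longrightarrow> deg n E v \<ge> (1 - 1 / p - \<epsilon>) * n"
    and d0: "deg n E u0 \<ge> (1 - 2 / p - \<epsilon>) * n"
  shows "\<exists>i1<p. \<exists>i2<p. i1 \<noteq> i2 \<and> (\<forall>i<p. \<exists>w\<in>part n c u0 i. E u0 w) \<and>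
     (\<forall>u\<in>part n c u0 i1. \<forall>v\<in>part n c u0 i2. E u0 u \<longrightarrow> E u0 v \<longrightarrow> \<not> E u v)"
proof -
  let ?P = "part n c u0"
  have p2: "p \<ge> 2" using p by simp
  have n1: "1 \<le> \<epsilon> * n" using n by linarith
  define e where "e = (real p + 1) * \<epsilon> * n"
  have near: "real (card (?P j - {w. E u w})) \<le> e" if "i < p" "i \<noteq> j" "u \<in> ?P i" for i j u
    unfolding e_def by (rule proper_colouring_core(2)[OF E p2 u0 n1, where c = c and i = i]) (use c d that in blast)+
  have up: "card (?P i) \<le> (1 / p + \<epsilon>) * n" if "i < p" for i
    by (rule proper_colouring_core(1)[OF E p2 u0 n1, where c = c and i = i]) (use c d that in blast)+
  have e0: "e \<ge> 0" using \<epsilon> by (simp add: e_def)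
  have Pn: "?P i \<subseteq> {..<n}" for i by (auto simp: part_def)
  have sym: "E u v \<longleftrightarrow> E v u" for u v using simple_graphD(1)[OF E] by blast
  have irr: "\<not> E u u" for u using simple_graphD(2)[OF E] by blast
  have nbr: "\<exists>w\<in>?P i. E u0 w" if i: "i < p" for i
  proof (rule ccontr)
    assume no: "\<not> ?thesis"
    define c' where "c' = c(u0 := i)"
    have "c' u \<noteq> c' v" if uv: "u < n" "v < n" "E u v" for u v
    proof -
      have "u \<noteq> v" using irr uv by auto
      then consider "u = u0" "v \<noteq> u0" | "v = u0" "u \<noteq> u0" | "u \<noteq> u0" "v \<noteq> u0" by blast
      then show ?thesis
      proof cases
        case 1
        then have "c v \<noteq> i" using no uv by (auto simp: part_def)
        then show ?thesis using 1 by (simp add: c'_def)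
      next
        case 2
        then have "c u \<noteq> i" using no uv sym[of u u0] by (auto simp: part_def)
        then show ?thesis using 2 by (simp add: c'_def)
      next
        case 3
        then show ?thesis using c(2)[OF uv(1,2) 3 uv(3)] by (simp add: c'_def)
      qed
    qed
    moreover have "\<forall>v<n. c' v < p" using c(1) i by (auto simp: c'_def)
    ultimately have "colorable n E p" unfolding colorable_def by blast
    then show False using nc by simp
  qed
  define a where "a i = card (?P i \<inter> {w. E u0 w})" for i
  \<comment> \<open>Room for losing \<open>e\<close> at each of \<open>p - 1\<close> choices, that
    of \<open>w\<close> included, with \<open>q\<close> pages left.\<close>
  define B where "B = (real p - 1) * e + q"
  have small: "\<exists>j<p. j \<noteq> i \<and> real (a j) < B" if i: "i < p" for i
  proof (rule ccontr)
    assume no: "\<not> ?thesis"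
    obtain w where w: "w \<in> ?P i" "E u0 w" using nbr[OF i] by blast
    show False
    proof (rule greedy_book[OF E nb q e0, where I = "{..<p} - {i}" and V = ?P and S = "{u0, w}"])
      show "real (card (?P j' - {w. E u w})) \<le> e" if "i' \<in> {..<p} - {i}" "j' \<in> {..<p} - {i}" "i' \<noteq> j'" "u \<in> ?P i'" for i' j' u
        using near that by auto
      show "?P j \<subseteq> {..<n}" for j by (rule Pn)
      show "{..<p} - {i} \<noteq> {}" using p i by (intro card_gt_0_iff[THEN iffD1, THEN conjunct1]) simp
      show "{u0, w} \<subseteq> {..<n}" using u0 w Pn by auto
      show "clique E {u0, w}" using w sym by (auto simp: clique_def)
      have "u0 \<noteq> w" using w by (auto simp: part_def)
      then show "card {u0, w} + card ({..<p} - {i}) = Suc p" using i p by simp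
      fix j assume j: "j \<in> {..<p} - {i}"
      have "?P j \<inter> {w. E u0 w} \<subseteq> (?P j \<inter> common_nbrs n E {u0, w}) \<union> (?P j - {u. E w u})"
        by (auto simp: common_nbrs_def part_def)
      then have "a j \<le> card ((?P j \<inter> common_nbrs n E {u0, w}) \<union> (?P j - {u. E w u}))"
        unfolding a_def by (intro card_mono) auto
      then have "a j \<le> card (?P j \<inter> common_nbrs n E {u0, w}) + card (?P j - {u. E w u})"
        by (rule order_trans[OF _ card_Un_le])
      then have "real (a j) \<le> real (card (?P j \<inter> common_nbrs n E {u0, w})) + real (card (?P j - {u. E w u}))"
        by linarith
      moreover have "real (card (?P j - {u. E w u})) \<le> e" using near[OF i _ w(1), of j] j by auto
      moreover have "B \<le> real (a j)" using no j by (metis DiffD1 DiffD2 insertI1 lessThan_iff not_less)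
      moreover have "real (card ({..<p} - {i}) - 1) * e = (real p - 1) * e - e"
        using i p by (simp add: of_nat_diff algebra_simps)
      ultimately show "real (card ({..<p} - {i}) - 1) * e + q \<le> real (card (?P j \<inter> common_nbrs n E {u0, w}))"
        unfolding B_def by linarith
    qed simp
  qed
  \<comment> \<open>Excluding an arbitrary class first, and then the class just found, yields two
    different poor classes.\<close>
  obtain i1 where i1: "i1 < p" "real (a i1) < B" using small[of 0] p by auto
  obtain i2 where i2: "i2 < p" "i2 \<noteq> i1" "real (a i2) < B" using small[OF i1(1)] by auto
  have suma: "real (deg n E u0) = (\<Sum>j<p. real (a j))"
  proof -
    have "{w. w < n \<and> E u0 w} = (\<Union>j<p. ?P j \<inter> {w. E u0 w})" using c(1) irr by (auto simp: part_def)
    moreover have "card (\<Union>j<p. ?P j \<inter> {w. E u0 w}) = (\<Sum>j<p. a j)"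
      unfolding a_def by (rule card_UN_disjoint) (auto simp: part_def)
    ultimately show ?thesis by (simp add: deg_def)
  qed
  define N where "N = \<epsilon> * real n"
  have NN: "N \<ge> 1" "real q \<le> N" using n by (auto simp: N_def)
  have eN: "e = p * N + N" by (simp add: e_def N_def algebra_simps)
  have pN: "p * N \<ge> 3 * N" using p NN by (intro mult_right_mono) auto
  have ppN: "p * (p * N) \<ge> 3 * (p * N)" using p NN by (intro mult_right_mono) auto
  have big: "100 * (p * (p * N)) \<le> n / p"
  proof -
    have "100 * (p * (real p)^2 * \<epsilon>) \<le> 100 * (p * (real p + 1)^2 * \<epsilon>)"
      using \<epsilon> p by (intro mult_left_mono mult_right_mono power_mono) auto
    also have "\<dots> \<le> 1" using \<epsilon>(2) by (simp add: mult_ac)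
    finally have "100 * (p * (real p)^2 * \<epsilon>) * (n / p) \<le> 1 * (n / p)" by (rule mult_right_mono) simp
    then show ?thesis using p by (simp add: N_def power2_eq_square field_simps)
  qed
  \<comment> \<open>The neighbours of \<open>u0\<close> outside class \<open>j\<close> lie in two
    poor classes and \<open>p - 3\<close> others of size at most about \<open>n / p\<close>, so
    class \<open>j\<close> must be nearly full.\<close>
  have aj: "real (a j) \<ge> n / p - p * N - 2 * B" if j: "j < p" "j \<noteq> i1" "j \<noteq> i2" for j
  proof -
    have "(\<Sum>k<p. real (a k)) = real (a i1) + (real (a i2) + (real (a j) + (\<Sum>k\<in>{..<p} - {i1} - {i2} - {j}. real (a k))))"
      using i1 i2 j by (simp add: sum.remove[of _ i1] sum.remove[of _ i2] sum.remove[of _ j])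
    moreover have "(\<Sum>k\<in>{..<p} - {i1} - {i2} - {j}. real (a k)) \<le> (\<Sum>k\<in>{..<p} - {i1} - {i2} - {j}. (1 / p + \<epsilon>) * n)"
    proof (rule sum_mono)
      fix k assume k: "k \<in> {..<p} - {i1} - {i2} - {j}"
      have "a k \<le> card (?P k)" unfolding a_def by (intro card_mono) auto
      then show "real (a k) \<le> (1 / p + \<epsilon>) * n" using up[of k] k by (simp add: order_trans[OF of_nat_mono])
    qed
    moreover have "(\<Sum>k\<in>{..<p} - {i1} - {i2} - {j}. (1 / p + \<epsilon>) * n) = (real p - 3) * ((1 / p + \<epsilon>) * n)"
    proof -
      have "card ({..<p} - {i1} - {i2} - {j}) = p - 3" using i1 i2 j by simp
      then show ?thesis using p by (simp add: of_nat_diff)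
    qed
    moreover have "(real p - 3) * ((1 / p + \<epsilon>) * n) = n - 3 * (n / p) + p * N - 3 * N"
      using p by (simp add: N_def field_simps)
    moreover have "(1 - 2 / p - \<epsilon>) * n = n - 2 * (n / p) - N" by (simp add: N_def algebra_simps)
    ultimately show ?thesis using suma d0 i1(2) i2(3) NN by linarith
  qed
  have "\<not> E u v" if u: "u \<in> ?P i1" "E u0 u" and v: "v \<in> ?P i2" "E u0 v" for u v
  proof
    assume uv: "E u v"
    have cI: "card ({..<p} - {i1, i2}) = p - 2" using i1 i2 by (subst card_Diff_subset) auto
    show False
    proof (rule greedy_book[OF E nb q e0, where I = "{..<p} - {i1, i2}" and V = ?P and S = "{u0, u, v}"])
      show "real (card (?P j' - {w. E u w})) \<le> e" if "i' \<in> {..<p} - {i1, i2}" "j' \<in> {..<p} - {i1, i2}" "i' \<noteq> j'" "u \<in> ?P i'" for i' j' u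
        using near that by auto
      show "?P j \<subseteq> {..<n}" for j by (rule Pn)
      show "{..<p} - {i1, i2} \<noteq> {}" using p cI by (intro card_gt_0_iff[THEN iffD1, THEN conjunct1]) simp
      show "{u0, u, v} \<subseteq> {..<n}" using u0 u v Pn by auto
      show "clique E {u0, u, v}" using u v uv sym by (auto simp: clique_def)
      have "u0 \<noteq> u" "u0 \<noteq> v" "u \<noteq> v" using u v i2 by (auto simp: part_def)
      then have "card {u0, u, v} = 3" by simp
      then show "card {u0, u, v} + card ({..<p} - {i1, i2}) = Suc p" using p cI by simp
      fix j assume j: "j \<in> {..<p} - {i1, i2}"
      have "?P j \<inter> {w. E u0 w} \<subseteq> (?P j \<inter> common_nbrs n E {u0, u, v}) \<union> ((?P j - {w. E u w}) \<union> (?P j - {w. E v w}))"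
        by (auto simp: common_nbrs_def part_def)
      then have "a j \<le> card ((?P j \<inter> common_nbrs n E {u0, u, v}) \<union> ((?P j - {w. E u w}) \<union> (?P j - {w. E v w})))"
        unfolding a_def by (intro card_mono) auto
      also have "\<dots> \<le> card (?P j \<inter> common_nbrs n E {u0, u, v}) + (card (?P j - {w. E u w}) + card (?P j - {w. E v w}))"
        by (meson add_left_mono card_Un_le order_trans)
      finally have "real (a j) \<le> real (card (?P j \<inter> common_nbrs n E {u0, u, v})) + (real (card (?P j - {w. E u w})) + real (card (?P j - {w. E v w})))"
        by linarith
      moreover have "real (card (?P j - {w. E u w})) \<le> e" using near[OF i1(1) _ u(1), of j] j by auto
      moreover have "real (card (?P j - {w. E v w})) \<le> e" using near[OF i2(1) _ v(1), of j] j by auto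
      moreover have "real (a j) \<ge> n / p - p * N - 2 * B" using aj j by auto
      ultimately have l: "n / p - p * N - 2 * B - 2 * e \<le> real (card (?P j \<inter> common_nbrs n E {u0, u, v}))" by linarith
      have "B = p * (p * N) - N + q" by (simp add: B_def eN algebra_simps)
      moreover have "(real p - 3) * e = p * (p * N) - 2 * (p * N) - 3 * N" by (simp add: eN algebra_simps)
      ultimately have "(real p - 3) * e + q \<le> n / p - p * N - 2 * B - 2 * e"
        using big ppN pN NN eN by linarith
      moreover have "real (card ({..<p} - {i1, i2}) - 1) = real p - 3" using cI p by (simp add: of_nat_diff)
      ultimately show "real (card ({..<p} - {i1, i2}) - 1) * e + q \<le> real (card (?P j \<inter> common_nbrs n E {u0, u, v}))"
        using l by simp
    qed simp
  qed
  then show ?thesis using i1(1) i2(1,2) nbr by blast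
qed

text \<open>Moving the edges from \<open>u0\<close> into \<open>A1 - {u1}\<close> and \<open>A2 - {u2}\<close> over to \<open>u2\<close> and \<open>u1\<close>, whose entries exceed that of \<open>u0\<close>,
  increases the quadratic form; the remaining missing edges of \<open>Y_col\<close> can then be added.\<close>

lemma quad_shift_le:
  fixes x :: "nat \<Rightarrow> real"
  assumes E: "simple_graph n E" and Y: "Y_structure p n c u0 u1 u2"
    and proper: "\<And>u v. u < n \<Longrightarrow> v < n \<Longrightarrow> u \<noteq> u0 \<Longrightarrow> v \<noteq> u0 \<Longrightarrow> E u v \<Longrightarrow> c u \<noteq> c v"
    and nbr: "E u0 u1" "E u0 u2"
    and sep: "\<And>u v. u \<in> part n c u0 (c u1) \<Longrightarrow> v \<in> part n c u0 (c u2) \<Longrightarrow> E u0 u \<Longrightarrow> E u0 v \<Longrightarrow> \<not> E u v"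
    and x: "\<And>i. i < n \<Longrightarrow> 0 < x i" "x u0 < x u1" "x u0 < x u2"
  shows "quad n E x \<le> quad n (Y_col n c u0 u1 u2) x \<and>
    (quad n E x = quad n (Y_col n c u0 u1 u2) x \<longrightarrow> E = Y_col n c u0 u1 u2)"
proof -
  interpret Y_structure p n c u0 u1 u2 by (rule Y)
  have sym: "E u v \<longleftrightarrow> E v u" for u v using simple_graphD(1)[OF E] by blast
  have irr: "\<not> E u u" for u using simple_graphD(2)[OF E] by blast
  have Gsym: "G u v \<longleftrightarrow> G v u" for u v using simple_graphD(1)[OF simple_G] by blast
  define A1 where "A1 = {w \<in> P (c u1). E u0 w \<and> w \<noteq> u1}"
  define A2 where "A2 = {w \<in> P (c u2). E u0 w \<and> w \<noteq> u2}"
  have A1: "w < n" "w \<noteq> u0" "c w = c u1" "E u0 w" "w \<noteq> u1" "w \<noteq> u2" if "w \<in> A1" for w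
    using that c12 by (auto simp: A1_def part_def)
  have A2: "w < n" "w \<noteq> u0" "c w = c u2" "E u0 w" "w \<noteq> u1" "w \<noteq> u2" if "w \<in> A2" for w
    using that c12 by (auto simp: A2_def part_def)
  have u1P: "u1 \<in> P (c u1)" and u2P: "u2 \<in> P (c u2)" using u1n u2n u01 u02 by (auto simp: part_def)
  \<comment> \<open>Both relations record an edge in one direction only, seen from the vertex
    \<open>i\<close> that trades its neighbour \<open>u0\<close> for \<open>u2\<close> or
    \<open>u1\<close>.\<close>
  define gain where "gain i j \<longleftrightarrow> (i \<in> A1 \<and> j = u2) \<or> (i \<in> A2 \<and> j = u1)" for i j
  define loss where "loss i j \<longleftrightarrow> (i \<in> A1 \<or> i \<in> A2) \<and> j = u0" for i j
  have gain: "G i j \<and> \<not> E i j \<and> \<not> gain j i \<and> \<not> loss i j \<and> \<not> loss j i" if gn: "gain i j" for i j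
  proof -
    consider "i \<in> A1" "j = u2" | "i \<in> A2" "j = u1" using gn by (auto simp: gain_def)
    then show ?thesis
    proof cases
      case 1
      have "G i j" using A1[OF 1(1)] 1 u2n u02 c12 by (auto simp: Y_col_def)
      \<comment> \<open>\<open>i\<close> and \<open>u2\<close> are neighbours of \<open>u0\<close>
        in the two separated classes, so the gained edge is really new.\<close>
      moreover have "\<not> E i j" using 1 sep[OF _ u2P _ nbr(2), of i] by (auto simp: A1_def)
      moreover have "j \<notin> A1" "j \<notin> A2" using 1 A1(6) A2(6) by blast+
      then have "\<not> gain j i" "\<not> loss j i" by (auto simp: gain_def loss_def)
      moreover have "\<not> loss i j" using 1 u02 by (auto simp: loss_def)
      ultimately show ?thesis by blast
    next
      case 2
      have "G i j" using A2[OF 2(1)] 2 u1n u01 c12 by (auto simp: Y_col_def)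
      moreover have "\<not> E i j" using 2 sep[OF u1P _ nbr(1), of i] sym[of i u1] by (auto simp: A2_def)
      moreover have "j \<notin> A1" "j \<notin> A2" using 2 A1(5) A2(5) by blast+
      then have "\<not> gain j i" "\<not> loss j i" by (auto simp: gain_def loss_def)
      moreover have "\<not> loss i j" using 2 u01 by (auto simp: loss_def)
      ultimately show ?thesis by blast
    qed
  qed
  have loss: "E i j \<and> \<not> loss j i" if "loss i j" for i j
    using that A1(2,4) A2(2,4) sym[of i u0] by (auto simp: loss_def)
  have stay0: "G u0 w" if w: "E u0 w" "w \<notin> A1" "w \<notin> A2" for w
  proof -
    have wn: "w < n" "w \<noteq> u0" using simple_graphD(4)[OF E w(1)] irr w(1) by auto
    then have "attached c u1 u2 w" using w unfolding attached_def A1_def A2_def part_def by auto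
    then show ?thesis using wn u0n by (simp add: Y_col_def)
  qed
  have stay: "G i j" if ij: "E i j" "\<not> loss i j" "\<not> loss j i" for i j
  proof -
    have n: "i < n" "j < n" "i \<noteq> j" using simple_graphD(3,4)[OF E ij(1)] irr ij(1) by auto
    consider "i = u0" | "j = u0" | "i \<noteq> u0" "j \<noteq> u0" by blast
    then show ?thesis
    proof cases
      case 1
      then show ?thesis using stay0[of j] ij by (auto simp: loss_def)
    next
      case 2
      then have "E u0 i" using ij(1) sym by blast
      then show ?thesis using stay0[of i] ij 2 Gsym[of i j] by (auto simp: loss_def)
    next
      case 3
      have "\<not> E u1 u2" "\<not> E u2 u1" using sep[OF u1P u2P nbr] sym by blast+
      then have "\<not> (i = u1 \<and> j = u2)" "\<not> (i = u2 \<and> j = u1)" using ij(1) by auto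
      then show ?thesis using proper[OF n(1,2) 3 ij(1)] n 3 by (simp add: Y_col_def)
    qed
  qed
  define D where "D i j = (of_bool (gain i j) - of_bool (loss i j) :: real)" for i j
  \<comment> \<open>What \<open>Y_col\<close> has beyond \<open>E\<close> after the exchange. Its
    nonnegativity says that unexchanged edges of \<open>E\<close> survive and that gains and losses
    do not collide.\<close>
  define R where "R i j = (of_bool (G i j) - of_bool (E i j) - D i j - D j i :: real)" for i j
  have R: "0 \<le> R i j" for i j
    using gain[of i j] gain[of j i] loss[of i j] loss[of j i] stay[of i j] Gsym[of i j] sym[of i j]
    unfolding R_def D_def by (cases "gain i j"; cases "gain j i"; cases "loss i j"; cases "loss j i"; cases "E i j") auto
  define g where "g i = of_bool (i \<in> A1) * (x u2 - x u0) + of_bool (i \<in> A2) * (x u1 - x u0)" for i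
  have Dg: "(\<Sum>j<n. D i j * x j) = g i" for i
  proof -
    have "i \<notin> A1 \<or> i \<notin> A2" by (metis A1(3) A2(3) c12)
    then have "(\<Sum>j<n. D i j * x j) = (\<Sum>j<n. of_bool (i \<in> A1) * (of_bool (j = u2) * x j - of_bool (j = u0) * x j)
        + of_bool (i \<in> A2) * (of_bool (j = u1) * x j - of_bool (j = u0) * x j))"
      unfolding D_def gain_def loss_def by (intro sum.cong) auto
    then show ?thesis
      unfolding g_def by (simp only: sum.distrib sum_subtractf sum_distrib_left[symmetric] sum_delta[OF u0n] sum_delta[OF u1n] sum_delta[OF u2n])
  qed
  define \<Delta> where "\<Delta> = (\<Sum>i<n. x i * g i)"
  define \<Sigma> where "\<Sigma> = (\<Sum>i<n. \<Sum>j<n. R i j * (x i * x j))"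
  have "quad n G x - quad n E x = (\<Sum>i<n. \<Sum>j<n. (of_bool (G i j) - of_bool (E i j)) * (x i * x j))"
    unfolding quad_def nsum_def sum_distrib_left sum_subtractf[symmetric] by (intro sum.cong refl) (simp add: algebra_simps)
  also have "\<dots> = (\<Sum>i<n. \<Sum>j<n. R i j * (x i * x j) + x i * (D i j * x j) + x j * (D j i * x i))"
    by (intro sum.cong refl) (simp add: R_def algebra_simps)
  also have "\<dots> = \<Sigma> + (\<Sum>i<n. \<Sum>j<n. x i * (D i j * x j)) + (\<Sum>i<n. \<Sum>j<n. x j * (D j i * x i))"
    by (simp only: sum.distrib \<Sigma>_def)
  also have "(\<Sum>i<n. \<Sum>j<n. x j * (D j i * x i)) = (\<Sum>i<n. \<Sum>j<n. x i * (D i j * x j))" by (rule sum.swap)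
  also have "(\<Sum>i<n. \<Sum>j<n. x i * (D i j * x j)) = \<Delta>"
    by (simp only: sum_distrib_left[symmetric] Dg \<Delta>_def)
  finally have diff: "quad n G x - quad n E x = \<Sigma> + 2 * \<Delta>" by simp
  have \<Sigma>t: "0 \<le> R i j * (x i * x j)" if "i < n" "j < n" for i j
    using R x(1)[OF that(1)] x(1)[OF that(2)] by simp
  have \<Sigma>0: "0 \<le> \<Sigma>" unfolding \<Sigma>_def using \<Sigma>t by (intro sum_nonneg) auto
  have \<Delta>t: "0 \<le> x i * g i" if "i < n" for i
    using x(1)[OF that] x(2,3) unfolding g_def by (intro mult_nonneg_nonneg add_nonneg_nonneg) auto
  have \<Delta>0: "0 \<le> \<Delta>" unfolding \<Delta>_def using \<Delta>t by (intro sum_nonneg) auto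
  \<comment> \<open>All summands are nonnegative. As \<open>x u0\<close> is strictly smaller than
    \<open>x u1\<close> and \<open>x u2\<close>, equality empties \<open>A1\<close> and
    \<open>A2\<close>, and positivity of \<open>x\<close> then forces \<open>R\<close> to
    vanish.\<close>
  have "E = G" if eq: "quad n E x = quad n G x"
  proof -
    have z: "\<Sigma> = 0" "\<Delta> = 0" using diff eq \<Sigma>0 \<Delta>0 by linarith+
    have "x i * g i = 0" if "i < n" for i
      using z(2) \<Delta>t that unfolding \<Delta>_def by (subst (asm) sum_nonneg_eq_0_iff) auto
    then have g0: "g i = 0" if "i < n" for i using that x(1)[of i] by force
    have "A1 = {}"
    proof (rule ccontr)
      assume "A1 \<noteq> {}"
      then obtain w where w: "w \<in> A1" by blast
      then have "w \<notin> A2" by (metis A1(3) A2(3) c12)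
      then show False using g0[OF A1(1)[OF w]] w x(3) by (simp add: g_def)
    qed
    moreover have "A2 = {}"
    proof (rule ccontr)
      assume "A2 \<noteq> {}"
      then obtain w where w: "w \<in> A2" by blast
      then have "w \<notin> A1" by (metis A1(3) A2(3) c12)
      then show False using g0[OF A2(1)[OF w]] w x(2) by (simp add: g_def)
    qed
    ultimately have D0: "D i j = 0" for i j by (simp add: D_def gain_def loss_def)
    have "R i j = 0" if "i < n" "j < n" for i j
    proof -
      have "(\<Sum>j<n. R i j * (x i * x j)) = 0"
        using z(1) \<Sigma>t that(1) unfolding \<Sigma>_def by (subst (asm) sum_nonneg_eq_0_iff) (auto intro: sum_nonneg)
      then have "R i j * (x i * x j) = 0" using \<Sigma>t that by (subst (asm) sum_nonneg_eq_0_iff) auto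
      then show ?thesis using x(1)[OF that(1)] x(1)[OF that(2)] by simp
    qed
    then have "E i j \<longleftrightarrow> G i j" if "i < n" "j < n" for i j
      using that unfolding R_def D0 by (cases "E i j"; cases "G i j") fastforce+
    then show ?thesis using simple_graphD(3,4)[OF E] simple_graphD(3,4)[OF simple_G] by (intro ext) blast
  qed
  then show ?thesis using diff \<Sigma>0 \<Delta>0 by linarith
qed

text \<open>The Perron vector of \<open>E\<close> is the test vector for \<open>Y_col\<close>.
  Equality of spectral radii forces equality in \<open>quad_shift_le\<close>, hence equality of the
  graphs and not merely isomorphism.\<close>

lemma spec_rad_le_Y_col:
  fixes p q :: nat
  assumes p: "p \<ge> 3" and q: "q \<ge> 1"
  defines "\<theta> \<equiv> (real p - 2) / (real p - 1)"
  shows "\<exists>h>0. \<forall>\<^sub>F n in sequentially. \<forall>E. simple_graph n E \<longrightarrow> \<not> contains_book n E p q \<longrightarrow> \<not> colorable n E p \<longrightarrow>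
    (1 - 1 / p) * (real n - (1 - \<theta>\<^sup>2) - h) \<le> spec_rad n E \<longrightarrow>
    (\<exists>c u0 u1 u2. Y_structure p n c u0 u1 u2 \<and> spec_rad n E \<le> spec_rad n (Y_col n c u0 u1 u2) \<and>
      (spec_rad n E = spec_rad n (Y_col n c u0 u1 u2) \<longrightarrow> E = Y_col n c u0 u1 u2))"
proof -
  have p2: "p \<ge> 2" using p by simp
  define a where "a = 1 - 1 / real p"
  have a: "a \<ge> 1/2" "a \<le> 1" using p by (auto simp: a_def field_simps)
  define K where "K = real p * (real p + 1)^2"
  have Kp: "K \<ge> 16 * p"
  proof -
    have "(4::real)^2 \<le> (real p + 1)^2" using p by (intro power_mono) auto
    then have "real p * 16 \<le> real p * (real p + 1)^2" by (intro mult_left_mono) auto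
    then show ?thesis by (simp add: K_def mult.commute)
  qed
  have K48: "K \<ge> 48" using Kp p by linarith
  \<comment> \<open>Meets the smallness condition of \<open>bad_vertex_neighbourhoods\<close> with
    equality and makes the slack \<zeta> below a small fraction of \<open>1 / p\<close>, the gap
    between the degree levels of \<open>u0\<close> and of the other vertices.\<close>
  define \<epsilon> where "\<epsilon> = 1 / (100 * K)"
  have \<epsilon>: "\<epsilon> > 0" "100 * p * (real p + 1)^2 * \<epsilon> \<le> 1" "\<epsilon> \<le> 1/1000"
    using K48 by (auto simp: \<epsilon>_def K_def field_simps)
  have \<epsilon>p: "1600 * \<epsilon> \<le> 1 / p"
  proof -
    have "1600 / (100 * K) \<le> 1600 / (100 * (16 * p))" using Kp p by (intro divide_left_mono) auto
    then show ?thesis by (simp add: \<epsilon>_def)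
  qed
  define \<eta> where "\<eta> = \<epsilon> / 2"
  have \<eta>: "\<eta> > 0" "\<eta> \<le> 1" using \<epsilon> by (auto simp: \<eta>_def)
  have \<theta>: "1/2 \<le> \<theta>" "\<theta> \<le> 1 - 1 / p" using p by (auto simp: \<theta>_def field_simps)
  have \<epsilon>4: "\<epsilon> \<le> 1 / (4 * p^2)"
  proof -
    have "4 * (p * p) \<le> 100 * K"
    proof -
      have "real p * p \<le> real p * (real p + 1)^2" by (intro mult_left_mono) (auto simp: power2_eq_square algebra_simps)
      then show ?thesis using p by (simp add: K_def)
    qed
    then show ?thesis using p unfolding \<epsilon>_def power2_eq_square by (intro divide_left_mono) (auto simp: K_def)
  qed
  define \<zeta> where "\<zeta> = 8 * (real p + 1)^2 * \<epsilon>"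
  have \<zeta>: "\<zeta> = 8 / 100 * (1 / p)" using p by (simp add: \<zeta>_def \<epsilon>_def K_def)
  obtain h where h: "h > 0" and ev: "\<forall>\<^sub>F n in sequentially. \<forall>E x. simple_graph n E \<longrightarrow> \<not> contains_book n E p q \<longrightarrow> \<not> colorable n E p \<longrightarrow>
    perron n E x \<longrightarrow> (1 - 1 / p) * (real n - (1 - \<theta>\<^sup>2) - h) \<le> spec_rad n E \<longrightarrow>
    (\<exists>u0<n. \<bar>x u0 - \<theta>\<bar> \<le> \<eta> \<and> (\<forall>v<n. v \<noteq> u0 \<longrightarrow> 1 - \<eta> \<le> x v) \<and>
      (\<forall>v<n. \<bar>x v - deg n E v / ((1 - 1 / p) * n)\<bar> \<le> \<eta>))"
    using one_bad_vertex[OF p q \<eta>] unfolding \<theta>_def by blast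
  have "\<forall>\<^sub>F n in sequentially. 2 * real (p + 1) * q + real q + 1 \<le> \<epsilon> * real n" using \<epsilon>(1) by real_asymp
  then have "\<forall>\<^sub>F n in sequentially. \<forall>E. simple_graph n E \<longrightarrow> \<not> contains_book n E p q \<longrightarrow> \<not> colorable n E p \<longrightarrow>
    (1 - 1 / p) * (real n - (1 - \<theta>\<^sup>2) - h) \<le> spec_rad n E \<longrightarrow>
    (\<exists>c u0 u1 u2. Y_structure p n c u0 u1 u2 \<and> spec_rad n E \<le> spec_rad n (Y_col n c u0 u1 u2) \<and>
      (spec_rad n E = spec_rad n (Y_col n c u0 u1 u2) \<longrightarrow> E = Y_col n c u0 u1 u2))"
    using ev eventually_gt_at_top[of 0]
  proof (eventually_elim, intro allI impI)
    fix n E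
    assume n: "2 * real (p + 1) * q + real q + 1 \<le> \<epsilon> * real n" and n0: "0 < n"
      and one: "\<forall>E x. simple_graph n E \<longrightarrow> \<not> contains_book n E p q \<longrightarrow> \<not> colorable n E p \<longrightarrow>
        perron n E x \<longrightarrow> (1 - 1 / p) * (real n - (1 - \<theta>\<^sup>2) - h) \<le> spec_rad n E \<longrightarrow>
        (\<exists>u0<n. \<bar>x u0 - \<theta>\<bar> \<le> \<eta> \<and> (\<forall>v<n. v \<noteq> u0 \<longrightarrow> 1 - \<eta> \<le> x v) \<and>
          (\<forall>v<n. \<bar>x v - deg n E v / ((1 - 1 / p) * n)\<bar> \<le> \<eta>))"
      and E: "simple_graph n E" and nb: "\<not> contains_book n E p q" and nc: "\<not> colorable n E p"
      and \<rho>: "(1 - 1 / p) * (real n - (1 - \<theta>\<^sup>2) - h) \<le> spec_rad n E"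
    obtain x where x: "perron n E x" using perron_exists[OF E n0] by blast
    obtain u0 where u0: "u0 < n" and x0: "\<bar>x u0 - \<theta>\<bar> \<le> \<eta>" and xv: "\<And>v. v < n \<Longrightarrow> v \<noteq> u0 \<Longrightarrow> 1 - \<eta> \<le> x v"
      and ent: "\<And>v. v < n \<Longrightarrow> \<bar>x v - deg n E v / (a * n)\<bar> \<le> \<eta>"
      using one[rule_format, OF E nb nc x \<rho>] unfolding a_def by blast
    have an: "a * n > 0" using a n0 by simp
    have lb: "(t * a - \<epsilon>) * n \<le> deg n E v" if "v < n" "t - \<eta> \<le> x v" for v and t :: real
    proof -
      have "t - \<epsilon> \<le> deg n E v / (a * n)" using ent[OF that(1)] that(2) unfolding \<eta>_def by linarith
      then have "(t - \<epsilon>) * (a * n) \<le> deg n E v" using an by (simp add: pos_le_divide_eq)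
      moreover have "\<epsilon> * a * n \<le> \<epsilon> * n" using a \<epsilon> n0 by simp
      ultimately show ?thesis by (simp add: algebra_simps)
    qed
    have d: "deg n E v \<ge> (1 - 1 / p - \<epsilon>) * n" if "v < n" "v \<noteq> u0" for v
      using lb[OF that(1) xv[OF that]] by (simp add: a_def)
    have "\<theta> * a = 1 - 2 / p" using p by (simp add: \<theta>_def a_def field_simps)
    then have d0: "deg n E u0 \<ge> (1 - 2 / p - \<epsilon>) * n" using lb[OF u0, of \<theta>] x0 by (simp add: abs_le_iff)
    have nn: "0 \<le> 2 * real (p + 1) * q" "0 \<le> real q" by auto
    have n2: "2 * real (p + 1) * q \<le> \<epsilon> * n" "real q + 1 \<le> \<epsilon> * n" "1 \<le> \<epsilon> * n" using n nn by linarith+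
    \<comment> \<open>Only \<open>u0\<close> has low degree now, so for all other vertices both
      thresholds of \<open>partial_colouring\<close> hold with room to spare.\<close>
    have "\<exists>c. (\<forall>v\<in>{..<n} - {u0}. c v < p) \<and> (\<forall>u\<in>{..<n} - {u0}. \<forall>v\<in>{..<n} - {u0}. E u v \<longrightarrow> c u \<noteq> c v)"
    proof (rule partial_colouring[OF E nb p2 q \<epsilon>(1) \<epsilon>4 n2(1), where L = "{u0}" and \<eta> = \<zeta>])
      show "{u0} \<subseteq> {..<n}" using u0 by simp
      show "real (card {u0}) \<le> \<epsilon> * n" using n2(3) by simp
      show "8 * (real p + 1)^2 * \<epsilon> \<le> \<zeta>" by (simp add: \<zeta>_def)
      have i1: "1 - 2 / p + \<zeta> \<le> 1 - 1 / p - \<epsilon>" and i2: "2 - 3 / p + \<zeta> \<le> (1 - 1 / p - \<epsilon>) + (1 - 1 / p - \<epsilon>)"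
        unfolding \<zeta> using \<epsilon>p \<epsilon>(1) by (auto simp: field_simps)
      show "(1 - 2 / p + \<zeta>) * n \<le> deg n E v" if "v \<in> {..<n} - {u0}" for v
        by (rule order_trans[OF mult_right_mono[OF i1, of "real n"] d]) (use that in auto)
      show "(2 - 3 / p + \<zeta>) * n \<le> real (deg n E u) + deg n E v" if "u \<in> {..<n} - {u0}" "v \<in> {..<n} - {u0}" for u v
      proof -
        have "(1 - 1 / p - \<epsilon> + (1 - 1 / p - \<epsilon>)) * n \<le> real (deg n E u) + deg n E v"
          unfolding distrib_right using d[of u] d[of v] that by (intro add_mono) auto
        with mult_right_mono[OF i2, of "real n"] show ?thesis by (meson of_nat_0_le_iff order_trans)
      qed
      show "(1 - 1 / p - \<epsilon>) * n \<le> deg n E v" if "v < n" "v \<notin> {u0}" for v using d that by simp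
    qed auto
    then obtain c where c: "\<And>v. v < n \<Longrightarrow> v \<noteq> u0 \<Longrightarrow> c v < p"
      "\<And>u v. u < n \<Longrightarrow> v < n \<Longrightarrow> u \<noteq> u0 \<Longrightarrow> v \<noteq> u0 \<Longrightarrow> E u v \<Longrightarrow> c u \<noteq> c v" by auto
    have "\<exists>i1<p. \<exists>i2<p. i1 \<noteq> i2 \<and> (\<forall>i<p. \<exists>w\<in>part n c u0 i. E u0 w) \<and>
       (\<forall>u\<in>part n c u0 i1. \<forall>v\<in>part n c u0 i2. E u0 u \<longrightarrow> E u0 v \<longrightarrow> \<not> E u v)"
      by (rule bad_vertex_neighbourhoods[OF E nb nc p q u0 \<epsilon>(1,2) n2(2)]) (use c d d0 in blast)+
    then obtain i1 i2 where i: "i1 < p" "i2 < p" "i1 \<noteq> i2" and nbr: "\<forall>i<p. \<exists>w\<in>part n c u0 i. E u0 w"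
      and sep: "\<forall>u\<in>part n c u0 i1. \<forall>v\<in>part n c u0 i2. E u0 u \<longrightarrow> E u0 v \<longrightarrow> \<not> E u v" by blast
    obtain u1 u2 where u: "u1 \<in> part n c u0 i1" "E u0 u1" "u2 \<in> part n c u0 i2" "E u0 u2" using nbr i by metis
    have u': "u1 < n" "u1 \<noteq> u0" "c u1 = i1" "u2 < n" "u2 \<noteq> u0" "c u2 = i2" using u by (auto simp: part_def)
    have Y: "Y_structure p n c u0 u1 u2" using p2 u0 u' i c(1) by unfold_locales auto
    have "0 < 1 / real p" using p by simp
    \<comment> \<open>The edge shift needs \<open>x u0\<close> strictly below \<open>x u1\<close>
      and \<open>x u2\<close>; \<theta> stays below 1 by at least \<open>1 / p\<close>, which is
      large on the scale of \<eta>.\<close>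
    then have gap: "\<theta> + \<eta> < 1 - \<eta>" using \<theta>(2) \<epsilon>p \<epsilon>(1) unfolding \<eta>_def by linarith
    have pos: "0 < x v" if "v < n" for v
    proof (cases "v = u0")
      case True
      then show ?thesis using x0 \<theta>(1) \<epsilon>(3) unfolding \<eta>_def True by linarith
    next
      case False
      then show ?thesis using xv[OF that False] \<epsilon>(3) unfolding \<eta>_def by linarith
    qed
    have q1: "quad n E x \<le> quad n (Y_col n c u0 u1 u2) x \<and>
        (quad n E x = quad n (Y_col n c u0 u1 u2) x \<longrightarrow> E = Y_col n c u0 u1 u2)"
    proof (rule quad_shift_le[OF E Y _ u(2,4) _ pos])
      show "c u \<noteq> c v" if "u < n" "v < n" "u \<noteq> u0" "v \<noteq> u0" "E u v" for u v using c(2) that by blast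
      show "\<not> E u v" if "u \<in> part n c u0 (c u1)" "v \<in> part n c u0 (c u2)" "E u0 u" "E u0 v" for u v
        using sep that u' by blast
      show "x u0 < x u1" using xv[OF u'(1,2)] x0 gap by linarith
      show "x u0 < x u2" using xv[OF u'(4,5)] x0 gap by linarith
    qed
    have q2: "quad n (Y_col n c u0 u1 u2) x \<le> spec_rad n (Y_col n c u0 u1 u2) * n"
      using quad_le_spec_rad[OF Y_structure.simple_G[OF Y] n0, of x] x by (simp add: perron_def)
    have q3: "quad n E x = spec_rad n E * n" by (rule quad_perron[OF x])
    have "spec_rad n E * n \<le> spec_rad n (Y_col n c u0 u1 u2) * n" using q1 q2 q3 by linarith
    then have "spec_rad n E \<le> spec_rad n (Y_col n c u0 u1 u2)" using n0 by simp
    moreover have "E = Y_col n c u0 u1 u2" if "spec_rad n E = spec_rad n (Y_col n c u0 u1 u2)"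
      using q1 q2 q3 that by simp
    ultimately show "\<exists>c u0 u1 u2. Y_structure p n c u0 u1 u2 \<and> spec_rad n E \<le> spec_rad n (Y_col n c u0 u1 u2) \<and>
      (spec_rad n E = spec_rad n (Y_col n c u0 u1 u2) \<longrightarrow> E = Y_col n c u0 u1 u2)" using Y by blast
  qed
  then show ?thesis using h by blast
qed

section \<open>Comparison with \<open>Y_graph\<close>\<close>

lemma spec_rad_Y_graph_lower:
  fixes p :: nat and \<eta> :: real
  assumes p: "p \<ge> 3" and \<eta>: "\<eta> > 0"
  defines "\<theta> \<equiv> (real p - 2) / (real p - 1)"
  shows "\<forall>\<^sub>F n in sequentially. (1 - 1 / p) * (real n - (1 - \<theta>\<^sup>2) - \<eta>) \<le> spec_rad n (Y_graph p n)"
proof -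
  have p2: "p \<ge> 2" using p by simp
  show ?thesis using spec_rad_Y_lower[OF p2 \<eta>] eventually_gt_at_top[of p]
  proof eventually_elim
    fix n
    assume L: "\<forall>c u0 u1 u2. Y_structure p n c u0 u1 u2 \<longrightarrow>
      (\<forall>i<p. \<bar>card (part n c u0 i) - (real n - 1) / p\<bar> \<le> 1) \<longrightarrow>
      (1 - 1 / p) * (real n - (1 - ((real p - 2) / (real p - 1))\<^sup>2) - \<eta>) \<le> spec_rad n (Y_col n c u0 u1 u2)"
      and n: "p < n"
    have "\<bar>card (part n (\<lambda>v. (v - 1) mod p) 0 i) - (real n - 1) / p\<bar> \<le> 1" if i: "i < p" for i
    proof -
      define k r where "k = (n - 1) div p" and "r = (n - 1) mod p"
      have "real (n - 1) = real (k * p + r)" by (simp add: k_def r_def)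
      then have "(real n - 1) / p = k + r / p" using n p by (simp add: of_nat_diff field_simps)
      moreover have "r < p" using p by (simp add: r_def)
      then have "0 \<le> r / p" "r / p \<le> 1" by (auto simp: divide_le_eq)
      moreover have "real (card (part n (\<lambda>v. (v - 1) mod p) 0 i)) = k + of_bool (i < r)"
        using Y_graph_sizes[OF i, of n] by (simp add: k_def r_def)
      ultimately show ?thesis by (cases "i < r") auto
    qed
    then show "(1 - 1 / p) * (real n - (1 - \<theta>\<^sup>2) - \<eta>) \<le> spec_rad n (Y_graph p n)"
      unfolding Y_graph_eq[OF p] \<theta>_def using L Y_graph_structure[OF p n] by blast
  qed
qed

theorem theorem1p4:
  fixes p q :: nat
  assumes "p \<ge> 3" and "q \<ge> 1"
  shows "\<exists>N. \<forall>n\<ge>N. \<forall>E. simple_graph n E \<and> \<not> colorable n E p \<and> \<not> contains_book n E p q \<longrightarrow>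
           spec_rad n E \<le> spec_rad n (Y_graph p n) \<and>
           (spec_rad n E = spec_rad n (Y_graph p n) \<longleftrightarrow> graph_iso n E (Y_graph p n))"
proof -
  note p = assms(1)
  define \<theta> where "\<theta> = (real p - 2) / (real p - 1)"
  obtain h where h: "h > 0" and S: "\<forall>\<^sub>F n in sequentially. \<forall>E. simple_graph n E \<longrightarrow> \<not> contains_book n E p q \<longrightarrow> \<not> colorable n E p \<longrightarrow>
    (1 - 1 / p) * (real n - (1 - \<theta>\<^sup>2) - h) \<le> spec_rad n E \<longrightarrow>
    (\<exists>c u0 u1 u2. Y_structure p n c u0 u1 u2 \<and> spec_rad n E \<le> spec_rad n (Y_col n c u0 u1 u2) \<and>
      (spec_rad n E = spec_rad n (Y_col n c u0 u1 u2) \<longrightarrow> E = Y_col n c u0 u1 u2))"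
    using spec_rad_le_Y_col[OF assms] unfolding \<theta>_def by blast
  have "\<forall>\<^sub>F n in sequentially. \<forall>E. simple_graph n E \<and> \<not> colorable n E p \<and> \<not> contains_book n E p q \<longrightarrow>
           spec_rad n E \<le> spec_rad n (Y_graph p n) \<and>
           (spec_rad n E = spec_rad n (Y_graph p n) \<longleftrightarrow> graph_iso n E (Y_graph p n))"
    \<comment> \<open>This value of \<open>C0\<close> brings the threshold
      \<open>(1 - 1/p) * (n - (1 - \<theta>\<^sup>2) - h)\<close> into the form
      \<open>(1 - 1/p) * n - C0\<close>.\<close>
    using S spec_rad_Y_graph_lower[OF p h] spec_rad_Y_le[OF p, of "(1 - 1 / p) * ((1 - \<theta>\<^sup>2) + h)"] eventually_gt_at_top[of p]
  proof (eventually_elim, intro allI impI)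
    fix n E
    assume S: "\<forall>E. simple_graph n E \<longrightarrow> \<not> contains_book n E p q \<longrightarrow> \<not> colorable n E p \<longrightarrow>
      (1 - 1 / p) * (real n - (1 - \<theta>\<^sup>2) - h) \<le> spec_rad n E \<longrightarrow>
      (\<exists>c u0 u1 u2. Y_structure p n c u0 u1 u2 \<and> spec_rad n E \<le> spec_rad n (Y_col n c u0 u1 u2) \<and>
        (spec_rad n E = spec_rad n (Y_col n c u0 u1 u2) \<longrightarrow> E = Y_col n c u0 u1 u2))"
      and lower: "(1 - 1 / p) * (real n - (1 - ((real p - 2) / (real p - 1))\<^sup>2) - h) \<le> spec_rad n (Y_graph p n)"
      and Yle: "\<forall>c u0 u1 u2. Y_structure p n c u0 u1 u2 \<longrightarrow>
        (1 - 1 / p) * n - (1 - 1 / p) * ((1 - \<theta>\<^sup>2) + h) \<le> spec_rad n (Y_col n c u0 u1 u2) \<longrightarrow>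
        spec_rad n (Y_col n c u0 u1 u2) < spec_rad n (Y_graph p n) \<or> graph_iso n (Y_col n c u0 u1 u2) (Y_graph p n)"
      and n: "p < n"
      and E': "simple_graph n E \<and> \<not> colorable n E p \<and> \<not> contains_book n E p q"
    then have E: "simple_graph n E" "\<not> contains_book n E p q" "\<not> colorable n E p" by auto
    let ?Y = "Y_graph p n"
    have sY: "simple_graph n ?Y"
      unfolding Y_graph_eq[OF p] by (rule Y_structure.simple_G[OF Y_graph_structure[OF p n]])
    have iso_eq: "spec_rad n F = spec_rad n ?Y" if "graph_iso n F ?Y" "simple_graph n F" for F
      using graph_iso_spec_rad[OF that sY] .
    show "spec_rad n E \<le> spec_rad n ?Y \<and> (spec_rad n E = spec_rad n ?Y \<longleftrightarrow> graph_iso n E ?Y)"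
    proof (cases "spec_rad n E < spec_rad n ?Y")
      case True
      then show ?thesis using iso_eq[OF _ E(1)] by auto
    next
      \<comment> \<open>Only a graph with at least the spectral radius of \<open>Y_graph\<close>
        needs analysis, and it inherits the lower bound known for \<open>Y_graph\<close>.\<close>
      case False
      then have \<rho>: "(1 - 1 / p) * (real n - (1 - \<theta>\<^sup>2) - h) \<le> spec_rad n E" using lower by (simp add: \<theta>_def)
      then obtain c u0 u1 u2 where Y: "Y_structure p n c u0 u1 u2"
        and le: "spec_rad n E \<le> spec_rad n (Y_col n c u0 u1 u2)"
        and eq: "spec_rad n E = spec_rad n (Y_col n c u0 u1 u2) \<Longrightarrow> E = Y_col n c u0 u1 u2"
        using S E by blast
      have "(1 - 1 / p) * n - (1 - 1 / p) * ((1 - \<theta>\<^sup>2) + h) \<le> spec_rad n (Y_col n c u0 u1 u2)"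
        using \<rho> le by (simp add: algebra_simps)
      \<comment> \<open>\<open>Y_col\<close> has at least the spectral radius of \<open>E\<close>,
        hence that of \<open>Y_graph\<close>, so only the isomorphism alternative remains.\<close>
      then have iso: "graph_iso n (Y_col n c u0 u1 u2) ?Y" using Yle Y le False by force
      then have "spec_rad n (Y_col n c u0 u1 u2) = spec_rad n ?Y"
        using iso_eq Y_structure.simple_G[OF Y] by blast
      then show ?thesis using le eq iso False by auto
    qed
  qed
  then show ?thesis by (simp add: eventually_sequentially)
qed

end
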